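(* For all integers $n\geq 0$, \[ M_{\omega}(1,5,5n+2)-M_{\omega}(4,5,5n+2)=2NT(3,5,5n+2)-2NT(2,5,5n+2). \]
   Context: For a partition $\pi$ of a positive integer $n$ (written $\pi\vdash n$), let $\#(\pi)$ be the number of parts, $\lambda(\pi)$ the largest part, $\omega(\pi)$ the number of parts equal to $1$, and $\mu(\pi)$ the number of parts larger than $\omega(\pi)$. The rank is $\mathrm{rank}(\pi)=\lambda(\pi)-\#(\pi)$. The crank is $\mathrm{crank}(\pi)=\lambda(\pi)$ if $\omega(\pi)=0$ and $\mathrm{crank}(\pi)=\mu(\pi)-\omega(\pi)$ otherwise. For integers $m$, $j\ge1$, $n\ge0$: $NT(m,j,n)=\sum_{\pi\vdash n,\ \mathrm{rank}(\pi)\equiv m \ (\mathrm{mod}\ j)}\#(\pi)$ and $M_{\omega}(m,j,n)=\sum_{\pi\vdash n,\ \mathrm{crank}(\pi)\equiv m\ (\mathrm{mod}\ j)}\omega(\pi)$. *)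

theory Defs
  imports "HOL-Library.Multiset" "HOL-Number_Theory.Cong"
begin

(* A partition of n is represented by the multiset of its parts. *)

definition partitions :: "nat \<Rightarrow> nat multiset set" where
  "partitions n = {\<pi>. (\<forall>p\<in>#\<pi>. 0 < p) \<and> sum_mset \<pi> = n}"

abbreviation num_parts :: "nat multiset \<Rightarrow> nat" where
  "num_parts \<pi> \<equiv> size \<pi>"

(* Convention: the empty partition has largest part 0. *)

definition largest_part :: "nat multiset \<Rightarrow> nat" where
  "largest_part \<pi> = (if \<pi> = {#} then 0 else Max (set_mset \<pi>))"

definition num_ones :: "nat multiset \<Rightarrow> nat" where
  "num_ones \<pi> = count \<pi> 1"

(* Parts are counted with multiplicity. *)

definition num_parts_gt_ones :: "nat multiset \<Rightarrow> nat" where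
  "num_parts_gt_ones \<pi> = size {#p \<in># \<pi>. num_ones \<pi> < p#}"

definition partition_rank :: "nat multiset \<Rightarrow> int" where
  "partition_rank \<pi> = int (largest_part \<pi>) - int (num_parts \<pi>)"

definition partition_crank :: "nat multiset \<Rightarrow> int" where
  "partition_crank \<pi> =
     (if num_ones \<pi> = 0 then int (largest_part \<pi>)
      else int (num_parts_gt_ones \<pi>) - int (num_ones \<pi>))"

definition NT :: "int \<Rightarrow> int \<Rightarrow> nat \<Rightarrow> int" where
  "NT m j n = (\<Sum>\<pi> | \<pi> \<in> partitions n \<and> [partition_rank \<pi> = m] (mod j). int (num_parts \<pi>))"

definition M_omega :: "int \<Rightarrow> int \<Rightarrow> nat \<Rightarrow> int" where
  "M_omega m j n = (\<Sum>\<pi> | \<pi> \<in> partitions n \<and> [partition_crank \<pi> = m] (mod j). int (num_ones \<pi>))"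

(* The sums above therefore range over finite sets. *)

lemma finite_partitions: "finite (partitions n)"
proof (rule finite_subset)
  show "partitions n \<subseteq> mset ` {xs. set xs \<subseteq> {..n} \<and> length xs \<le> n}"
  proof
    fix \<pi> assume "\<pi> \<in> partitions n"
    then have pos: "\<forall>p\<in>#\<pi>. 0 < p" and sum: "sum_mset \<pi> = n"
      by (auto simp: partitions_def)
    obtain xs where xs: "\<pi> = mset xs"
      by (metis ex_mset)
    have "length xs \<le> sum_list xs" if "\<forall>p\<in>set xs. 0 < p" for xs :: "nat list"
      using that by (induction xs) auto
    moreover have "set xs \<subseteq> {..sum_list xs}"
      using member_le_sum_list by auto
    ultimately show "\<pi> \<in> mset ` {xs. set xs \<subseteq> {..n} \<and> length xs \<le> n}"
      using pos sum xs by (auto simp: sum_mset_sum_list)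
  qed
  show "finite (mset ` {xs. set xs \<subseteq> {..n} \<and> length xs \<le> n})"
    by (intro finite_imageI finite_lists_length_le) auto
qed

end

theory Submission
  imports "HOL-Complex_Analysis.Complex_Analysis" Defs
begin

text \<open>
  Let \<open>\<zeta>\<close> be a primitive fifth root of unity. The coefficient of \<open>q^n\<close> in the difference of the two sides, for all residues of \<open>n\<close> at once, is the derivative
  at \<open>z = 1\<close> of a \<open>\<zeta>\<close>-weighted combination of the crank product \<open>C(\<zeta>^j z; q)\<close> and the rank generating function \<open>R(\<zeta>^j z; q)\<close>: on the rank side
  conjugation of partitions turns the difference of the numbers of parts into a sum of ranks, and on the crank side the number of ones comes from the logarithmic
  derivative of the crank product. Both functions are Lambert series in \<open>z\<close>, and the weighting turns them into Lambert series with denominators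
  \<open>1 - z^5 q^(5m)\<close>. Splitting these modulo 5 by partial fractions of theta quotients, and extracting the powers \<open>q^(5n+2)\<close>, leaves a
  quotient of theta functions of base \<open>q^25\<close> in \<open>z^5\<close>. Its numerator and denominator both vanish at \<open>z = 1\<close>, and by three Weierstrass relations their
  second-order expansions in \<open>u = log z\<close> are proportional up to order two, so that the quotient has derivative zero there.
\<close>

section \<open>Sums over the integers\<close>

text \<open>The argument runs with convergent series in a disc, and only the isolation of zeros of
  power series returns to coefficients at the end. With y = q^5 fixed and Q = y^5, all theta
  functions that survive the splitting depend on y alone, so passing to a conjugate
  \<open>root5 ^ k * q\<close> touches only explicit powers of q. The obstacle lies on the rank
  side: its Lambert series have level three (the theta weight occurs cubed), and two of the pieces
  are not theta quotients. They occur multiplied by exactly r - q - q^2/r, where \<open>r\<close> is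
  a theta quotient in y and (q;q)_inf = J (r - q - q^2/r). Dividing by (q;q)_inf therefore leaves
  them with the bare powers q^3 and q^4, and the residue class 2 does not see them. In the remaining
  theta part the same factor is cleared by a quartic in q with coefficients in y; its product with
  the factor is \<open>Mc\<close>, a function of y and r.\<close>

lemma infsum_dominated_convergence:
  fixes f :: "nat \<Rightarrow> 'a \<Rightarrow> complex"
  assumes lim: "\<And>x. x \<in> A \<Longrightarrow> (\<lambda>N. f N x) \<longlonglongrightarrow> l x"
    and bound: "\<And>N x. x \<in> A \<Longrightarrow> norm (f N x) \<le> g x"
    and g: "g summable_on A"
  shows "(\<lambda>N. infsum (f N) A) \<longlonglongrightarrow> infsum l A"
proof -
  have gnn: "g x \<ge> 0" if "x \<in> A" for x
    using bound[OF that, of 0] by (meson norm_ge_zero order_trans)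
  have lb: "norm (l x) \<le> g x" if "x \<in> A" for x
    using tendsto_norm[OF lim[OF that]] bound[OF that] LIMSEQ_le_const2 by blast
  have "(\<lambda>x. norm (g x)) summable_on A"
    by (rule summable_on_cong[THEN iffD1, OF _ g]) (simp add: gnn)
  then have gi: "integrable (count_space A) g"
    using abs_summable_equivalent[of g A] unfolding Infinite_Set_Sum.abs_summable_on_def by blast
  have s1: "(\<lambda>x. norm (f N x)) summable_on A" for N
    by (rule summable_on_comparison_test[OF g]) (use bound in auto)
  have s2: "(\<lambda>x. norm (l x)) summable_on A"
    by (rule summable_on_comparison_test[OF g]) (use lb in auto)
  have e1: "infsum (f N) A = lebesgue_integral (count_space A) (f N)" for N
    using infsetsum_infsum[of "f N" A] s1[of N] abs_summable_equivalent[of "f N" A]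
    by (simp add: infsetsum_def)
  have e2: "infsum l A = lebesgue_integral (count_space A) l"
    using infsetsum_infsum[of l A] s2 abs_summable_equivalent[of l A]
    by (simp add: infsetsum_def)
  \<comment> \<open>Both infinite sums are integrals for the counting measure, so Tannery's theorem
    becomes Lebesgue dominated convergence.\<close>
  show ?thesis unfolding e1 e2
    by (rule integral_dominated_convergence[where w = g])
      (use gi lim bound in \<open>auto simp: AE_count_space\<close>)
qed

lemma bij_int_nat_halves:
  shows "range int \<union> range (\<lambda>n. - int n - 1) = UNIV" "range int \<inter> range (\<lambda>n. - int n - 1) = {}"
proof -
  have "x \<in> range int \<union> range (\<lambda>n. - int n - 1)" for x
  proof (cases "x \<ge> 0")
    case True then show ?thesis by (auto intro!: rev_image_eqI[of "nat x"])
  next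
    case False then show ?thesis by (intro UnI2 rev_image_eqI[of "nat (-x-1)"]) auto
  qed
  then show "range int \<union> range (\<lambda>n. - int n - 1) = UNIV" by blast
qed auto

lemma summable_on_int_halves:
  fixes f :: "int \<Rightarrow> 'a :: banach"
  assumes "summable (\<lambda>n. norm (f (int n)))" "summable (\<lambda>n. norm (f (- int n - 1)))"
  shows "(\<lambda>m. norm (f m)) summable_on UNIV"
proof -
  have 1: "(\<lambda>m. norm (f m)) summable_on range int"
    by (subst summable_on_reindex) (use assms(1) summable_on_UNIV_nonneg_real_iff in \<open>auto simp: o_def\<close>)
  have 2: "(\<lambda>m. norm (f m)) summable_on range (\<lambda>n. - int n - 1)"
    by (subst summable_on_reindex)
       (use assms(2) summable_on_UNIV_nonneg_real_iff in \<open>auto simp: o_def inj_on_def\<close>)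
  show ?thesis
    using summable_on_Un_disjoint[OF 1 2] bij_int_nat_halves by simp
qed

definition tri :: "int \<Rightarrow> int" where "tri m = m * (m + 1) div 2"

lemma two_tri: "2 * tri m = m * (m + 1)"
  unfolding tri_def by simp

lemma tri_eqI: "2 * a = m * (m + 1) \<Longrightarrow> tri m = a"
  using two_tri[of m] by simp

lemma tri_minus: "tri (- m - 1) = tri m"
  by (rule tri_eqI) (use two_tri[of m] in \<open>simp add: algebra_simps\<close>)

lemma tri_0 [simp]: "tri 0 = 0" by (simp add: tri_def)

lemma tri_add1: "tri (m + 1) = tri m + m + 1"
  by (rule tri_eqI) (use two_tri[of m] in \<open>simp add: algebra_simps\<close>)

text \<open>Ratio test: consecutive terms have ratio r^(d(n+1)) C, which tends to 0 whatever the
  size of C. This freedom in C admits every linear weight later.\<close>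

lemma summable_theta_half:
  fixes r C :: real
  assumes "0 < r" "r < 1" "C > 0" "d \<ge> (1::nat)"
  shows "summable (\<lambda>n. r powi (int d * tri (int n)) * C ^ n)"
proof -
  have r0: "r \<noteq> 0" using assms by simp
  have rat: "r powi (int d * tri (int (Suc n))) * C ^ Suc n =
        (r ^ Suc n) ^ d * C * (r powi (int d * tri (int n)) * C ^ n)" for n
  proof -
    have "int d * tri (int (Suc n)) = int d * tri (int n) + int (Suc n * d)"
      using tri_add1[of "int n"] by (simp add: algebra_simps)
    then have "r powi (int d * tri (int (Suc n))) = r powi (int d * tri (int n)) * r ^ (Suc n * d)"
      using r0 by (simp add: power_int_add del: mult_Suc of_nat_mult)
    then show ?thesis unfolding power_mult by simp
  qed
  have "(\<lambda>n. (r ^ Suc n) ^ d * C) \<longlonglongrightarrow> 0 ^ d * C"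
    using assms by (intro tendsto_intros LIMSEQ_Suc[OF LIMSEQ_power_zero]) auto
  then have "(\<lambda>n. (r ^ Suc n) ^ d * C) \<longlonglongrightarrow> 0"
    using assms by (simp add: zero_power)
  then have "eventually (\<lambda>n. (r ^ Suc n) ^ d * C < 1/2) sequentially"
    by (rule order_tendstoD) simp
  then obtain N where N: "\<And>n. n \<ge> N \<Longrightarrow> (r ^ Suc n) ^ d * C < 1/2"
    unfolding eventually_sequentially by blast
  show ?thesis
  proof (rule summable_ratio_test[of "1/2" N])
    fix n assume "n \<ge> N"
    have nn: "(r ^ Suc n) ^ d * C \<ge> 0" using assms by simp
    have nn2: "r powi (int d * tri (int n)) * C ^ n \<ge> 0" using assms by simp
    show "norm (r powi (int d * tri (int (Suc n))) * C ^ Suc n) \<le> 1/2 * norm (r powi (int d * tri (int n)) * C ^ n)"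
      unfolding rat norm_mult[of "(r ^ Suc n) ^ d * C"] using N[OF \<open>n \<ge> N\<close>] nn
      by (intro mult_right_mono) auto
  qed simp
qed

lemma summable_theta:
  fixes r C :: real
  assumes "0 < r" "r < 1" "C > 0" "d \<ge> (1::nat)"
  shows "(\<lambda>m. r powi (int d * tri m) * C powi m) summable_on UNIV"
proof -
  have "summable (\<lambda>n. norm (r powi (int d * tri (int n)) * C powi int n))"
    using summable_theta_half[OF assms] assms by simp
  moreover have "summable (\<lambda>n. norm (r powi (int d * tri (- int n - 1)) * C powi (- int n - 1)))"
  proof -
    have "C powi (- int n - 1) = inverse C ^ n * inverse C" for n
      using assms by (simp add: power_int_diff power_int_minus field_simps)
    then show ?thesis
      using summable_mult2[OF summable_theta_half[OF assms(1,2) _ assms(4), of "inverse C"], of "inverse C"] assms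
      by (simp add: tri_minus mult.assoc)
  qed
  ultimately have "(\<lambda>m. norm (r powi (int d * tri m) * C powi m)) summable_on UNIV"
    by (rule summable_on_int_halves)
  then show ?thesis using assms by simp
qed

section \<open>Infinite q-products\<close>

text \<open>The shifted factorial (x;q)_n; its limit (x;q)_inf is \<open>qinf\<close>.\<close>

definition qpf :: "complex \<Rightarrow> complex \<Rightarrow> nat \<Rightarrow> complex" where
  "qpf x q n = (\<Prod>k<n. 1 - x * q ^ k)"

definition qinf :: "complex \<Rightarrow> complex \<Rightarrow> complex" where
  "qinf x q = prodinf (\<lambda>k. 1 - x * q ^ k)"

lemma qpf_0 [simp]: "qpf x q 0 = 1" by (simp add: qpf_def)

lemma qpf_Suc: "qpf x q (Suc n) = qpf x q n * (1 - x * q ^ n)"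
  by (simp add: qpf_def)

lemma qpf_Suc': "qpf x q (Suc n) = (1 - x) * qpf (x * q) q n"
  unfolding qpf_def by (subst prod.lessThan_Suc_shift) (simp add: mult_ac)

lemma qpf_add: "qpf x q (m + n) = qpf x q m * qpf (x * q ^ m) q n"
  by (induction n) (simp_all add: qpf_Suc power_add mult_ac)

lemma qpf_nonzero: "(\<And>k. k < n \<Longrightarrow> x * q ^ k \<noteq> 1) \<Longrightarrow> qpf x q n \<noteq> 0"
  by (auto simp: qpf_def)

lemma convergent_prod_qinf:
  fixes q x :: complex
  assumes "norm q < 1"
  shows "convergent_prod (\<lambda>k. 1 - x * q ^ k)"
proof -
  have "summable (\<lambda>k. norm (- (x * q ^ k)))"
    unfolding norm_minus_cancel norm_mult norm_power using assms
    by (intro summable_mult summable_geometric) simp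
  then have "abs_convergent_prod (\<lambda>k. 1 + (- (x * q ^ k)))"
    by (simp add: summable_imp_abs_convergent_prod)
  then show ?thesis using abs_convergent_prod_imp_convergent_prod by fastforce
qed

lemma qpf_LIMSEQ:
  assumes "norm q < 1"
  shows "(\<lambda>n. qpf x q n) \<longlonglongrightarrow> qinf x q"
proof -
  have "(\<lambda>n. \<Prod>k\<le>n. 1 - x * q ^ k) \<longlonglongrightarrow> qinf x q"
    unfolding qinf_def by (rule convergent_prod_LIMSEQ[OF convergent_prod_qinf[OF assms]])
  then have "(\<lambda>n. qpf x q (Suc n)) \<longlonglongrightarrow> qinf x q"
    by (simp add: qpf_def lessThan_Suc_atMost)
  then show ?thesis by (rule LIMSEQ_imp_Suc)
qed

lemma qinf_nonzero:
  assumes "norm q < 1" "\<And>k. x * q ^ k \<noteq> 1"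
  shows "qinf x q \<noteq> 0"
  unfolding qinf_def by (rule prodinf_nonzero[OF convergent_prod_qinf]) (use assms in auto)

lemma qinf_rec:
  assumes "norm q < 1"
  shows "qinf x q = (1 - x) * qinf (x * q) q"
proof -
  have "(\<lambda>n. (1 - x) * qpf (x * q) q n) \<longlonglongrightarrow> qinf x q"
    using LIMSEQ_Suc[OF qpf_LIMSEQ[OF assms, of x]] by (simp add: qpf_Suc')
  moreover have "(\<lambda>n. (1 - x) * qpf (x * q) q n) \<longlonglongrightarrow> (1 - x) * qinf (x * q) q"
    by (intro tendsto_intros qpf_LIMSEQ assms)
  ultimately show ?thesis by (rule LIMSEQ_unique)
qed

lemma qinf_split:
  assumes "norm q < 1"
  shows "qinf x q = qpf x q n * qinf (x * q ^ n) q"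
proof (induction n)
  case (Suc n)
  then show ?case using qinf_rec[OF assms, of "x * q ^ n"] by (simp add: qpf_Suc mult_ac)
qed simp

text \<open>Convergence to a nonzero limit bounds the sequence from above, and convergence of the
  reciprocals bounds it away from 0. Such bounds supply the summable majorants below.\<close>

lemma qpf_bounds:
  assumes "norm q < 1" "\<And>k. x * q ^ k \<noteq> 1"
  obtains a b where "0 < a" "0 < b" "\<And>n. a \<le> norm (qpf x q n)" "\<And>n. norm (qpf x q n) \<le> b"
proof -
  have lim: "(\<lambda>n. qpf x q n) \<longlonglongrightarrow> qinf x q" by (rule qpf_LIMSEQ[OF assms(1)])
  have nz: "qpf x q n \<noteq> 0" for n by (rule qpf_nonzero) (use assms in auto)
  have "Bseq (\<lambda>n. qpf x q n)"
    using lim convergentI Bseq_eq_bounded convergent_imp_Bseq by blast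
  then obtain b where b: "b > 0" "\<And>n. norm (qpf x q n) \<le> b" unfolding Bseq_def by blast
  have "(\<lambda>n. inverse (qpf x q n)) \<longlonglongrightarrow> inverse (qinf x q)"
    by (intro tendsto_inverse lim qinf_nonzero assms)
  then have "Bseq (\<lambda>n. inverse (qpf x q n))"
    using convergentI convergent_imp_Bseq by blast
  then obtain c where c: "c > 0" "\<And>n. norm (inverse (qpf x q n)) \<le> c" unfolding Bseq_def by blast
  have "inverse c \<le> norm (qpf x q n)" for n
    using c(1) c(2)[of n] nz[of n] by (simp add: norm_inverse norm_divide divide_simps mult.commute)
  with b c show ?thesis by (intro that[of "inverse c" b]) auto
qed

lemma qpf_bound:
  assumes "norm q < 1"
  obtains b where "0 < b" "\<And>n. norm (qpf x q n) \<le> b"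
proof -
  have "Bseq (\<lambda>n. qpf x q n)"
    using qpf_LIMSEQ[OF assms, of x] convergentI convergent_imp_Bseq by blast
  then show ?thesis unfolding Bseq_def using that by blast
qed

lemma qinf_holomorphic:
  assumes "norm q < 1"
  shows "(\<lambda>x. qinf x q) holomorphic_on UNIV"
proof -
  have "(\<lambda>x. qinf x q) holomorphic_on ball 0 R" if "R > 0" for R
  proof -
    have "uniformly_convergent_on (cball 0 R) (\<lambda>N x. \<Sum>n<N. norm (1 - x * q ^ n - 1))"
    proof (rule Weierstrass_m_test')
      show "norm (norm (1 - x * q ^ n - 1)) \<le> R * norm q ^ n" if "x \<in> cball 0 R" for n x
        using that by (simp add: norm_mult norm_power mult_right_mono)
      show "summable (\<lambda>n. R * norm q ^ n)"
        using assms by (simp add: summable_mult summable_geometric)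
    qed
    then have "uniformly_convergent_on (cball 0 R) (\<lambda>N x. \<Prod>n<N. 1 - x * q ^ n)"
      by (intro uniformly_convergent_on_prod') (auto intro!: continuous_intros)
    then obtain g where g: "uniform_limit (cball 0 R) (\<lambda>N x. \<Prod>n<N. 1 - x * q ^ n) g sequentially"
      unfolding uniformly_convergent_on_def by blast
    have eq: "g x = qinf x q" if "x \<in> cball 0 R" for x
      using tendsto_uniform_limitI[OF g that] qpf_LIMSEQ[OF assms, of x]
      unfolding qpf_def by (rule LIMSEQ_unique)
    have "continuous_on (cball 0 R) g \<and> g holomorphic_on ball 0 R"
      by (rule holomorphic_uniform_limit[OF _ g])
         (auto intro!: always_eventually continuous_intros holomorphic_intros)
    then have "g holomorphic_on ball 0 R" by blast
    then show ?thesis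
      by (rule holomorphic_transform) (use eq in auto)
  qed
  then have "(\<lambda>x. qinf x q) field_differentiable (at x)" for x
  proof -
    have "x \<in> ball 0 (norm x + 1)" by simp
    moreover have "(\<lambda>x. qinf x q) holomorphic_on ball 0 (norm x + 1)"
      by (rule \<open>\<And>R. R > 0 \<Longrightarrow> _\<close>) (simp add: add_nonneg_pos)
    ultimately show ?thesis
      using holomorphic_on_imp_differentiable_at by blast
  qed
  then show ?thesis by (simp add: holomorphic_on_def field_differentiable_at_within)
qed

lemma qinf_holomorphic' [holomorphic_intros]:
  assumes "norm q < 1" "f holomorphic_on A"
  shows "(\<lambda>x. qinf (f x) q) holomorphic_on A"
  using holomorphic_on_compose_gen[OF assms(2) qinf_holomorphic[OF assms(1)]] by (auto simp: o_def)

text \<open>Jacobi's theta function without the factor (q;q)_inf of the triple product. For nonzero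
  q and x its zeros are the integer powers of q.\<close>

definition jth :: "complex \<Rightarrow> complex \<Rightarrow> complex" where
  "jth q x = qinf x q * qinf (q / x) q"

lemma jth_shift:
  assumes "norm q < 1" "q \<noteq> 0" "x \<noteq> 0"
  shows "jth q (x * q) = - jth q x / x"
proof -
  have 1: "qinf x q = (1 - x) * qinf (x * q) q" by (rule qinf_rec[OF assms(1)])
  have 2: "qinf (q / (x * q)) q = (1 - 1 / x) * qinf (q / x) q"
    using qinf_rec[OF assms(1), of "1 / x"] assms by simp
  show ?thesis
    unfolding jth_def 2 1 using assms by (simp add: divide_simps) (simp add: algebra_simps)
qed

lemma jth_inverse:
  assumes "q \<noteq> 0" "x \<noteq> 0"
  shows "jth q (q / x) = jth q x"
  using assms by (simp add: jth_def)

lemma jth_nonzero: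
  assumes "norm q < 1" "q \<noteq> 0" "x \<noteq> 0" "\<And>m. x * q powi m \<noteq> 1"
  shows "jth q x \<noteq> 0"
proof -
  have "x * q ^ k \<noteq> 1" for k using assms(4)[of "int k"] by simp
  moreover have "q / x * q ^ k \<noteq> 1" for k
  proof
    assume h: "q / x * q ^ k = 1"
    have "x * q powi (- int (Suc k)) = x / (q * q ^ k)"
      using assms by (simp add: power_int_minus divide_inverse del: of_nat_Suc)
    also have "\<dots> = 1" using h assms by (simp add: field_simps)
    finally show False using assms(4) by blast
  qed
  ultimately show ?thesis unfolding jth_def using assms by (simp add: qinf_nonzero)
qed

section \<open>Partial fractions of theta quotients\<close>

text \<open>The difference \<open>R\<close> of the two numerators has degree below
  \<open>card S\<close> but vanishes at the \<open>card S\<close> distinct points 1/c, so it is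
  zero.\<close>

lemma lagrange_partial_fractions:
  fixes p :: "complex poly"
  assumes fin: "finite S" and S0: "0 \<notin> S" and deg: "degree p < card S" and x: "\<And>c. c \<in> S \<Longrightarrow> x * c \<noteq> 1"
  shows "poly p x / (\<Prod>c\<in>S. 1 - x * c) =
    (\<Sum>c\<in>S. poly p (1 / c) / (\<Prod>c'\<in>S-{c}. 1 - c' / c) / (1 - x * c))"
proof -
  define k where "k c = poly p (1 / c) / (\<Prod>c'\<in>S-{c}. 1 - c' / c)" for c
  define R where "R = p - (\<Sum>c\<in>S. smult (k c) (\<Prod>c'\<in>S-{c}. [:1, - c':]))"
  have degc: "degree (smult (k c) (\<Prod>c'\<in>S-{c}. [:1, - c':])) < card S" if "c \<in> S" for c
  proof -
    have "degree (\<Prod>c'\<in>S-{c}. [:1, - c':]) \<le> (\<Sum>c'\<in>S-{c}. degree [:1, - c':])"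
      using degree_prod_sum_le[of "S - {c}" "\<lambda>c'. [:1, - c':]"] fin by (simp add: o_def)
    also have "\<dots> \<le> (\<Sum>c'\<in>S-{c}. 1)" by (intro sum_mono) simp
    also have "\<dots> = card (S - {c})" by simp
    also have "\<dots> < card S" using card_Diff1_less[OF fin that] .
    finally show ?thesis using degree_smult_le le_less_trans by blast
  qed
  have "S \<noteq> {}" using deg by auto
  have "degree (\<Sum>c\<in>S. smult (k c) (\<Prod>c'\<in>S-{c}. [:1, - c':])) < card S"
    by (rule degree_sum_less) (use degc fin \<open>S \<noteq> {}\<close> in \<open>auto simp: card_gt_0_iff\<close>)
  then have degR: "degree R < card S"
    unfolding R_def by (intro degree_diff_less deg)
  have root: "poly R (1 / c) = 0" if "c \<in> S" for c
  proof -
    have c0: "c \<noteq> 0" using that S0 by auto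
    have ne: "(\<Prod>c'\<in>S-{c}. 1 - c' / c) \<noteq> 0"
      using fin c0 by (auto simp: prod_zero_iff)
    have "(\<Sum>d\<in>S. k d * (\<Prod>c'\<in>S-{d}. 1 - c' / c)) = (\<Sum>d\<in>{c}. k d * (\<Prod>c'\<in>S-{d}. 1 - c' / c))"
    proof (rule sum.mono_neutral_right[OF fin])
      show "\<forall>d\<in>S - {c}. k d * (\<Prod>c'\<in>S - {d}. 1 - c' / c) = 0"
        using that c0 fin by (auto simp: prod_zero_iff)
    qed (use that in auto)
    also have "\<dots> = poly p (1 / c)" using ne by (simp add: k_def)
    finally show ?thesis
      unfolding R_def by (simp add: poly_sum poly_prod)
  qed
  have "R = 0"
  proof (rule ccontr)
    assume R: "R \<noteq> 0"
    have "card S = card ((\<lambda>c. 1 / c) ` S)"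
      by (subst card_image) (use S0 in \<open>auto simp: inj_on_def\<close>)
    also have "\<dots> \<le> card {x. poly R x = 0}"
      by (rule card_mono) (use root R poly_roots_finite in auto)
    also have "\<dots> \<le> degree R" using R by (rule card_poly_roots_bound)
    finally show False using degR by simp
  qed
  then have "poly p x = (\<Sum>c\<in>S. k c * (\<Prod>c'\<in>S-{c}. 1 - x * c'))"
    unfolding R_def by (simp add: poly_sum poly_prod)
  then have "poly p x / (\<Prod>c\<in>S. 1 - x * c) = (\<Sum>c\<in>S. k c * (\<Prod>c'\<in>S-{c}. 1 - x * c') / (\<Prod>c\<in>S. 1 - x * c))"
    by (simp add: sum_divide_distrib)
  also have "\<dots> = (\<Sum>c\<in>S. k c / (1 - x * c))"
  proof (rule sum.cong)
    fix c assume "c \<in> S"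
    have "(\<Prod>c'\<in>S-{c}. 1 - x * c') \<noteq> 0"
      using fin x by (auto simp: prod_zero_iff)
    moreover have "(\<Prod>c\<in>S. 1 - x * c) = (1 - x * c) * (\<Prod>c'\<in>S-{c}. 1 - x * c')"
      by (rule prod.remove[OF fin \<open>c \<in> S\<close>])
    ultimately show "k c * (\<Prod>c'\<in>S-{c}. 1 - x * c') / (\<Prod>c\<in>S. 1 - x * c) = k c / (1 - x * c)"
      by simp
  qed simp
  finally show ?thesis by (simp add: k_def)
qed

section \<open>Truncated theta functions\<close>

definition win :: "complex \<Rightarrow> nat \<Rightarrow> complex \<Rightarrow> complex" where
  "win q N x = (\<Prod>j\<in>{- int N..int N}. 1 - x * q powi j)"

text \<open>Two truncations are needed: \<open>win\<close> is a polynomial in x, to which Lagrange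
  interpolation applies, while \<open>tht\<close> converges to \<open>jth\<close>. By
  \<open>tht_win\<close> they differ by the constant \<open>winc\<close> and the power x^N.\<close>

definition tht :: "complex \<Rightarrow> nat \<Rightarrow> complex \<Rightarrow> complex" where
  "tht q N x = qpf x q (Suc N) * qpf (q / x) q N"

text \<open>Each factor 1 - c q^(-i-1) equals -c q^(-i-1) (1 - (q/c) q^i); the extracted monomials
  multiply to the sign and the triangular power.\<close>

lemma qpf_neg_window:
  assumes "q \<noteq> 0" "c \<noteq> 0"
  shows "(\<Prod>i<M. 1 - c * q powi (- int i - 1)) = (- c) ^ M * q powi (- tri (int M)) * qpf (q / c) q M"
proof (induction M)
  case (Suc M)
  have "- tri (int (Suc M)) = - tri (int M) + (- int M - 1)"
    using tri_add1[of "int M"] by (simp add: algebra_simps)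
  then have e: "q powi (- tri (int (Suc M))) = q powi (- tri (int M)) * q powi (- int M - 1)"
    using assms by (metis power_int_add)
  have e2: "q powi (- int M - 1) = inverse (q * q ^ M)"
  proof -
    have "- int M - 1 = - int (Suc M)" by simp
    then show ?thesis by (simp only: power_int_minus power_int_of_nat power_Suc)
  qed
  have "1 - c * q powi (- int M - 1) = (- c) * q powi (- int M - 1) * (1 - q / c * q ^ M)"
    unfolding e2 using assms by (simp add: field_simps)
  then show ?case
    unfolding prod.lessThan_Suc Suc e qpf_Suc by (simp add: mult_ac)
qed simp

lemma prod_int_window:
  fixes f :: "int \<Rightarrow> complex"
  shows "(\<Prod>j\<in>{- int a..<int b}. f j) = (\<Prod>i<b. f (int i)) * (\<Prod>i<a. f (- int i - 1))"
proof -
  have "{- int a..<int b} = int ` {..<b} \<union> (\<lambda>i. - int i - 1) ` {..<a}"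
  proof (intro equalityI subsetI)
    fix x assume x: "x \<in> {- int a..<int b}"
    show "x \<in> int ` {..<b} \<union> (\<lambda>i. - int i - 1) ` {..<a}"
    proof (cases "x \<ge> 0")
      case True
      then show ?thesis using x by (auto intro!: rev_image_eqI[of "nat x"])
    next
      case False
      then show ?thesis using x by (intro UnI2 rev_image_eqI[of "nat (-x-1)"]) auto
    qed
  qed auto
  moreover have "int ` {..<b} \<inter> (\<lambda>i. - int i - 1) ` {..<a} = {}" by auto
  ultimately have "(\<Prod>j\<in>{- int a..<int b}. f j) = prod f (int ` {..<b}) * prod f ((\<lambda>i. - int i - 1) ` {..<a})"
    by (simp add: prod.union_disjoint)
  also have "prod f (int ` {..<b}) = (\<Prod>i<b. f (int i))"
    by (subst prod.reindex) (auto simp: o_def)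
  also have "prod f ((\<lambda>i. - int i - 1) ` {..<a}) = (\<Prod>i<a. f (- int i - 1))"
    by (subst prod.reindex) (auto simp: o_def inj_on_def)
  finally show ?thesis .
qed

lemma win_shift:
  assumes "q \<noteq> 0" "c \<noteq> 0" "\<bar>m\<bar> \<le> int N"
  shows "win q N (c * q powi (- m)) =
    qpf c q (nat (int N - m) + 1) * (- c) ^ nat (int N + m) * q powi (- tri (int N + m)) * qpf (q / c) q (nat (int N + m))"
proof -
  have m: "- int N \<le> m" "m \<le> int N" using assms(3) by auto
  have "win q N (c * q powi (- m)) = (\<Prod>j\<in>{- int N..int N}. 1 - c * q powi (j - m))"
    unfolding win_def using assms by (simp add: power_int_diff power_int_minus divide_inverse mult_ac)
  also have "\<dots> = (\<Prod>j\<in>{- int (nat (int N + m))..<int (nat (int N - m) + 1)}. 1 - c * q powi j)"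
    by (rule prod.reindex_bij_witness[of _ "\<lambda>j. j + m" "\<lambda>j. j - m"]) (use m in auto)
  also have "\<dots> = (\<Prod>i<nat (int N - m) + 1. 1 - c * q powi (int i)) * (\<Prod>i<nat (int N + m). 1 - c * q powi (- int i - 1))"
    by (rule prod_int_window)
  also have "\<dots> = qpf c q (nat (int N - m) + 1) * ((- c) ^ nat (int N + m) * q powi (- tri (int N + m)) * qpf (q / c) q (nat (int N + m)))"
    unfolding qpf_neg_window[OF assms(1,2)] using assms(3) by (simp add: qpf_def)
  finally show ?thesis by (simp add: mult_ac)
qed

definition winc :: "complex \<Rightarrow> nat \<Rightarrow> complex" where
  "winc q N = (- 1) ^ N * q powi tri (int N)"

lemma winc_nonzero: "q \<noteq> 0 \<Longrightarrow> winc q N \<noteq> 0"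
  by (simp add: winc_def)

lemma tht_win:
  assumes "q \<noteq> 0" "x \<noteq> 0"
  shows "tht q N x = winc q N * win q N x / x ^ N"
proof -
  have "win q N x = qpf x q (N + 1) * (- x) ^ N * q powi (- tri (int N)) * qpf (q / x) q N"
    using win_shift[OF assms, of 0 N] by simp
  also have "\<dots> = tht q N x * x ^ N * ((- 1) ^ N * q powi (- tri (int N)))"
    unfolding tht_def by (subst power_minus[of x]) (simp add: mult_ac)
  finally have "winc q N * win q N x = tht q N x * x ^ N * ((- 1) ^ N * (- 1) ^ N) * (q powi tri (int N) * q powi (- tri (int N)))"
    by (simp add: winc_def mult_ac)
  also have "(- 1) ^ N * (- 1) ^ N = (1::complex)" by (simp flip: power_mult_distrib)
  also have "q powi tri (int N) * q powi (- tri (int N)) = 1" using assms by (simp add: power_int_minus)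
  finally show ?thesis using assms by (simp add: field_simps)
qed

lemma tri_add: "tri (a + b) = tri a + tri b + a * b"
  by (rule tri_eqI) (use two_tri[of a] two_tri[of b] in \<open>simp add: algebra_simps\<close>)

text \<open>What is left of the truncated theta function at c q^(-m) once a monomial is split off.
  The window is off centre by m, hence the unequal lengths, but for fixed m the limit is
  \<open>jth q c\<close>.\<close>

definition wfac :: "complex \<Rightarrow> nat \<Rightarrow> int \<Rightarrow> complex \<Rightarrow> complex" where
  "wfac q N m c = qpf c q (nat (int N - m) + 1) * qpf (q / c) q (nat (int N + m))"

text \<open>Quasi-periodicity at finite level. The shift by q^(-m) moves the window, and
  \<open>tri_add\<close> makes all monomials that depend on N cancel.\<close>

lemma tht_shift:
  assumes "q \<noteq> 0" "c \<noteq> 0" "\<bar>m\<bar> \<le> int N"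
  shows "tht q N (c * q powi (- m)) = (- c) powi m * q powi (- tri m) * wfac q N m c"
proof -
  have e1: "(- c) ^ nat (int N + m) = (- c) powi (int N + m)"
    using assms(3) by (simp add: power_int_def)
  have e2: "(c * q powi - m) ^ N = c ^ N * q powi (- m * int N)"
    using power_int_mult[of q "- m" "int N"] by (simp add: power_mult_distrib)
  have e3: "- tri (int N + m) = - tri (int N) + - tri m + - m * int N"
    by (simp add: tri_add)
  have e4: "q powi (- tri (int N + m)) = q powi (- tri (int N)) * q powi (- tri m) * q powi (- m * int N)"
    by (simp only: e3 power_int_add[OF disjI1[OF assms(1)]])
  have e5: "(- c) powi (int N + m) = (- 1) ^ N * c ^ N * (- c) powi m"
    using assms by (simp add: power_int_add) (metis power_minus)
  have aux: "(s * T) * (K * (s * cN * C) * (P * R * Z) * D) / (cN * Z) = (s * s) * (T * P) * (C * R * (K * D))"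
    if "cN \<noteq> 0" "Z \<noteq> 0" for s T K cN C P R Z D :: complex
    using that by (simp add: field_simps)
  have z: "q powi (- m * int N) \<noteq> 0" "c ^ N \<noteq> 0" "q powi (tri (int N)) \<noteq> 0"
    using assms by auto
  have "tht q N (c * q powi (- m)) = winc q N * win q N (c * q powi (- m)) / (c * q powi (- m)) ^ N"
    using assms by (intro tht_win) auto
  also have "\<dots> = ((- 1) ^ N * q powi tri (int N)) * (qpf c q (nat (int N - m) + 1) * ((- 1) ^ N * c ^ N * (- c) powi m) *
        (q powi (- tri (int N)) * q powi (- tri m) * q powi (- m * int N)) * qpf (q / c) q (nat (int N + m))) / (c ^ N * q powi (- m * int N))"
    unfolding win_shift[OF assms] winc_def e1 e2 e4 e5 by simp
  also have "\<dots> = (((- 1) ^ N) * (- 1) ^ N) * (q powi tri (int N) * q powi (- tri (int N))) * ((- c) powi m * q powi (- tri m) * wfac q N m c)"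
    unfolding wfac_def Suc_eq_plus1[symmetric] by (rule aux[OF z(2,1)])
  also have "(((- 1) ^ N) * (- 1) ^ N) = (1::complex)" by (simp flip: power_mult_distrib)
  also have "q powi tri (int N) * q powi (- tri (int N)) = 1"
    using z by (simp add: power_int_minus)
  finally show ?thesis by simp
qed

text \<open>The analogue of \<open>tht_shift\<close> at the pole itself (c = 1), with the vanishing
  factor j = m left out. It is the origin of (q;q)_inf^2 in the residues of theta quotients.\<close>

lemma win_self:
  assumes "q \<noteq> 0" "\<bar>m\<bar> \<le> int N"
  shows "winc q N * (\<Prod>j\<in>{- int N..int N}-{m}. 1 - q powi (j - m)) * q powi (m * int N) =
    (- 1) powi m * q powi (- tri m) * (qpf q q (nat (int N - m)) * qpf q q (nat (int N + m)))"
proof -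
  let ?M = "nat (int N + m)"
  have m: "- int N \<le> m" "m \<le> int N" using assms(2) by auto
  have e1: "(- 1 :: complex) ^ nat (int N + m) = (- 1) powi (int N + m)"
    using assms(2) by (simp add: power_int_def)
  have e5: "(- 1 :: complex) powi (int N + m) = (- 1) ^ N * (- 1) powi m"
    by (simp add: power_int_add)
  have e3: "- tri (int N + m) = - tri (int N) + - tri m + - m * int N"
    by (simp add: tri_add)
  have e4: "q powi (- tri (int N + m)) = q powi (- tri (int N)) * q powi (- tri m) * q powi (- m * int N)"
    by (simp only: e3 power_int_add[OF disjI1[OF assms(1)]])
  have "(\<Prod>j\<in>{- int N..int N}-{m}. 1 - q powi (j - m)) = (\<Prod>j\<in>{- int ?M..<int (nat (int N - m) + 1)}-{0}. 1 - q powi j)"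
    by (rule prod.reindex_bij_witness[of _ "\<lambda>j. j + m" "\<lambda>j. j - m"]) (use m in auto)
  \<comment> \<open>The omitted factor is replaced by 1, so that the product runs over a full
    interval and can be cut at 0.\<close>
  also have "\<dots> = (\<Prod>j\<in>{- int ?M..<int (nat (int N - m) + 1)}. if j = 0 then 1 else 1 - q powi j)"
    by (rule prod.mono_neutral_cong_left) auto
  also have "\<dots> = (\<Prod>i<nat (int N - m) + 1. if int i = 0 then 1 else 1 - q powi (int i)) *
       (\<Prod>i<?M. if - int i - 1 = 0 then 1 else 1 - q powi (- int i - 1))"
    by (rule prod_int_window)
  also have "(\<Prod>i<nat (int N - m) + 1. if int i = 0 then 1 else 1 - q powi (int i)) = qpf q q (nat (int N - m))"
    unfolding qpf_def Suc_eq_plus1[symmetric] by (subst prod.lessThan_Suc_shift) (simp del: of_nat_Suc)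
  also have "(\<Prod>i<?M. if - int i - 1 = 0 then 1 else 1 - q powi (- int i - 1)) = (\<Prod>i<?M. 1 - 1 * q powi (- int i - 1))"
    by (intro prod.cong) auto
  also have "\<dots> = (- 1) ^ ?M * q powi (- tri (int ?M)) * qpf q q ?M"
    using qpf_neg_window[OF assms(1), of 1 ?M] by simp
  finally have "(\<Prod>j\<in>{- int N..int N}-{m}. 1 - q powi (j - m)) =
      qpf q q (nat (int N - m)) * ((- 1) ^ ?M * q powi (- tri (int ?M)) * qpf q q ?M)" .
  also have "int ?M = int N + m" using assms by simp
  finally have *: "(\<Prod>j\<in>{- int N..int N}-{m}. 1 - q powi (j - m)) =
      qpf q q (nat (int N - m)) * ((- 1) ^ N * (- 1) powi m * (q powi (- tri (int N)) * q powi (- tri m) * q powi (- m * int N)) * qpf q q ?M)"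
    unfolding e1 e4 e5 .
  have "winc q N * (\<Prod>j\<in>{- int N..int N}-{m}. 1 - q powi (j - m)) * q powi (m * int N) =
     ((- 1) ^ N * (- 1) ^ N) * (q powi tri (int N) * q powi (- tri (int N))) * (q powi (- m * int N) * q powi (m * int N)) *
    ((- 1) powi m * q powi (- tri m) * (qpf q q (nat (int N - m)) * qpf q q ?M))"
    unfolding * winc_def by (simp only: mult_ac)
  also have "(((- 1) ^ N) * (- 1) ^ N) = (1::complex)" by (simp flip: power_mult_distrib)
  also have "q powi tri (int N) * q powi (- tri (int N)) = 1"
    using assms by (simp add: power_int_minus)
  also have "q powi (- m * int N) * q powi (m * int N) = 1"
    using assms by (simp add: power_int_minus)
  finally show ?thesis by simp
qed

lemma prod_powi: "(\<Prod>x\<in>A. f x powi m) = (\<Prod>x\<in>A. f x :: complex) powi m"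
  by (induction A rule: infinite_finite_induct) (simp_all add: power_int_mult_distrib)

text \<open>Lagrange interpolation with poles at the reciprocals of b q^j, which are distinct
  because the b are inequivalent modulo powers of q. The excess d of factors below over factors
  above secures the degree condition and becomes the exponent of the theta weight.\<close>

lemma finite_theta_partial_fractions:
  assumes q: "q \<noteq> 0" and fA: "finite A" and fB: "finite B" and A0: "0 \<notin> A" and B0: "0 \<notin> B"
    and card: "card B = card A + d" and d: "d \<ge> 1" and x0: "x \<noteq> 0"
    and dist: "\<And>b b' j. b \<in> B \<Longrightarrow> b' \<in> B \<Longrightarrow> b = b' * q powi j \<Longrightarrow> b = b' \<and> j = 0"
    and x: "\<And>b j. b \<in> B \<Longrightarrow> \<bar>j\<bar> \<le> int N \<Longrightarrow> x * b * q powi j \<noteq> 1"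
  shows "(\<Prod>a\<in>A. tht q N (x * a)) / (\<Prod>b\<in>B. tht q N (x * b)) =
    (\<Sum>b\<in>B. \<Sum>m\<in>{- int N..int N}.
       ((- 1) powi m * q powi tri m) ^ d * (\<Prod>A / \<Prod>B * b ^ d) powi m *
       ((\<Prod>a\<in>A. wfac q N m (a / b)) / ((\<Prod>b'\<in>B-{b}. wfac q N m (b' / b)) *
         (qpf q q (nat (int N - m)) * qpf q q (nat (int N + m))))) / (1 - x * b * q powi m))"
proof -
  define I where "I = {- int N..int N}"
  define g where "g = (\<lambda>(b, j). b * q powi j)"
  define S where "S = g ` (B \<times> I)"
  have fI: "finite I" "card I = 2 * N + 1" by (auto simp: I_def)
  have inj: "inj_on g (B \<times> I)"
  proof (rule inj_onI; clarify)
    fix b j b' j' assume h: "b \<in> B" "b' \<in> B" "g (b, j) = g (b', j')"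
    have "b = b' * q powi (j' - j)"
      using h(3) q unfolding g_def by (simp add: power_int_diff field_simps)
    from dist[OF h(1,2) this] show "b = b' \<and> j = j'" by simp
  qed
  have prodS: "(\<Prod>c\<in>S. f c) = (\<Prod>b\<in>B. \<Prod>j\<in>I. f (b * q powi j))" for f :: "complex \<Rightarrow> complex"
    unfolding S_def by (subst prod.reindex[OF inj]) (simp add: prod.cartesian_product g_def o_def case_prod_unfold)
  have sumS: "(\<Sum>c\<in>S. f c) = (\<Sum>b\<in>B. \<Sum>j\<in>I. f (b * q powi j))" for f :: "complex \<Rightarrow> complex"
    unfolding S_def by (subst sum.reindex[OF inj]) (simp add: sum.cartesian_product g_def o_def case_prod_unfold)
  \<comment> \<open>Passing from \<open>tht\<close> to \<open>win\<close> leaves d surplus factors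
    x^N in the numerator. The degree dN + |A|(2N+1) stays below |S| = (|A|+d)(2N+1) because d >= 1.
    The coefficient \<open>x ^ 0\<close> is 1.\<close>
  define p where "p = monom (x ^ 0) (d * N) * (\<Prod>a\<in>A. \<Prod>j\<in>I. [:1, - (a * q powi j):])"
  have polyp: "poly p z = z ^ (d * N) * (\<Prod>a\<in>A. win q N (z * a))" for z
    unfolding p_def by (simp add: poly_monom poly_prod win_def I_def mult_ac)
  have "degree p \<le> d * N + card A * (2 * N + 1)"
  proof -
    have "degree (\<Prod>a\<in>A. \<Prod>j\<in>I. [:1, - (a * q powi j):]) \<le> (\<Sum>a\<in>A. degree (\<Prod>j\<in>I. [:1, - (a * q powi j):]))"
      using degree_prod_sum_le[OF fA, of "\<lambda>a. \<Prod>j\<in>I. [:1, - (a * q powi j):]"] by (simp add: o_def)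
    also have "\<dots> \<le> (\<Sum>a\<in>A. 2 * N + 1)"
    proof (rule sum_mono)
      fix a
      have "degree (\<Prod>j\<in>I. [:1, - (a * q powi j):]) \<le> (\<Sum>j\<in>I. degree [:1, - (a * q powi j):])"
        using degree_prod_sum_le[OF fI(1), of "\<lambda>j. [:1, - (a * q powi j):]"] by (simp add: o_def)
      also have "\<dots> \<le> (\<Sum>j\<in>I. 1)" by (intro sum_mono) simp
      finally show "degree (\<Prod>j\<in>I. [:1, - (a * q powi j):]) \<le> 2 * N + 1" using fI by simp
    qed
    finally have "degree (\<Prod>a\<in>A. \<Prod>j\<in>I. [:1, - (a * q powi j):]) \<le> card A * (2 * N + 1)" by simp
    then show ?thesis unfolding p_def
      using degree_mult_le[of "monom (x ^ 0) (d * N)" "\<Prod>a\<in>A. \<Prod>j\<in>I. [:1, - (a * q powi j):]"]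
        degree_monom_le[of "x ^ 0" "d * N"] by linarith
  qed
  moreover have "card S = (card A + d) * (2 * N + 1)"
    unfolding S_def card_image[OF inj] by (simp add: card_cartesian_product card fI)
  moreover have "d * N + card A * (2 * N + 1) < (card A + d) * (2 * N + 1)"
    using d by (simp add: algebra_simps)
  ultimately have degp: "degree p < card S" by simp
  have S0: "0 \<notin> S" using B0 q by (auto simp: S_def g_def)
  have lag: "poly p x / (\<Prod>c\<in>S. 1 - x * c) =
    (\<Sum>c\<in>S. poly p (1 / c) / (\<Prod>c'\<in>S-{c}. 1 - c' / c) / (1 - x * c))"
    by (rule lagrange_partial_fractions) (use S0 degp x fB in \<open>auto simp: S_def g_def I_def mult.assoc\<close>)
  define w where "w = winc q N"
  have w0: "w \<noteq> 0" using q by (simp add: w_def winc_nonzero)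
  have A0': "a \<noteq> 0" if "a \<in> A" for a using A0 that by auto
  have B0': "b \<noteq> 0" if "b \<in> B" for b using B0 that by auto
  have PA: "(\<Prod>a\<in>A. tht q N (z * a)) = w ^ card A * (\<Prod>a\<in>A. win q N (z * a)) / (z ^ (card A * N) * \<Prod>A ^ N)"
    if "z \<noteq> 0" for z
  proof -
    have "(\<Prod>a\<in>A. tht q N (z * a)) = (\<Prod>a\<in>A. w * win q N (z * a) / (z ^ N * a ^ N))"
      by (rule prod.cong[OF refl], subst tht_win) (use q that A0' in \<open>auto simp: w_def power_mult_distrib\<close>)
    then show ?thesis
      by (simp add: prod_dividef prod.distrib power_mult prod_power_distrib mult.commute[of "card A" N])
  qed
  have PB: "(\<Prod>b\<in>C. tht q N (z * b)) = w ^ card C * (\<Prod>b\<in>C. win q N (z * b)) / (z ^ (card C * N) * \<Prod>C ^ N)"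
    if "z \<noteq> 0" "C \<subseteq> B" for z C
  proof -
    have "(\<Prod>b\<in>C. tht q N (z * b)) = (\<Prod>b\<in>C. w * win q N (z * b) / (z ^ N * b ^ N))"
      by (rule prod.cong[OF refl], subst tht_win) (use q that B0' in \<open>auto simp: w_def power_mult_distrib\<close>)
    then show ?thesis
      by (simp add: prod_dividef prod.distrib power_mult prod_power_distrib mult.commute[of "card C" N])
  qed
  have pA0: "\<Prod>A \<noteq> 0" using A0 fA by (simp add: prod_zero_iff)
  have pB0: "\<Prod>B \<noteq> 0" using B0 fB by (simp add: prod_zero_iff)
  define K where "K = (\<Prod>B / \<Prod>A) ^ N / w ^ d"
  have lhs: "(\<Prod>a\<in>A. tht q N (x * a)) / (\<Prod>b\<in>B. tht q N (x * b)) = K * (poly p x / (\<Prod>c\<in>S. 1 - x * c))"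
  proof -
    have e: "(\<Prod>c\<in>S. 1 - x * c) = (\<Prod>b\<in>B. win q N (x * b))"
      unfolding prodS by (simp add: win_def I_def mult.assoc)
    have "x ^ (card B * N) = x ^ (card A * N) * x ^ (d * N)" "w ^ card B = w ^ card A * w ^ d"
      unfolding card by (simp_all add: power_add add_mult_distrib)
    then show ?thesis
      unfolding PA[OF x0] PB[OF x0 subset_refl] e polyp K_def
      using x0 w0 pA0 pB0 by (simp add: field_simps)
  qed
  \<comment> \<open>The residue belonging to c = b q^m. Shifting the theta factors by
    \<open>tht_shift\<close> gives |A| powers of \<sigma> above and |A| + d - 1 below, and
    \<open>win_self\<close> one more below, so \<sigma>^(-d) survives.\<close>
  have termE: "K * (poly p (1 / c) / (\<Prod>c'\<in>S-{c}. 1 - c' / c) / (1 - x * c)) =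
     ((- 1) powi m * q powi tri m) ^ d * (\<Prod>A / \<Prod>B * b ^ d) powi m *
       ((\<Prod>a\<in>A. wfac q N m (a / b)) / ((\<Prod>b'\<in>B-{b}. wfac q N m (b' / b)) *
         (qpf q q (nat (int N - m)) * qpf q q (nat (int N + m))))) / (1 - x * b * q powi m)"
    if bm: "b \<in> B" "m \<in> I" "c = b * q powi m" for b m c
  proof -
    obtain d' where d': "d = Suc d'" using d by (cases d) auto
    define r where "r = card A"
    define PBb where "PBb = \<Prod>(B - {b})"
    have b0: "b \<noteq> 0" and c0: "c \<noteq> 0" using B0'[OF bm(1)] bm q by auto
    have mN: "\<bar>m\<bar> \<le> int N" using bm by (auto simp: I_def)
    have cardBb: "card (B - {b}) = r + d'" using bm fB card d' by (simp add: r_def)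
    have PBeq: "\<Prod>B = b * PBb" unfolding PBb_def by (rule prod.remove[OF fB bm(1)])
    have PBb0: "PBb \<noteq> 0" using pB0 PBeq by auto
    define \<sigma> where "\<sigma> = (- 1) powi m * q powi (- tri m)"
    have \<sigma>0: "\<sigma> \<noteq> 0" using q by (simp add: \<sigma>_def)
    have \<sigma>inv: "(- 1) powi m * q powi tri m = inverse \<sigma>"
      by (simp add: \<sigma>_def power_int_minus flip: power_int_inverse)
    have qm: "q powi (m * int N) = (c / b) ^ N" using bm b0 by (simp add: power_int_mult)
    define WA where "WA = (\<Prod>a\<in>A. win q N (1 / c * a))"
    define WB where "WB = (\<Prod>b'\<in>B-{b}. win q N (1 / c * b'))"
    define W where "W = (\<Prod>j\<in>I-{m}. 1 - q powi (j - m))"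
    define FA where "FA = (\<Prod>a\<in>A. wfac q N m (a / b))"
    define FB where "FB = (\<Prod>b'\<in>B-{b}. wfac q N m (b' / b))"
    define QQ where "QQ = qpf q q (nat (int N - m)) * qpf q q (nat (int N + m))"
    have thtc: "tht q N (1 / c * z) = \<sigma> * (z / b) powi m * wfac q N m (z / b)" if "z \<noteq> 0" for z
    proof -
      have "1 / c * z = z / b * q powi (- m)"
        using bm by (simp add: power_int_minus field_simps)
      then have "tht q N (1 / c * z) = (- (z / b)) powi m * q powi (- tri m) * wfac q N m (z / b)"
        using tht_shift[OF q _ mN, of "z / b"] that b0 by simp
      also have "(- (z / b)) powi m = (- 1) powi m * (z / b) powi m"
        by (metis mult_minus1 power_int_mult_distrib)
      finally show ?thesis by (simp add: \<sigma>_def mult_ac)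
    qed
    have TA: "(\<Prod>a\<in>A. tht q N (1 / c * a)) = \<sigma> ^ r * (\<Prod>A / b ^ r) powi m * FA"
    proof -
      have "(\<Prod>a\<in>A. tht q N (1 / c * a)) = (\<Prod>a\<in>A. \<sigma> * (a / b) powi m * wfac q N m (a / b))"
        by (intro prod.cong refl thtc A0')
      then show ?thesis
        by (simp add: prod.distrib FA_def r_def prod_dividef add: prod_powi)
    qed
    have TB: "(\<Prod>b'\<in>B-{b}. tht q N (1 / c * b')) = \<sigma> ^ (r + d') * (PBb / b ^ (r + d')) powi m * FB"
    proof -
      have "(\<Prod>b'\<in>B-{b}. tht q N (1 / c * b')) = (\<Prod>b'\<in>B-{b}. \<sigma> * (b' / b) powi m * wfac q N m (b' / b))"
        by (intro prod.cong refl thtc B0') auto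
      then show ?thesis
        by (simp add: prod.distrib FB_def cardBb PBb_def prod_dividef add: prod_powi)
    qed
    have WAeq: "w ^ r * WA = (\<sigma> ^ r * (\<Prod>A / b ^ r) powi m * FA) * (1 / c) ^ (r * N) * \<Prod>A ^ N"
      using PA[of "1 / c"] c0 pA0 unfolding TA WA_def[symmetric] r_def[symmetric] by (simp add: field_simps)
    have WBeq: "w ^ (r + d') * WB = (\<sigma> ^ (r + d') * (PBb / b ^ (r + d')) powi m * FB) * (1 / c) ^ ((r + d') * N) * PBb ^ N"
      using PB[of "1 / c" "B - {b}"] c0 PBb0 unfolding TB WB_def[symmetric] cardBb PBb_def[symmetric] by (simp add: field_simps)
    have Weq: "w * W * (c / b) ^ N = \<sigma> * QQ"
      using win_self[OF q mN] unfolding w_def W_def I_def \<sigma>_def QQ_def qm by simp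
    have Sc: "(\<Prod>c'\<in>S-{c}. 1 - c' / c) = WB * W"
    proof -
      have Sc: "S - {c} = g ` (B \<times> I - {(b, m)})"
        unfolding S_def using inj_on_image_set_diff[OF inj, of "B \<times> I" "{(b, m)}"] bm by (simp add: g_def)
      have un: "B \<times> I - {(b, m)} = (B - {b}) \<times> I \<union> {b} \<times> (I - {m})" using bm by auto
      have "(\<Prod>c'\<in>S-{c}. 1 - c' / c) = (\<Prod>(b',j)\<in>B \<times> I - {(b, m)}. 1 - b' * q powi j / c)"
        unfolding Sc by (subst prod.reindex[OF inj_on_subset[OF inj]]) (auto simp: o_def g_def case_prod_unfold)
      also have "\<dots> = (\<Prod>(b',j)\<in>(B - {b}) \<times> I. 1 - b' * q powi j / c) * (\<Prod>(b',j)\<in>{b} \<times> (I - {m}). 1 - b' * q powi j / c)"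
        unfolding un using fB fI by (intro prod.union_disjoint) auto
      also have "(\<Prod>(b',j)\<in>(B - {b}) \<times> I. 1 - b' * q powi j / c) = WB"
        unfolding WB_def win_def I_def[symmetric] by (simp add: prod.cartesian_product)
      also have "(\<Prod>(b',j)\<in>{b} \<times> (I - {m}). 1 - b' * q powi j / c) = (\<Prod>j\<in>I-{m}. 1 - b * q powi j / c)"
        by (simp flip: prod.cartesian_product)
      also have "\<dots> = W" unfolding W_def bm(3) using b0 q by (simp add: power_int_diff)
      finally show ?thesis .
    qed
    have pc: "poly p (1 / c) = (1 / c) ^ (d * N) * WA" unfolding polyp WA_def ..
    have main: "K * (poly p (1 / c) / (WB * W)) = inverse \<sigma> ^ d * (\<Prod>A / \<Prod>B * b ^ d) powi m * (FA / (FB * QQ))"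
    proof -
      have WA': "WA = (\<sigma> ^ r * (\<Prod>A / b ^ r) powi m * FA) * (1 / c) ^ (r * N) * \<Prod>A ^ N / w ^ r"
        using WAeq w0 by (metis nonzero_mult_div_cancel_left power_not_zero)
      have WB': "WB = (\<sigma> ^ (r + d') * (PBb / b ^ (r + d')) powi m * FB) * (1 / c) ^ ((r + d') * N) * PBb ^ N / w ^ (r + d')"
        using WBeq w0 by (metis nonzero_mult_div_cancel_left power_not_zero)
      have W': "W = \<sigma> * QQ / (w * (c / b) ^ N)"
        using Weq w0 b0 c0 by (simp add: field_simps)
      define u where "u = (1 / c) ^ N"
      have u0: "u \<noteq> 0" using c0 by (simp add: u_def)
      have cu: "(c / b) ^ N = 1 / (u * b ^ N)" using c0 b0 by (simp add: u_def field_simps)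
      have pu: "(1 / c) ^ (k * N) = u ^ k" for k
        by (simp add: u_def mult.commute[of k N] flip: power_mult)
      have bk: "(b ^ k) powi m = (b powi m) ^ k" for k
        by (simp only: power_int_power power_int_power' mult.commute)
      have P1: "(\<Prod>A / \<Prod>B * b ^ d) powi m = (\<Prod>A powi m) * (b powi m) ^ d' / PBb powi m"
      proof -
        have "\<Prod>A / \<Prod>B * b ^ d = \<Prod>A * b ^ d' / PBb" unfolding PBeq d' using b0 by simp
        then show ?thesis by (simp only: power_int_mult_distrib power_int_divide_distrib bk)
      qed
      have P2: "(\<Prod>A / b ^ r) powi m = \<Prod>A powi m / (b powi m) ^ r"
        by (simp only: power_int_divide_distrib bk)
      have P3: "(PBb / b ^ (r + d')) powi m = PBb powi m / ((b powi m) ^ r * (b powi m) ^ d')"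
        by (simp only: power_int_divide_distrib power_add power_int_mult_distrib bk)
      have K': "K = (b * PBb / \<Prod>A) ^ N / (w * w ^ d')" unfolding K_def PBeq d' by simp
      have bm0: "b powi m \<noteq> 0" "PBb powi m \<noteq> 0" "\<Prod>A powi m \<noteq> 0" using b0 PBb0 pA0 by auto
      show ?thesis
        unfolding pc K' WA' WB' W' pu cu P1 P2 P3 unfolding d' power_add
        using bm0 b0 PBb0 pA0 u0 w0 \<sigma>0
        \<comment> \<open>If FB or QQ is 0, both sides are 0 by the convention on division.\<close>
        by (cases "FB = 0"; cases "QQ = 0") (simp_all add: power_mult_distrib power_divide divide_simps)
    qed
    have cx: "x * c = x * b * q powi m" using bm by (simp add: mult_ac)
    show ?thesis
      unfolding Sc cx \<sigma>inv FA_def[symmetric] FB_def[symmetric] QQ_def[symmetric]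
      using main by (metis times_divide_eq_right)
  qed
  show ?thesis
    unfolding lhs lag sumS sum_distrib_left I_def[symmetric]
    by (intro sum.cong refl termE) auto
qed

text \<open>The terms tend to 1 for m -> +inf and to 0 for m -> -inf, and no denominator vanishes.
  Hence a Lambert series is dominated by the theta series of its weights.\<close>

lemma norm_one_minus_powi_bounded_below:
  fixes q z :: complex
  assumes q: "norm q < 1" "q \<noteq> 0" and z: "z \<noteq> 0" "\<And>m. z * q powi m \<noteq> 1"
  obtains K where "K > 0" "\<And>m. norm (1 / (1 - z * q powi m)) \<le> K"
proof -
  have "(\<lambda>n. 1 / (1 - z * q ^ n)) \<longlonglongrightarrow> 1 / (1 - z * 0)"
    using q by (intro tendsto_intros LIMSEQ_power_zero) auto
  then have "Bseq (\<lambda>n. 1 / (1 - z * q ^ n))" using convergentI convergent_imp_Bseq by blast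
  then obtain K1 where K1: "K1 > 0" "\<And>n. norm (1 / (1 - z * q ^ n)) \<le> K1" unfolding Bseq_def by blast
  have "(\<lambda>n. q ^ n / (q ^ n - z)) \<longlonglongrightarrow> 0 / (0 - z)"
    using q z by (intro tendsto_intros LIMSEQ_power_zero) auto
  then have "Bseq (\<lambda>n. q ^ n / (q ^ n - z))" using convergentI convergent_imp_Bseq by blast
  then obtain K2 where K2: "K2 > 0" "\<And>n. norm (q ^ n / (q ^ n - z)) \<le> K2" unfolding Bseq_def by blast
  have "norm (1 / (1 - z * q powi m)) \<le> max K1 K2" for m
  proof (cases "m \<ge> 0")
    case True
    then show ?thesis using K1(2)[of "nat m"] by (simp add: power_int_def)
  next
    case False
    define n where "n = nat (- m)"
    have m: "m = - int n" using False by (simp add: n_def)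
    have "1 / (1 - z * q powi m) = q ^ n / (q ^ n - z)"
      unfolding m using q by (simp add: power_int_minus field_simps)
    then show ?thesis using K2(2)[of n] by simp
  qed
  then show ?thesis using K1 by (intro that[of "max K1 K2"]) auto
qed

lemma powi_shift_neq_1:
  assumes "q \<noteq> (0::complex)" "\<And>m. c * q powi m \<noteq> 1"
  shows "c * q ^ k \<noteq> 1" "q / c * q ^ k \<noteq> 1"
proof -
  show "c * q ^ k \<noteq> 1" using assms(2)[of "int k"] by simp
  show "q / c * q ^ k \<noteq> 1"
  proof
    assume h: "q / c * q ^ k = 1"
    have "c * q powi (- int (Suc k)) = c / (q * q ^ k)"
      using assms by (simp add: power_int_minus divide_inverse del: of_nat_Suc)
    also have "\<dots> = 1" using h assms by (cases "c = 0") (simp_all add: field_simps)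
    finally show False using assms(2) by blast
  qed
qed

lemma wfac_LIMSEQ:
  assumes "norm q < 1"
  shows "(\<lambda>N. wfac q N m c) \<longlonglongrightarrow> jth q c"
proof -
  have 1: "filterlim (\<lambda>N. nat (int N - m) + 1) sequentially sequentially"
    by (rule filterlim_at_top_mono[OF filterlim_minus_const_nat_at_top[of "nat \<bar>m\<bar>"]]) (intro always_eventually allI, arith)
  have 2: "filterlim (\<lambda>N. nat (int N + m)) sequentially sequentially"
    by (rule filterlim_at_top_mono[OF filterlim_minus_const_nat_at_top[of "nat \<bar>m\<bar>"]]) (intro always_eventually allI, arith)
  show ?thesis unfolding wfac_def jth_def
    by (intro tendsto_mult filterlim_compose[OF qpf_LIMSEQ[OF assms] 1] filterlim_compose[OF qpf_LIMSEQ[OF assms] 2])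
qed

lemma qpf_pair_LIMSEQ:
  assumes "norm q < 1"
  shows "(\<lambda>N. qpf q q (nat (int N - m)) * qpf q q (nat (int N + m))) \<longlonglongrightarrow> qinf q q ^ 2"
proof -
  have 1: "filterlim (\<lambda>N. nat (int N - m)) sequentially sequentially"
    by (rule filterlim_at_top_mono[OF filterlim_minus_const_nat_at_top[of "nat \<bar>m\<bar>"]]) (intro always_eventually allI, arith)
  have 2: "filterlim (\<lambda>N. nat (int N + m)) sequentially sequentially"
    by (rule filterlim_at_top_mono[OF filterlim_minus_const_nat_at_top[of "nat \<bar>m\<bar>"]]) (intro always_eventually allI, arith)
  show ?thesis unfolding power2_eq_square
    by (intro tendsto_mult filterlim_compose[OF qpf_LIMSEQ[OF assms] 1] filterlim_compose[OF qpf_LIMSEQ[OF assms] 2])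
qed

lemma tht_LIMSEQ:
  assumes "norm q < 1"
  shows "(\<lambda>N. tht q N c) \<longlonglongrightarrow> jth q c"
  unfolding tht_def jth_def
  by (intro tendsto_mult LIMSEQ_Suc[OF qpf_LIMSEQ[OF assms]] qpf_LIMSEQ[OF assms])

lemma qpf_self_neq:
  assumes "norm q < 1" shows "q * q ^ k \<noteq> (1::complex)"
proof
  assume "q * q ^ k = 1"
  then have "norm (q ^ Suc k) = 1" by simp
  moreover have "norm q ^ Suc k < 1" using assms by (cases "q = 0") (auto intro!: power_Suc_less_one simp del: power_Suc)
  ultimately show False by (simp add: norm_power del: power_Suc)
qed

lemma qinf_self_nonzero: "norm q < 1 \<Longrightarrow> qinf q q \<noteq> 0"
  using qinf_nonzero qpf_self_neq by blast

lemma qpf_lower_bound: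
  assumes "norm q < 1" "\<And>k. x * q ^ k \<noteq> 1"
  obtains a where "0 < a" "\<And>n. a \<le> norm (qpf x q n)"
  using qpf_bounds[OF assms] by metis

text \<open>The limit N -> inf of the finite version: d surplus factors in the denominator give
  Lambert series of level d, one for each class b of poles. Levels 1 and 3 are those of the crank
  and the rank.\<close>

theorem theta_partial_fractions:
  assumes q: "norm q < 1" "q \<noteq> 0" and fA: "finite A" and fB: "finite B" and A0: "0 \<notin> A" and B0: "0 \<notin> B"
    and card: "card B = card A + d" and d: "d \<ge> 1" and x0: "x \<noteq> 0"
    and dist: "\<And>b b' j. b \<in> B \<Longrightarrow> b' \<in> B \<Longrightarrow> b = b' * q powi j \<Longrightarrow> b = b' \<and> j = 0"
    and x: "\<And>b j. b \<in> B \<Longrightarrow> x * b * q powi j \<noteq> 1"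
  shows "(\<Prod>a\<in>A. jth q (x * a)) / (\<Prod>b\<in>B. jth q (x * b)) =
    (\<Sum>b\<in>B. (\<Prod>a\<in>A. jth q (a / b)) / ((\<Prod>b'\<in>B-{b}. jth q (b' / b)) * qinf q q ^ 2) *
      (\<Sum>\<^sub>\<infinity>m. ((- 1) powi m * q powi tri m) ^ d * (\<Prod>A / \<Prod>B * b ^ d) powi m / (1 - x * b * q powi m)))"
proof -
  define C where "C b = \<Prod>A / \<Prod>B * b ^ d" for b
  define R where "R b N m = (\<Prod>a\<in>A. wfac q N m (a / b)) / ((\<Prod>b'\<in>B-{b}. wfac q N m (b' / b)) *
         (qpf q q (nat (int N - m)) * qpf q q (nat (int N + m))))" for b N m
  define R' where "R' b = (\<Prod>a\<in>A. jth q (a / b)) / ((\<Prod>b'\<in>B-{b}. jth q (b' / b)) * qinf q q ^ 2)" for b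
  define h where "h b m = ((- 1) powi m * q powi tri m) ^ d * C b powi m / (1 - x * b * q powi m)" for b m
  \<comment> \<open>Setting the terms outside the window to 0 puts all N on one index set, as
    dominated convergence requires.\<close>
  define F where "F b N m = (if m \<in> {- int N..int N} then h b m * R b N m else 0)" for b N m
  have bb: "b' / b * q powi m \<noteq> 1" if "b \<in> B" "b' \<in> B" "b' \<noteq> b" for b b' m
  proof
    assume "b' / b * q powi m = 1"
    then have "b = b' * q powi m" using that B0 by (auto simp: field_simps)
    then show False using dist[of b b' m] that by auto
  qed
  have jb: "jth q (b' / b) \<noteq> 0" if "b \<in> B" "b' \<in> B" "b' \<noteq> b" for b b'
    by (rule jth_nonzero[OF q]) (use bb that B0 in auto)
  have jx: "jth q (x * b) \<noteq> 0" if "b \<in> B" for b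
    by (rule jth_nonzero[OF q]) (use x that B0 x0 in auto)
  have J0: "qinf q q \<noteq> 0" by (rule qinf_self_nonzero[OF q(1)])
  have fin: "(\<Prod>a\<in>A. tht q N (x * a)) / (\<Prod>b\<in>B. tht q N (x * b)) = (\<Sum>b\<in>B. infsum (F b N) UNIV)" for N
  proof -
    have eq: "infsum (F b N) UNIV = (\<Sum>m\<in>{- int N..int N}. h b m * R b N m)" for b
    proof -
      have "infsum (F b N) UNIV = infsum (\<lambda>m. h b m * R b N m) {- int N..int N}"
        by (rule infsum_cong_neutral) (auto simp: F_def)
      then show ?thesis by simp
    qed
    show ?thesis
      unfolding eq
    proof (subst finite_theta_partial_fractions[OF q(2) fA fB A0 B0 card d x0])
      show "b = b' \<and> j = 0" if "b \<in> B" "b' \<in> B" "b = b' * q powi j" for b b' j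
        using dist that by blast
      show "x * b * q powi j \<noteq> 1" if "b \<in> B" for b j using x that by blast
    qed (unfold h_def R_def C_def times_divide_eq_left, rule refl)
  qed
  have lim: "(\<lambda>N. infsum (F b N) UNIV) \<longlonglongrightarrow> infsum (\<lambda>m. h b m * R' b) UNIV" if b: "b \<in> B" for b
  proof -
    have b0: "b \<noteq> 0" using b B0 by auto
    have C0: "norm (C b) > 0" using A0 B0 fA fB b0 by (auto simp: C_def prod_zero_iff)
    obtain K where K: "K > 0" "\<And>m. norm (1 / (1 - x * b * q powi m)) \<le> K"
      by (rule norm_one_minus_powi_bounded_below[OF q, of "x * b"]) (use x b x0 b0 in auto)
    have "\<exists>u>0. \<forall>N m. norm (wfac q N m c) \<le> u" for c
    proof -
      obtain u where u: "u > 0" "\<And>n. norm (qpf c q n) \<le> u" using qpf_bound[OF q(1)] by blast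
      obtain v where v: "v > 0" "\<And>n. norm (qpf (q / c) q n) \<le> v" using qpf_bound[OF q(1)] by blast
      show ?thesis unfolding wfac_def norm_mult
        by (intro exI[of _ "u * v"] conjI allI mult_pos_pos mult_mono) (use u v in \<open>auto intro: less_imp_le\<close>)
    qed
    then have "\<forall>c. \<exists>u>0. \<forall>N m. norm (wfac q N m c) \<le> u" by blast
    from choice[OF this] obtain u where u: "\<And>c. u c > 0" "\<And>c N m. norm (wfac q N m c) \<le> u c" by blast
    have "\<exists>l>0. \<forall>N m. l \<le> norm (wfac q N m (b' / b))" if b': "b' \<in> B - {b}" for b'
    proof -
      have c: "b' / b * q powi m \<noteq> 1" for m using bb[of b b'] b b' by auto
      obtain u where u: "u > 0" "\<And>n. u \<le> norm (qpf (b' / b) q n)"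
        using qpf_lower_bound[OF q(1) powi_shift_neq_1(1)[OF q(2) c]] by metis
      obtain v where v: "v > 0" "\<And>n. v \<le> norm (qpf (q / (b' / b)) q n)"
        using qpf_lower_bound[OF q(1) powi_shift_neq_1(2)[OF q(2) c]] by metis
      show ?thesis unfolding wfac_def norm_mult
        by (intro exI[of _ "u * v"] conjI allI mult_pos_pos mult_mono) (use u v in \<open>auto intro: less_imp_le\<close>)
    qed
    then have "\<forall>b'\<in>B-{b}. \<exists>l>0. \<forall>N m. l \<le> norm (wfac q N m (b' / b))" by blast
    from bchoice[OF this] obtain l where l: "\<And>b'. b' \<in> B - {b} \<Longrightarrow> l b' > 0" "\<And>b' N m. b' \<in> B - {b} \<Longrightarrow> l b' \<le> norm (wfac q N m (b' / b))"
      by blast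
    obtain v where v: "v > 0" "\<And>n. v \<le> norm (qpf q q n)"
      using qpf_lower_bound[OF q(1) qpf_self_neq[OF q(1)]] by metis
    \<comment> \<open>A bound for the residue factor that depends on neither N nor m; the majorant
      is then a theta series times K M.\<close>
    define M where "M = (\<Prod>a\<in>A. u (a / b)) / ((\<Prod>b'\<in>B-{b}. l b') * (v * v))"
    have Rb: "norm (R b N m) \<le> M" for N m
      unfolding R_def M_def norm_divide norm_mult prod_norm[symmetric]
    proof (intro frac_le mult_mono prod_mono prod_nonneg mult_pos_pos prod_pos)
    qed (use u l v in \<open>auto intro!: mult_nonneg_nonneg prod_nonneg intro: less_imp_le\<close>)
    have M0: "M \<ge> 0" using Rb[of 0 0] by (meson norm_ge_zero order_trans)
    show ?thesis
    proof (rule infsum_dominated_convergence)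
      show "(\<lambda>N. F b N m) \<longlonglongrightarrow> h b m * R' b" for m
      proof (rule Lim_transform_eventually)
        show "(\<lambda>N. h b m * R b N m) \<longlonglongrightarrow> h b m * R' b"
          unfolding R_def R'_def
          by (intro tendsto_intros wfac_LIMSEQ qpf_pair_LIMSEQ q)
             (use fB J0 jb b in \<open>auto simp: prod_zero_iff\<close>)
        show "\<forall>\<^sub>F N in sequentially. h b m * R b N m = F b N m"
          using eventually_ge_at_top[of "nat \<bar>m\<bar>"] by eventually_elim (auto simp: F_def)
      qed
      show "norm (F b N m) \<le> (norm q powi (int d * tri m) * norm (C b) powi m) * (K * M)" for N m
      proof (cases "m \<in> {- int N..int N}")
        case True
        have "norm (F b N m) = norm (q powi tri m) ^ d * norm (C b powi m) * norm (1 / (1 - x * b * q powi m)) * norm (R b N m)"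
          using True by (simp add: F_def h_def norm_mult norm_divide norm_power norm_power_int power_mult_distrib)
        also have "\<dots> \<le> norm (q powi tri m) ^ d * norm (C b powi m) * K * M"
          using K Rb M0 by (intro mult_mono) auto
        also have "norm (q powi tri m) ^ d = norm q powi (int d * tri m)"
          by (simp add: norm_power_int power_int_power' mult.commute)
        finally show ?thesis by (simp add: norm_power_int mult_ac)
      next
        case False
        then have "F b N m = 0" by (simp only: F_def if_False)
        then show ?thesis using K M0 by simp
      qed
      show "(\<lambda>m. (norm q powi (int d * tri m) * norm (C b) powi m) * (K * M)) summable_on UNIV"
        using q C0 d by (intro summable_on_cmult_left summable_theta) auto
    qed
  qed
  have "(\<lambda>N. (\<Prod>a\<in>A. tht q N (x * a)) / (\<Prod>b\<in>B. tht q N (x * b))) \<longlonglongrightarrow> (\<Sum>b\<in>B. infsum (\<lambda>m. h b m * R' b) UNIV)"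
    unfolding fin by (intro tendsto_sum lim)
  moreover have "(\<lambda>N. (\<Prod>a\<in>A. tht q N (x * a)) / (\<Prod>b\<in>B. tht q N (x * b))) \<longlonglongrightarrow>
       (\<Prod>a\<in>A. jth q (x * a)) / (\<Prod>b\<in>B. jth q (x * b))"
    by (intro tendsto_intros tht_LIMSEQ q) (use fB jx in \<open>auto simp: prod_zero_iff\<close>)
  ultimately have "(\<Prod>a\<in>A. jth q (x * a)) / (\<Prod>b\<in>B. jth q (x * b)) = (\<Sum>b\<in>B. infsum (\<lambda>m. h b m * R' b) UNIV)"
    using LIMSEQ_unique by blast
  also have "\<dots> = (\<Sum>b\<in>B. R' b * infsum (h b) UNIV)"
    by (simp add: infsum_cmult_left' mult.commute[of "infsum _ _"])
  finally show ?thesis unfolding R'_def h_def C_def .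
qed

section \<open>Rank and crank q-series\<close>

lemma norm_qpower_lt_1:
  assumes "norm (x * q) < 1" "norm (q::complex) < 1"
  shows "x * q * q ^ k \<noteq> 1"
proof
  assume h: "x * q * q ^ k = 1"
  have "norm (x * q * q ^ k) = norm (x * q) * norm q ^ k" by (simp add: norm_mult norm_power)
  also have "\<dots> \<le> norm (x * q) * 1" using assms by (intro mult_left_mono power_le_one) auto
  finally show False using h assms by simp
qed

lemma qpf_uniform_lower_bound:
  assumes "norm q < 1" "\<And>k. x * q ^ k \<noteq> 1"
  shows "\<exists>a>0. \<forall>N n. a \<le> norm (qpf (x * q ^ N) q n)"
proof -
  obtain a b where ab: "0 < a" "0 < b" "\<And>n. a \<le> norm (qpf x q n)" "\<And>n. norm (qpf x q n) \<le> b"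
    using qpf_bounds[OF assms] by metis
  have "a / b \<le> norm (qpf (x * q ^ N) q n)" for N n
  proof -
    have "a \<le> norm (qpf x q N) * norm (qpf (x * q ^ N) q n)"
      using ab(3)[of "N + n"] by (simp add: qpf_add norm_mult)
    also have "\<dots> \<le> b * norm (qpf (x * q ^ N) q n)" using ab by (intro mult_right_mono) auto
    finally show ?thesis using ab by (simp add: field_simps)
  qed
  then show ?thesis using ab by (intro exI[of _ "a / b"]) simp
qed

text \<open>Terms of the Durfee square series; x = 1/z and w = z give the rank generating function.
  Independent x and w allow a recurrence in x with w fixed, and the specialisation w = 1.\<close>

definition durf_term :: "complex \<Rightarrow> complex \<Rightarrow> complex \<Rightarrow> nat \<Rightarrow> complex" where
  "durf_term q x w n = (x * w) ^ n * q ^ (n ^ 2) / (qpf (x * q) q n * qpf (w * q) q n)"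

lemma summable_square_power:
  fixes r C :: real
  assumes "0 \<le> r" "r < 1" "C \<ge> 0"
  shows "summable (\<lambda>n. C ^ n * r ^ (n ^ 2))"
proof (cases "r = 0 \<or> C = 0")
  case True
  then have "C ^ n * r ^ (n ^ 2) = 0" if "n \<notin> {0}" for n using that by auto
  then show ?thesis by (intro summable_finite[of "{0}"]) auto
next
  case False
  then have rC: "r > 0" "C > 0" using assms by auto
  have "(\<lambda>n. C * r ^ n) \<longlonglongrightarrow> C * 0" using assms by (intro tendsto_intros LIMSEQ_power_zero) auto
  then have "\<forall>\<^sub>F n in sequentially. C * r ^ n < 1/2" by (intro order_tendstoD) auto
  then have "\<forall>\<^sub>F n in sequentially. norm (C ^ n * r ^ (n ^ 2)) \<le> (1/2) ^ n"
  proof eventually_elim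
    case (elim n)
    have "norm (C ^ n * r ^ (n ^ 2)) = (C * r ^ n) ^ n"
      using rC by (simp add: power_mult_distrib power2_eq_square power_mult)
    also have "\<dots> \<le> (1/2) ^ n" using elim rC by (intro power_mono) auto
    finally show ?case .
  qed
  then show ?thesis by (rule summable_comparison_test_ev) (simp add: summable_geometric)
qed

text \<open>The factor |q|^(N n) is kept in the bound: it makes all terms with n >= 1 disappear as N
  grows.\<close>

lemma durf_term_bound:
  assumes "norm q < 1" "\<And>k. x * q * q ^ k \<noteq> 1" "\<And>k. w * q * q ^ k \<noteq> 1"
  shows "\<exists>K>0. \<forall>N n. norm (durf_term q (x * q ^ N) w n) \<le> K * ((norm (x * w) * norm q ^ N) ^ n * norm q ^ (n ^ 2))"
proof -
  obtain a where a: "0 < a" "\<And>N n. a \<le> norm (qpf (x * q * q ^ N) q n)"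
    using qpf_uniform_lower_bound[OF assms(1,2)] by blast
  obtain b where b: "0 < b" "\<And>n. b \<le> norm (qpf (w * q) q n)"
    using qpf_lower_bound[OF assms(1,3)] by metis
  have "norm (durf_term q (x * q ^ N) w n) \<le> 1 / (a * b) * ((norm (x * w) * norm q ^ N) ^ n * norm q ^ (n ^ 2))" for N n
  proof -
    have "a * b \<le> norm (qpf (x * q * q ^ N) q n) * norm (qpf (w * q) q n)"
      using a b by (intro mult_mono) (auto intro: less_imp_le)
    then have "norm ((x * w * q ^ N) ^ n * q ^ (n ^ 2)) / norm (qpf (x * q * q ^ N) q n * qpf (w * q) q n)
       \<le> norm ((x * w * q ^ N) ^ n * q ^ (n ^ 2)) / (a * b)"
      using a b by (intro divide_left_mono) (auto simp: norm_mult intro!: mult_pos_pos less_le_trans[OF a(1) a(2)] less_le_trans[OF b(1) b(2)])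
    then show ?thesis
      unfolding durf_term_def by (simp add: norm_divide norm_mult norm_power mult_ac)
  qed
  then show ?thesis using a b by (intro exI[of _ "1 / (a * b)"]) simp
qed

lemma durf_summable:
  assumes "norm q < 1" "\<And>k. x * q * q ^ k \<noteq> 1" "\<And>k. w * q * q ^ k \<noteq> 1"
  shows "summable (\<lambda>n. norm (durf_term q x w n))"
proof -
  obtain K where K: "K > 0" "\<And>N n. norm (durf_term q (x * q ^ N) w n) \<le> K * ((norm (x * w) * norm q ^ N) ^ n * norm q ^ (n ^ 2))"
    using durf_term_bound[OF assms] by blast
  show ?thesis
    by (rule summable_comparison_test'[of "\<lambda>n. K * (norm (x * w) ^ n * norm q ^ (n ^ 2))" 0])
       (use K(2)[of 0] assms in \<open>auto intro!: summable_mult summable_square_power\<close>)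
qed

definition durf :: "complex \<Rightarrow> complex \<Rightarrow> complex \<Rightarrow> complex" where
  "durf q x w = (\<Sum>n. durf_term q x w n)"

lemma durf_rec:
  assumes q: "norm q < 1" and x: "\<And>k. x * q * q ^ k \<noteq> 1" and w: "\<And>k. w * q * q ^ k \<noteq> 1"
  shows "durf q x w = 1 - w + w * durf q (x * q) w / (1 - x * q)"
proof -
  have x': "x * q * q * q ^ k \<noteq> 1" for k using x[of "Suc k"] by (simp add: mult_ac)
  \<comment> \<open>A telescoping certificate: the n-th term of the recurrence is U n - U (n+1), and
    U 0 = 1 - w is the inhomogeneous part.\<close>
  define U where "U n = durf_term q x w n * (1 - w * q ^ n)" for n
  have tel: "durf_term q x w n - w * durf_term q (x * q) w n / (1 - x * q) = U n - U (Suc n)" for n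
  proof -
    define A where "A = qpf (x * q) q n"
    define B where "B = qpf (w * q) q n"
    define P where "P = (x * w) ^ n * q ^ (n ^ 2)"
    define Q where "Q = q ^ n"
    have A0: "A \<noteq> 0" "B \<noteq> 0" unfolding A_def B_def by (intro qpf_nonzero x w)+
    have nz: "1 - x * q \<noteq> 0" "1 - x * q * Q \<noteq> 0" "1 - w * q * Q \<noteq> 0"
      using x[of 0] x[of n] w[of n] by (auto simp: Q_def)
    have AS: "qpf (x * q) q (Suc n) = A * (1 - x * q * Q)" "qpf (w * q) q (Suc n) = B * (1 - w * q * Q)"
      by (simp_all add: A_def B_def Q_def qpf_Suc)
    have A2: "qpf (x * q * q) q n = A * (1 - x * q * Q) / (1 - x * q)"
      using AS(1) qpf_Suc'[of "x * q" q n] nz(1) by (metis nonzero_mult_div_cancel_left)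
    have t1: "durf_term q x w n = P / (A * B)" by (simp add: durf_term_def P_def A_def B_def)
    have t2: "durf_term q (x * q) w n = P * Q / (A * (1 - x * q * Q) / (1 - x * q) * B)"
      unfolding durf_term_def A2 B_def[symmetric] by (simp add: P_def Q_def power_mult_distrib mult_ac)
    have "(Suc n) ^ 2 = n ^ 2 + n + n + 1" by (simp add: power2_eq_square)
    then have "q ^ ((Suc n) ^ 2) = q ^ (n ^ 2) * Q * Q * q" by (simp add: Q_def power_add)
    then have t3: "durf_term q x w (Suc n) = P * x * w * Q * Q * q / (A * (1 - x * q * Q) * (B * (1 - w * q * Q)))"
      unfolding durf_term_def AS by (simp add: P_def mult_ac)
    have "P / (A * B) - w * (P * Q / (A * (1 - x * q * Q) / (1 - x * q) * B)) / (1 - x * q) =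
      P / (A * B) * (1 - w * Q) - P * x * w * Q * Q * q / (A * (1 - x * q * Q) * B)"
      using A0 nz(1,2) by (simp add: divide_simps) (simp add: algebra_simps)
    also have "P * x * w * Q * Q * q / (A * (1 - x * q * Q) * B) =
      P * x * w * Q * Q * q / (A * (1 - x * q * Q) * (B * (1 - w * q * Q))) * (1 - w * q * Q)"
      using nz by (simp add: mult.assoc)
    finally show ?thesis unfolding U_def t1 t2 t3 by (simp only: Q_def power_Suc mult_ac)
  qed
  have s1: "summable (\<lambda>n. durf_term q x w n)" using durf_summable[OF q x w] by (rule summable_norm_cancel)
  have s2: "summable (\<lambda>n. durf_term q (x * q) w n)" using durf_summable[OF q x' w] by (rule summable_norm_cancel)
  have "(\<lambda>n. durf_term q x w n - w * durf_term q (x * q) w n / (1 - x * q)) sums (durf q x w - w * durf q (x * q) w / (1 - x * q))"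
    unfolding durf_def by (intro sums_diff sums_divide sums_mult summable_sums s1 s2)
  moreover have "(\<lambda>n. U n - U (Suc n)) sums (U 0 - 0)"
  proof (rule telescope_sums')
    have "(\<lambda>n. durf_term q x w n * (1 - w * q ^ n)) \<longlonglongrightarrow> 0 * (1 - w * 0)"
      using q by (intro tendsto_intros summable_LIMSEQ_zero s1 LIMSEQ_power_zero) auto
    moreover have "U = (\<lambda>n. durf_term q x w n * (1 - w * q ^ n))" by (rule ext) (simp add: U_def)
    ultimately show "U \<longlonglongrightarrow> 0" by simp
  qed
  ultimately have "durf q x w - w * durf q (x * q) w / (1 - x * q) = U 0"
    unfolding tel using sums_unique2 by fastforce
  then show ?thesis by (simp add: U_def durf_term_def algebra_simps)
qed

text \<open>The term n = 0 is 1 and the others carry |q|^(N n) <= |q|^N. This is the boundary value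
  for iterating x -> xq.\<close>

lemma durf_near_1:
  assumes q: "norm q < 1" and x: "\<And>k. x * q * q ^ k \<noteq> 1" and w: "\<And>k. w * q * q ^ k \<noteq> 1"
  shows "\<exists>K\<ge>0. \<forall>N. norm (durf q (x * q ^ N) w - 1) \<le> K * norm q ^ N"
proof -
  obtain K where K: "K > 0" "\<And>N n. norm (durf_term q (x * q ^ N) w n) \<le> K * ((norm (x * w) * norm q ^ N) ^ n * norm q ^ (n ^ 2))"
    using durf_term_bound[OF q x w] by blast
  define s where "s n = norm (x * w) ^ n * norm q ^ (n ^ 2)" for n
  have ss: "summable s" unfolding s_def by (rule summable_square_power) (use q in auto)
  then have ss': "summable (\<lambda>n. s (Suc n))" by (subst summable_Suc_iff)
  have sp: "suminf (\<lambda>n. s (Suc n)) \<ge> 0" using ss' by (rule suminf_nonneg) (simp add: s_def)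
  have "norm (durf q (x * q ^ N) w - 1) \<le> K * suminf (\<lambda>n. s (Suc n)) * norm q ^ N" for N
  proof -
    have xN: "x * q ^ N * q * q ^ k \<noteq> 1" for k using x[of "N + k"] by (simp add: power_add mult_ac)
    have sm: "summable (\<lambda>n. norm (durf_term q (x * q ^ N) w n))" by (rule durf_summable[OF q xN w])
    have sm': "summable (\<lambda>n. norm (durf_term q (x * q ^ N) w (Suc n)))"
      using sm summable_Suc_iff[of "\<lambda>n. norm (durf_term q (x * q ^ N) w n)"] by blast
    have "durf q (x * q ^ N) w = durf_term q (x * q ^ N) w 0 + (\<Sum>n. durf_term q (x * q ^ N) w (Suc n))"
      unfolding durf_def using suminf_split_head[OF summable_norm_cancel[OF sm]] by simp
    then have "norm (durf q (x * q ^ N) w - 1) = norm (\<Sum>n. durf_term q (x * q ^ N) w (Suc n))"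
      by (simp add: durf_term_def)
    also have "\<dots> \<le> (\<Sum>n. norm (durf_term q (x * q ^ N) w (Suc n)))"
      by (rule summable_norm[OF sm'])
    also have "\<dots> \<le> (\<Sum>n. K * s (Suc n) * norm q ^ N)"
    proof (rule suminf_le)
      fix n
      have "(norm q ^ N) ^ Suc n \<le> (norm q ^ N) ^ 1"
        using q by (intro power_decreasing power_le_one) auto
      then have "(norm (x * w) * norm q ^ N) ^ Suc n * norm q ^ (Suc n ^ 2) \<le> s (Suc n) * norm q ^ N"
        unfolding power_mult_distrib s_def by (simp add: mult_left_mono mult_right_mono mult_ac del: power_Suc)
      then have "K * ((norm (x * w) * norm q ^ N) ^ Suc n * norm q ^ (Suc n ^ 2)) \<le> K * (s (Suc n) * norm q ^ N)"
        using K by (intro mult_left_mono) auto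
      with K(2)[of N "Suc n"] show "norm (durf_term q (x * q ^ N) w (Suc n)) \<le> K * s (Suc n) * norm q ^ N"
        by (metis mult.assoc order_trans)
      show "summable (\<lambda>n. K * s (Suc n) * norm q ^ N)"
        by (intro summable_mult2 summable_mult ss')
    qed (rule sm')
    also have "\<dots> = K * suminf (\<lambda>n. s (Suc n)) * norm q ^ N"
      by (simp only: suminf_mult[OF ss'] suminf_mult2[OF summable_mult[OF ss'], symmetric])
    finally show ?thesis .
  qed
  then show ?thesis using K sp by (intro exI[of _ "K * suminf (\<lambda>n. s (Suc n))"]) auto
qed

text \<open>At w = 1 the recurrence loses its inhomogeneous term, and iterating it down to the
  boundary value 1 gives Cauchy's identity.\<close>

lemma durf_1:
  assumes q: "norm q < 1" and x: "\<And>k. x * q * q ^ k \<noteq> 1"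
  shows "durf q x 1 = 1 / qinf (x * q) q"
proof -
  have q1: "1 * q * q ^ k \<noteq> 1" for k using qpf_self_neq[OF q] by simp
  obtain K where K: "K \<ge> 0" "\<And>N. norm (durf q (x * q ^ N) 1 - 1) \<le> K * norm q ^ N"
    using durf_near_1[OF q x q1] by blast
  have it: "durf q x 1 = durf q (x * q ^ N) 1 / qpf (x * q) q N" for N
  proof (induction N)
    case (Suc N)
    have xN: "x * q ^ N * q * q ^ k \<noteq> 1" for k using x[of "N + k"] by (simp add: power_add mult_ac)
    have step: "durf q (x * q ^ N) 1 = durf q (x * q ^ N * q) 1 / (1 - x * q ^ N * q)"
      using durf_rec[OF q xN q1] by simp
    have "durf q (x * q ^ N) 1 / qpf (x * q) q N = durf q (x * q ^ Suc N) 1 / qpf (x * q) q (Suc N)"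
      unfolding step by (simp add: qpf_Suc mult_ac)
    with Suc.IH show ?case by (rule trans)
  qed simp
  have "(\<lambda>N. K * norm q ^ N) \<longlonglongrightarrow> 0" 
    by (rule tendsto_mult_right_zero[OF LIMSEQ_power_zero]) (use q in simp)
  then have "(\<lambda>N. durf q (x * q ^ N) 1 - 1) \<longlonglongrightarrow> 0"
    by (rule Lim_null_comparison[rotated]) (use K in auto)
  then have 1: "(\<lambda>N. durf q (x * q ^ N) 1) \<longlonglongrightarrow> 1"
    by (rule LIM_zero_cancel)
  have "(\<lambda>N. durf q (x * q ^ N) 1 / qpf (x * q) q N) \<longlonglongrightarrow> 1 / qinf (x * q) q"
    by (rule tendsto_divide[OF 1 qpf_LIMSEQ[OF q] qinf_nonzero[OF q x]])
  moreover have "(\<lambda>N. durf q (x * q ^ N) 1 / qpf (x * q) q N) \<longlonglongrightarrow> durf q x 1"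
    using tendsto_const by (rule Lim_transform_eventually) (rule always_eventually, intro allI it)
  ultimately show ?thesis using LIMSEQ_unique by blast
qed

text \<open>Generating function of the partitions with largest part L + 1, where w marks the largest
  part and x the number of parts.\<close>

definition gsum_term :: "complex \<Rightarrow> complex \<Rightarrow> complex \<Rightarrow> nat \<Rightarrow> complex" where
  "gsum_term q x w L = w ^ Suc L * x * q ^ Suc L / qpf (x * q) q (Suc L)"

text \<open>Both series satisfy the same first-order q-difference equation in x and tend to 1 under
  x -> xq. Their difference h solves the homogeneous equation, so h 0 is O(|wq|^N) and therefore
  vanishes.\<close>

lemma gsum_eq_durf:
  assumes q: "norm q < 1" and x: "\<And>k. x * q * q ^ k \<noteq> 1" and w: "norm (w * q) < 1"
  shows "gsum_term q x w sums (durf q x w - 1)"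
proof -
  have w': "w * q * q ^ k \<noteq> 1" for k by (rule norm_qpower_lt_1[OF w q])
  obtain a where a: "0 < a" "\<And>N n. a \<le> norm (qpf (x * q * q ^ N) q n)"
    using qpf_uniform_lower_bound[OF q x] by blast
  define s where "s = suminf (\<lambda>L. norm (w * q) ^ Suc L)"
  have sw: "summable (\<lambda>L. norm (w * q) ^ Suc L)" using w by (simp add: summable_geometric summable_Suc_iff del: power_Suc)
  have tb: "norm (gsum_term q (x * q ^ N) w L) \<le> norm x / a * norm q ^ N * norm (w * q) ^ Suc L" for N L
  proof -
    have pos: "0 < norm (qpf (x * q * q ^ N) q (Suc L))" using a by (meson less_le_trans)
    have "norm (gsum_term q (x * q ^ N) w L) = norm x * norm q ^ N * norm (w * q) ^ Suc L / norm (qpf (x * q * q ^ N) q (Suc L))"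
      by (simp add: gsum_term_def norm_mult norm_divide norm_power power_mult_distrib mult_ac)
    also have "\<dots> \<le> norm x * norm q ^ N * norm (w * q) ^ Suc L / a"
      using a pos by (intro divide_left_mono) (auto intro!: mult_nonneg_nonneg simp del: power_Suc)
    finally show ?thesis by (simp add: mult_ac)
  qed
  have sm: "summable (gsum_term q (x * q ^ N) w)" for N
    by (rule summable_comparison_test'[of "\<lambda>L. norm x / a * norm q ^ N * norm (w * q) ^ Suc L" 0])
       (use tb sw in \<open>auto intro!: summable_mult simp del: power_Suc\<close>)
  define g where "g y = 1 + suminf (gsum_term q y w)" for y
  have gb: "norm (g (x * q ^ N) - 1) \<le> norm x / a * s * norm q ^ N" for N
  proof -
    have "norm (suminf (gsum_term q (x * q ^ N) w)) \<le> (\<Sum>L. norm x / a * norm q ^ N * norm (w * q) ^ Suc L)"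
      by (rule norm_suminf_le) (use tb sw in \<open>auto intro!: summable_mult simp del: power_Suc\<close>)
    also have "\<dots> = norm x / a * norm q ^ N * s"
      unfolding s_def using sw by (subst suminf_mult[symmetric]) (auto simp del: power_Suc)
    finally show ?thesis by (simp add: g_def mult_ac)
  qed
  have grec: "g (x * q ^ N) = 1 - w + w * g (x * q ^ N * q) / (1 - x * q ^ N * q)" for N
  proof -
    define y where "y = x * q ^ N"
    have y: "y * q * q ^ k \<noteq> 1" for k using x[of "N + k"] by (simp add: y_def power_add mult_ac)
    have y1: "1 - y * q \<noteq> 0" using y[of 0] by simp
    have s1: "summable (gsum_term q y w)" unfolding y_def by (rule sm)
    have s2: "summable (gsum_term q (y * q) w)" using sm[of "Suc N"] by (simp add: y_def mult_ac)
    have shift: "gsum_term q y w (Suc L) = w * gsum_term q (y * q) w L / (1 - y * q)" for L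
      unfolding gsum_term_def qpf_Suc'[of "y * q" q "Suc L"] by (simp add: mult_ac)
    have "suminf (gsum_term q y w) = gsum_term q y w 0 + (\<Sum>L. w * gsum_term q (y * q) w L / (1 - y * q))"
      using suminf_split_head[OF s1] shift by simp
    also have "(\<Sum>L. w * gsum_term q (y * q) w L / (1 - y * q)) = w * suminf (gsum_term q (y * q) w) / (1 - y * q)"
      using s2 by (simp add: suminf_mult suminf_divide summable_mult)
    also have "gsum_term q y w 0 = w * y * q / (1 - y * q)" by (simp add: gsum_term_def qpf_def)
    finally have e: "suminf (gsum_term q y w) = w * y * q / (1 - y * q) + w * suminf (gsum_term q (y * q) w) / (1 - y * q)" .
    have "w * y * q / (1 - y * q) = w / (1 - y * q) - w" using y1 by (simp add: field_simps)
    then show ?thesis unfolding g_def y_def[symmetric] e by (simp add: add_divide_distrib ring_distribs)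
  qed
  obtain K where K: "K \<ge> 0" "\<And>N. norm (durf q (x * q ^ N) w - 1) \<le> K * norm q ^ N"
    using durf_near_1[OF q x w'] by blast
  define h where "h N = g (x * q ^ N) - durf q (x * q ^ N) w" for N
  have hrec: "h N = w * h (Suc N) / (1 - x * q * q ^ N)" for N
  proof -
    have xN: "x * q ^ N * q * q ^ k \<noteq> 1" for k using x[of "N + k"] by (simp add: power_add mult_ac)
    have "1 - x * q ^ N * q \<noteq> 0" using xN[of 0] by simp
    then show ?thesis unfolding h_def grec[of N] durf_rec[OF q xN w']
      by (simp add: mult_ac diff_divide_distrib right_diff_distrib)
  qed
  have h0: "h 0 = w ^ N * h N / qpf (x * q) q N" for N
    by (induction N) (simp, subst (asm) hrec, simp add: qpf_Suc mult_ac)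
  have hb: "norm (h N) \<le> (norm x / a * s + K) * norm q ^ N" for N
  proof -
    have "norm (h N) \<le> norm (g (x * q ^ N) - 1) + norm (durf q (x * q ^ N) w - 1)"
      unfolding h_def by (metis diff_diff_eq2 diff_add_cancel norm_triangle_ineq4 add_diff_cancel_right')
    also have "\<dots> \<le> norm x / a * s * norm q ^ N + K * norm q ^ N" by (intro add_mono gb K)
    finally show ?thesis by (simp add: algebra_simps)
  qed
  have "norm (h 0) \<le> (norm x / a * s + K) / a * norm (w * q) ^ N" for N
  proof -
    have a': "a \<le> norm (qpf (x * q) q N)" using a(2)[of 0 N] by simp
    have "norm (h 0) = norm w ^ N * norm (h N) / norm (qpf (x * q) q N)"
      by (subst h0[of N]) (simp add: norm_mult norm_divide norm_power)
    also have "\<dots> \<le> norm w ^ N * ((norm x / a * s + K) * norm q ^ N) / a"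
      using a a' hb by (intro frac_le mult_left_mono mult_nonneg_nonneg[OF _ order_trans[OF norm_ge_zero hb]]) auto
    finally show ?thesis by (simp add: norm_mult power_mult_distrib mult_ac)
  qed
  moreover have "(\<lambda>N. (norm x / a * s + K) / a * norm (w * q) ^ N) \<longlonglongrightarrow> (norm x / a * s + K) / a * 0"
    using w by (intro tendsto_intros LIMSEQ_power_zero) auto
  ultimately have "norm (h 0) \<le> 0"
    by (intro LIMSEQ_le_const[of _ 0]) auto
  then have "g x = durf q x w" by (simp add: h_def)
  moreover have "gsum_term q x w sums suminf (gsum_term q x w)" using sm[of 0] by (simp add: summable_sums)
  moreover have "durf q x w - 1 = suminf (gsum_term q x w)"
    using \<open>g x = durf q x w\<close> by (simp add: g_def flip: \<open>g x = durf q x w\<close>)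
  ultimately show ?thesis by simp
qed

section \<open>From the Durfee series to Lambert series\<close>

lemma inverse_tht_partial_fractions:
  assumes q: "q \<noteq> 0" and self: "\<And>k. q * q ^ k \<noteq> 1" and z0: "z \<noteq> 0"
    and z: "\<And>j. \<bar>j\<bar> \<le> int N \<Longrightarrow> z * q powi j \<noteq> 1"
  shows "1 / tht q N z = (\<Sum>m\<in>{- int N..int N}. (- 1) powi m * q powi tri m /
     (qpf q q (nat (int N - m)) * qpf q q (nat (int N + m))) / (1 - z * q powi m))"
proof -
  have d: "b = b' \<and> j = 0" if "b \<in> {1}" "b' \<in> {1}" "b = b' * q powi j" for b b' :: complex and j
  proof -
    have e: "q powi j = 1" using that by simp
    have "j = 0"
    proof (rule ccontr)
      assume "j \<noteq> 0"
      then obtain k where "\<bar>j\<bar> = int (Suc k)" by (metis nat_abs_int_diff nat_0_iff not0_implies_Suc zero_less_abs_iff int_nat_eq abs_ge_zero of_nat_0 zero_neq_one abs_0_eq nat_eq_iff2)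
      then have "q powi \<bar>j\<bar> = q * q ^ k" by (simp del: of_nat_Suc)
      moreover have "q powi \<bar>j\<bar> = 1" using e q by (cases "j \<ge> 0") (auto simp: power_int_minus)
      ultimately show False using self by metis
    qed
    then show ?thesis using that by simp
  qed
  have "(\<Prod>a\<in>{}. tht q N (z * a)) / (\<Prod>b\<in>{1}. tht q N (z * b)) =
    (\<Sum>b\<in>{1}. \<Sum>m\<in>{- int N..int N}.
       ((- 1) powi m * q powi tri m) ^ 1 * (\<Prod>{} / \<Prod>{1} * b ^ 1) powi m *
       ((\<Prod>a\<in>{}. wfac q N m (a / b)) / ((\<Prod>b'\<in>{1}-{b}. wfac q N m (b' / b)) *
         (qpf q q (nat (int N - m)) * qpf q q (nat (int N + m))))) / (1 - z * b * q powi m))"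
  proof (rule finite_theta_partial_fractions[OF q])
    show "b = b' \<and> j = 0" if "b \<in> {1}" "b' \<in> {1}" "b = b' * q powi j" for b b' :: complex and j
      using d that by blast
    show "z * b * q powi j \<noteq> 1" if "b \<in> {1}" "\<bar>j\<bar> \<le> int N" for b j using z that by simp
  qed (use z0 in auto)
  then show ?thesis by simp
qed

text \<open>The case x = q^M, w = 1 of \<open>durf_1\<close>: every partition has a Durfee rectangle
  with sides k and k + M.\<close>

lemma durfee_rectangle:
  assumes q: "norm q < 1"
  shows "(\<lambda>k. q ^ (k ^ 2 + M * k) / (qpf q q k * qpf q q (M + k))) sums (1 / qinf q q)"
proof -
  have x: "q ^ M * q * q ^ k \<noteq> 1" for k using qpf_self_neq[OF q, of "M + k"] by (simp add: power_add mult_ac)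
  have w: "1 * q * q ^ k \<noteq> 1" for k using qpf_self_neq[OF q] by simp
  have nz: "qpf q q M \<noteq> 0" by (rule qpf_nonzero) (use qpf_self_neq[OF q] in auto)
  have "durf_term q (q ^ M) 1 sums durf q (q ^ M) 1"
    unfolding durf_def by (intro summable_sums summable_norm_cancel[OF durf_summable] q x w)
  then have "durf_term q (q ^ M) 1 sums (1 / qinf (q ^ M * q) q)" by (simp only: durf_1[OF q x])
  then have "(\<lambda>k. durf_term q (q ^ M) 1 k / qpf q q M) sums (1 / qinf (q ^ M * q) q / qpf q q M)"
    by (rule sums_divide)
  moreover have "durf_term q (q ^ M) 1 k / qpf q q M = q ^ (k ^ 2 + M * k) / (qpf q q k * qpf q q (M + k))" for k
    unfolding durf_term_def by (simp add: qpf_add power_add power_mult mult_ac)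
  moreover have "1 / qinf (q ^ M * q) q / qpf q q M = 1 / qinf q q"
    using qinf_split[OF q, of q M] by (simp add: mult_ac)
  ultimately show ?thesis by simp
qed

text \<open>Exchange of summation. For fixed m put n = |m| + k: since n^2 = m^2 + k^2 + 2|m|k, the
  sum over k is a Durfee rectangle sum with M = 2|m|, and q^(m^2) comes out. The weight f is
  arbitrary because the rank needs 1/(1 - z q^m) and Euler's theorem needs 1.\<close>

lemma rank_swap:
  fixes f :: "int \<Rightarrow> complex"
  assumes q: "norm q < 1" "q \<noteq> 0" and f: "\<And>m. norm (f m) \<le> K"
  shows "(\<lambda>n. q ^ (n ^ 2) * (\<Sum>m\<in>{- int n..int n}. (- 1) powi m * q powi tri m /
     (qpf q q (nat (int n - m)) * qpf q q (nat (int n + m))) * f m))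
    sums ((\<Sum>\<^sub>\<infinity>m. (- 1) powi m * q powi (tri m + m * m) * f m) / qinf q q)"
proof -
  define F where "F = (\<lambda>(n, m). if m \<in> {- int n..int n} then q ^ (n ^ 2) * ((- 1) powi m * q powi tri m /
     (qpf q q (nat (int n - m)) * qpf q q (nat (int n + m))) * f m) else 0)"
  obtain a where a: "a > 0" "\<And>n. a \<le> norm (qpf q q n)"
    using qpf_lower_bound[OF q(1) qpf_self_neq[OF q(1)]] by metis
  have K0: "K \<ge> 0" using f[of 0] norm_ge_zero order_trans by blast
  have r: "norm q > 0" using q by simp
  \<comment> \<open>The majorant factors into a function of n and a function of m, so double
    summability reduces to two single sums.\<close>
  define h where "h n m = norm q ^ (n ^ 2) * (norm q powi tri m * (K / (a * a)))" for n :: nat and m :: int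
  have hs: "(\<lambda>m. h n m) summable_on UNIV" for n
    unfolding h_def using summable_theta[OF r q(1), of 1 1]
    by (intro summable_on_cmult_right summable_on_cmult_left) simp
  have hsum: "infsum (h n) UNIV = norm q ^ (n ^ 2) * infsum (\<lambda>m. norm q powi tri m * (K / (a * a))) UNIV" for n
    unfolding h_def by (rule infsum_cmult_right')
  have sq: "summable (\<lambda>n. norm q ^ (n ^ 2))"
    using summable_square_power[of "norm q" 1] q by simp
  have Hs: "(\<lambda>(n, m). h n m) summable_on (UNIV \<times> UNIV)"
  proof (rule summable_on_SigmaI)
    show "((\<lambda>m. (\<lambda>(n, m). h n m) (n, m)) has_sum infsum (h n) UNIV) UNIV" for n
      using hs[of n] by simp
    have "(\<lambda>n. norm q ^ (n ^ 2)) summable_on UNIV"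
      using sq by (simp add: summable_on_UNIV_nonneg_real_iff)
    then show "(\<lambda>n. infsum (h n) UNIV) summable_on UNIV"
      unfolding hsum by (rule summable_on_cmult_left)
  qed (use K0 a in \<open>auto simp: h_def intro!: mult_nonneg_nonneg divide_nonneg_nonneg\<close>)
  have Fb: "norm (F (n, m)) \<le> h n m" for n m
  proof (cases "m \<in> {- int n..int n}")
    case True
    have "a * a \<le> norm (qpf q q (nat (int n - m))) * norm (qpf q q (nat (int n + m)))"
      using a by (intro mult_mono) (auto intro: less_imp_le)
    then have "norm (f m) / (norm (qpf q q (nat (int n - m))) * norm (qpf q q (nat (int n + m)))) \<le> K / (a * a)"
      using f K0 a by (intro frac_le) auto
    then have "norm q ^ (n ^ 2) * (norm q powi tri m * (norm (f m) / (norm (qpf q q (nat (int n - m))) * norm (qpf q q (nat (int n + m)))))) \<le> h n m"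
      unfolding h_def by (intro mult_left_mono) auto
    moreover have "F (n, m) = q ^ (n ^ 2) * ((- 1) powi m * q powi tri m /
     (qpf q q (nat (int n - m)) * qpf q q (nat (int n + m))) * f m)" unfolding F_def using True by (simp only: prod.case if_True)
    ultimately show ?thesis by (simp add: norm_mult norm_divide norm_power norm_power_int mult_ac)
  next
    case False
    then have "F (n, m) = 0" unfolding F_def by (simp only: prod.case if_False)
    then show ?thesis using K0 a by (simp add: h_def)
  qed
  have "(\<lambda>p. norm (F p)) summable_on UNIV \<times> UNIV"
    by (rule summable_on_comparison_test[OF Hs]) (use Fb in auto)
  then have Fs: "F summable_on UNIV \<times> UNIV" by (rule abs_summable_summable)
  have inner: "((\<lambda>m. F (n, m)) has_sum q ^ (n ^ 2) * (\<Sum>m\<in>{- int n..int n}. (- 1) powi m * q powi tri m /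
     (qpf q q (nat (int n - m)) * qpf q q (nat (int n + m))) * f m)) UNIV" for n
    by (rule has_sum_finite_neutralI[of "{- int n..int n}"]) (auto simp: F_def sum_distrib_left)
  have "((\<lambda>n. q ^ (n ^ 2) * (\<Sum>m\<in>{- int n..int n}. (- 1) powi m * q powi tri m /
     (qpf q q (nat (int n - m)) * qpf q q (nat (int n + m))) * f m)) has_sum infsum F (UNIV \<times> UNIV)) UNIV"
    using has_sum_SigmaD[OF has_sum_infsum[OF Fs], of "\<lambda>n. q ^ (n ^ 2) * (\<Sum>m\<in>{- int n..int n}. (- 1) powi m * q powi tri m /
     (qpf q q (nat (int n - m)) * qpf q q (nat (int n + m))) * f m)"] inner by blast
  then have 1: "(\<lambda>n. q ^ (n ^ 2) * (\<Sum>m\<in>{- int n..int n}. (- 1) powi m * q powi tri m /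
     (qpf q q (nat (int n - m)) * qpf q q (nat (int n + m))) * f m)) sums infsum F (UNIV \<times> UNIV)"
    by (rule has_sum_imp_sums)
  have inner2: "((\<lambda>n. F (n, m)) has_sum (- 1) powi m * q powi (tri m + m * m) * f m / qinf q q) UNIV" for m
  proof -
    define M where "M = nat \<bar>m\<bar>"
    have MM: "int M = \<bar>m\<bar>" by (simp add: M_def)
    have Fz: "F (n, m) = 0" if "n \<notin> range (\<lambda>k. M + k)" for n
    proof -
      have "n < M" using that by (metis not_less le_iff_add rangeI)
      then have "m \<notin> {- int n..int n}" using MM by auto
      then show ?thesis by (auto simp: F_def)
    qed
    have Fk: "F (M + k, m) = (- 1) powi m * q powi (tri m + m * m) * f m * (q ^ (k ^ 2 + (2 * M) * k) / (qpf q q k * qpf q q (2 * M + k)))" for k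
    proof -
      have in1: "m \<in> {- int (M + k)..int (M + k)}" using MM by auto
      have e: "qpf q q (nat (int (M + k) - m)) * qpf q q (nat (int (M + k) + m)) = qpf q q k * qpf q q (2 * M + k)"
      proof (cases "m \<ge> 0")
        case True
        then have "nat (int (M + k) - m) = k" "nat (int (M + k) + m) = 2 * M + k" using MM by auto
        then show ?thesis by simp
      next
        case False
        then have "nat (int (M + k) - m) = 2 * M + k" "nat (int (M + k) + m) = k" using MM by auto
        then show ?thesis by simp
      qed
      have "m * m = int (M * M)" using MM by (simp add: abs_mult_self_eq)
      then have e1: "q powi (m * m) = q ^ (M * M)" by (simp only: power_int_of_nat)
      have e2: "q ^ ((M + k) ^ 2) = q ^ (M * M) * q ^ (k ^ 2 + (2 * M) * k)"
      proof -
        have "(M + k) ^ 2 = M * M + (k ^ 2 + (2 * M) * k)" by (simp add: power2_eq_square algebra_simps)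
        then show ?thesis by (simp only: power_add)
      qed
      have "F (M + k, m) = q ^ ((M + k) ^ 2) * ((- 1) powi m * q powi tri m / (qpf q q k * qpf q q (2 * M + k)) * f m)"
        unfolding F_def prod.case e using in1 by (simp only: if_True)
      also have "\<dots> = (- 1) powi m * (q powi tri m * q powi (m * m)) * f m * (q ^ (k ^ 2 + (2 * M) * k) / (qpf q q k * qpf q q (2 * M + k)))"
        unfolding e2 e1 by simp
      also have "q powi tri m * q powi (m * m) = q powi (tri m + m * m)" using q by (simp add: power_int_add)
      finally show ?thesis .
    qed
    have "(\<lambda>n. F (n, m)) summable_on UNIV"
      using Fs summable_on_swap[of F UNIV UNIV] summable_on_SigmaD1[of "\<lambda>m n. F (n, m)" UNIV "\<lambda>_. UNIV" m] by simp
    then have "(\<lambda>n. F (n, m)) summable_on range (\<lambda>k. M + k)" by (rule summable_on_subset_banach) simp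
    then have s: "(\<lambda>k. F (M + k, m)) summable_on UNIV"
      by (subst (asm) summable_on_reindex) (auto simp: o_def)
    have "(\<lambda>k. F (M + k, m)) sums ((- 1) powi m * q powi (tri m + m * m) * f m * (1 / qinf q q))"
      unfolding Fk by (intro sums_mult durfee_rectangle q)
    then have "((\<lambda>k. F (M + k, m)) has_sum ((- 1) powi m * q powi (tri m + m * m) * f m * (1 / qinf q q))) UNIV"
      using s has_sum_imp_sums sums_unique2 summable_iff_has_sum_infsum by metis
    then have "((\<lambda>n. F (n, m)) has_sum ((- 1) powi m * q powi (tri m + m * m) * f m * (1 / qinf q q))) (range (\<lambda>k. M + k))"
      by (subst has_sum_reindex) (auto simp: o_def)
    then have "((\<lambda>n. F (n, m)) has_sum ((- 1) powi m * q powi (tri m + m * m) * f m * (1 / qinf q q))) UNIV"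
      by (rule has_sum_cong_neutral[THEN iffD1, rotated -1]) (use Fz in auto)
    then show ?thesis by simp
  qed
  have "((\<lambda>m. (- 1) powi m * q powi (tri m + m * m) * f m / qinf q q) has_sum infsum F (UNIV \<times> UNIV)) UNIV"
  proof (rule has_sum_SigmaD)
    show "((\<lambda>(m, n). F (n, m)) has_sum infsum F (UNIV \<times> UNIV)) (UNIV \<times> UNIV)"
      using has_sum_infsum[OF Fs] has_sum_swap[where f = F and S = "infsum F (UNIV \<times> UNIV)" and A = UNIV and B = UNIV] by simp
  qed (use inner2 in simp)
  then have "infsum F (UNIV \<times> UNIV) = (\<Sum>\<^sub>\<infinity>m. (- 1) powi m * q powi (tri m + m * m) * f m / qinf q q)"
    by (simp add: infsumI)
  also have "\<dots> = (\<Sum>\<^sub>\<infinity>m. (- 1) powi m * q powi (tri m + m * m) * f m) / qinf q q"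
    unfolding divide_inverse by (rule infsum_cmult_left')
  finally show ?thesis using 1 by simp
qed

text \<open>Multiplied by 1 - z, the denominator of the n-th Durfee term is the truncated theta
  function; its reciprocal is expanded in partial fractions and the sums are exchanged.\<close>

lemma rank_lambert:
  assumes q: "norm q < 1" "q \<noteq> 0" and z: "z \<noteq> 0" "\<And>m. z * q powi m \<noteq> 1"
  shows "durf q (1 / z) z = (1 - z) / qinf q q * (\<Sum>\<^sub>\<infinity>m. (- 1) powi m * q powi (tri m + m * m) / (1 - z * q powi m))"
proof -
  obtain K where K: "K > 0" "\<And>m. norm (1 / (1 - z * q powi m)) \<le> K"
    using norm_one_minus_powi_bounded_below[OF q z] by metis
  have x: "1 / z * q * q ^ k \<noteq> 1" for k using powi_shift_neq_1(2)[OF q(2) z(2), of k] by simp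
  have w: "z * q * q ^ k \<noteq> 1" for k using powi_shift_neq_1(1)[OF q(2) z(2), of "Suc k"] by (simp add: mult_ac)
  have z1: "1 - z \<noteq> 0" using z(2)[of 0] by simp
  have t: "durf_term q (1 / z) z n = (1 - z) * (q ^ (n ^ 2) * (\<Sum>m\<in>{- int n..int n}. (- 1) powi m * q powi tri m /
     (qpf q q (nat (int n - m)) * qpf q q (nat (int n + m))) * (1 / (1 - z * q powi m))))" for n
  proof -
    have "tht q n z = (1 - z) * (qpf (1 / z * q) q n * qpf (z * q) q n)"
      unfolding tht_def qpf_Suc' by simp
    then have "durf_term q (1 / z) z n = (1 - z) * (q ^ (n ^ 2) * (1 / tht q n z))"
      unfolding durf_term_def using z z1 by simp
    also have "1 / tht q n z = (\<Sum>m\<in>{- int n..int n}. (- 1) powi m * q powi tri m /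
     (qpf q q (nat (int n - m)) * qpf q q (nat (int n + m))) * (1 / (1 - z * q powi m)))"
      using inverse_tht_partial_fractions[OF q(2) qpf_self_neq[OF q(1)] z(1), of n] z(2) by simp
    finally show ?thesis .
  qed
  have "durf_term q (1 / z) z sums ((1 - z) * ((\<Sum>\<^sub>\<infinity>m. (- 1) powi m * q powi (tri m + m * m) * (1 / (1 - z * q powi m))) / qinf q q))"
    unfolding t by (intro sums_mult rank_swap[OF q K(2)])
  moreover have "durf_term q (1 / z) z sums durf q (1 / z) z"
    unfolding durf_def by (intro summable_sums summable_norm_cancel[OF durf_summable] q x w)
  ultimately show ?thesis using sums_unique2 by fastforce
qed

text \<open>Euler's pentagonal number theorem, as tri m + m^2 = m(3m+1)/2. With f = 1 in
  \<open>rank_swap\<close> only n = 0 contributes: the coefficients c n m add up to the value at z =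
  0 of the partial fractions of 1/\<open>tht\<close>, which for n >= 1 has a zero of order n
  there.\<close>

theorem pentagonal:
  assumes q: "norm q < 1" "q \<noteq> 0"
  shows "(\<Sum>\<^sub>\<infinity>m. (- 1) powi m * q powi (tri m + m * m)) = qinf q q"
proof -
  define c where "c n m = (- 1) powi m * q powi tri m /
     (qpf q q (nat (int n - m)) * qpf q q (nat (int n + m)))" for n :: nat and m
  have c0: "(\<Sum>m\<in>{- int n..int n}. c n m) = 0" if "n \<ge> 1" for n
  proof -
    have ev: "\<forall>\<^sub>F z in at 0. \<forall>j\<in>{- int n..int n}. z * q powi j \<noteq> 1"
    proof (subst eventually_ball_finite_distrib)
      show "\<forall>j\<in>{- int n..int n}. \<forall>\<^sub>F z in at 0. z * q powi j \<noteq> 1"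
      proof
        fix j
        have "(\<lambda>z. z * q powi j) \<midarrow>0\<rightarrow> 0 * q powi j" by (intro tendsto_intros)
        then show "\<forall>\<^sub>F z in at 0. z * q powi j \<noteq> 1" by (rule tendsto_imp_eventually_ne) simp
      qed
    qed simp
    have L1: "(\<lambda>z. \<Sum>m\<in>{- int n..int n}. c n m / (1 - z * q powi m)) \<midarrow>0\<rightarrow> (\<Sum>m\<in>{- int n..int n}. c n m / (1 - 0 * q powi m))"
      by (intro tendsto_intros) auto
    have L2: "(\<lambda>z. z ^ n / (winc q n * win q n z)) \<midarrow>0\<rightarrow> 0 ^ n / (winc q n * win q n 0)"
      unfolding win_def using q by (intro tendsto_intros) (auto simp: winc_nonzero)
    have ev2: "\<forall>\<^sub>F z in at 0. z ^ n / (winc q n * win q n z) = (\<Sum>m\<in>{- int n..int n}. c n m / (1 - z * q powi m))"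
      using ev eventually_neq_at_within[of 0]
    proof eventually_elim
      case (elim z)
      have "1 / tht q n z = (\<Sum>m\<in>{- int n..int n}. c n m / (1 - z * q powi m))"
        unfolding c_def
      proof (rule inverse_tht_partial_fractions[OF q(2) qpf_self_neq[OF q(1)]])
        show "z \<noteq> 0" using elim(2) .
        show "z * q powi j \<noteq> 1" if "\<bar>j\<bar> \<le> int n" for j
        proof -
          have "j \<in> {- int n..int n}" using that by (simp add: abs_le_iff)
          then show ?thesis using elim(1) by blast
        qed
      qed
      moreover have "1 / tht q n z = z ^ n / (winc q n * win q n z)"
        using elim q by (simp add: tht_win)
      ultimately show ?case by simp
    qed
    from LIM_unique[OF Lim_transform_eventually[OF L2 ev2] L1]
    show ?thesis using that by (simp add: zero_power)
  qed
  have "(\<lambda>n. q ^ (n ^ 2) * (\<Sum>m\<in>{- int n..int n}. c n m * 1))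
    sums ((\<Sum>\<^sub>\<infinity>m. (- 1) powi m * q powi (tri m + m * m) * 1) / qinf q q)"
    unfolding c_def by (rule rank_swap[OF q, of _ 1]) simp
  moreover have "q ^ (n ^ 2) * (\<Sum>m\<in>{- int n..int n}. c n m * 1) = (if n = 0 then 1 else 0)" for n
    using c0[of n] by (auto simp: c_def)
  ultimately have "(\<lambda>n. if n = 0 then 1 else 0) sums ((\<Sum>\<^sub>\<infinity>m. (- 1) powi m * q powi (tri m + m * m)) / qinf q q)"
    by simp
  moreover have "(\<lambda>n. if n = 0 then 1 else 0 :: complex) sums 1" using sums_single[of 0 "\<lambda>_. 1::complex"] by simp
  ultimately have "(\<Sum>\<^sub>\<infinity>m. (- 1) powi m * q powi (tri m + m * m)) / qinf q q = 1"
    using sums_unique2 by blast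
  then show ?thesis using qinf_self_nonzero[OF q(1)] by simp
qed

section \<open>The q-binomial theorem and its derivative\<close>

text \<open>The logarithmic derivative x d/dx log (x;q)_inf.\<close>

definition lam :: "complex \<Rightarrow> complex \<Rightarrow> complex" where
  "lam q x = x * deriv (\<lambda>x. qinf x q) x / qinf x q"

definition qbin :: "complex \<Rightarrow> complex \<Rightarrow> nat \<Rightarrow> complex" where
  "qbin q a w = qpf a q w / qpf q q w"

lemma qbin_summable:
  assumes q: "norm q < 1" and s: "norm s < 1"
  shows "summable (\<lambda>w. qbin q a w * s ^ w)"
proof -
  obtain l where l: "l > 0" "\<And>n. l \<le> norm (qpf q q n)"
    using qpf_lower_bound[OF q qpf_self_neq[OF q]] by metis
  obtain u where u: "u > 0" "\<And>n. norm (qpf a q n) \<le> u" using qpf_bound[OF q] by metis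
  have b: "norm (qbin q a w * s ^ w) \<le> u / l * norm s ^ w" for w
    unfolding qbin_def norm_mult norm_divide norm_power
    using l u by (intro mult_right_mono frac_le) (auto intro: less_imp_le)
  have "summable (\<lambda>w. u / l * norm s ^ w)"
    by (intro summable_mult summable_geometric) (use s in simp)
  then show ?thesis
    by (rule summable_comparison_test'[of _ 0]) (rule b)
qed

text \<open>The recursion of the coefficients gives H(t)(1 - t) = (1 - at) H(tq); iterate it and use
  the continuity of H at 0, where H is 1.\<close>

theorem q_binomial:
  assumes q: "norm q < 1" and s: "norm s < 1"
  shows "(\<Sum>w. qbin q a w * s ^ w) = qinf (a * s) q / qinf s q"
proof -
  define H where "H t = (\<Sum>w. qbin q a w * t ^ w)" for t
  have nq: "norm (t * q) < 1" if "norm t < 1" for t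
    using that q by (simp add: norm_mult) (meson less_trans mult_le_one mult_left_le le_less_trans norm_ge_zero less_imp_le)
  have rec: "H t * (1 - t) = (1 - a * t) * H (t * q)" if t: "norm t < 1" for t
  proof -
    have s1: "summable (\<lambda>w. qbin q a w * t ^ w)" by (rule qbin_summable[OF q t])
    have s2: "summable (\<lambda>w. qbin q a w * (t * q) ^ w)" by (rule qbin_summable[OF q nq[OF t]])
    have c: "qbin q a (Suc w) * (1 - q ^ Suc w) = qbin q a w * (1 - a * q ^ w)" for w
    proof -
      have "1 - q * q ^ w \<noteq> 0" using qpf_self_neq[OF q, of w] by simp
      then show ?thesis unfolding qbin_def by (simp add: qpf_Suc)
    qed
    have "H t - H (t * q) = (\<Sum>w. qbin q a w * t ^ w - qbin q a w * (t * q) ^ w)"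
      unfolding H_def by (rule suminf_diff[OF s1 s2])
    also have "\<dots> = (\<Sum>w. qbin q a (Suc w) * t ^ Suc w - qbin q a (Suc w) * (t * q) ^ Suc w)"
      using suminf_split_head[OF summable_diff[OF s1 s2]] by simp
    also have "\<dots> = (\<Sum>w. t * (qbin q a w * t ^ w) - a * t * (qbin q a w * (t * q) ^ w))"
    proof (rule suminf_cong)
      fix w
      have "qbin q a (Suc w) * t ^ Suc w - qbin q a (Suc w) * (t * q) ^ Suc w = (qbin q a (Suc w) * (1 - q ^ Suc w)) * t ^ Suc w"
        by (simp add: power_mult_distrib algebra_simps)
      also have "\<dots> = t * (qbin q a w * t ^ w) - a * t * (qbin q a w * (t * q) ^ w)"
        unfolding c by (simp add: power_mult_distrib algebra_simps)
      finally show "qbin q a (Suc w) * t ^ Suc w - qbin q a (Suc w) * (t * q) ^ Suc w =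
        t * (qbin q a w * t ^ w) - a * t * (qbin q a w * (t * q) ^ w)" .
    qed
    also have "\<dots> = t * H t - a * t * H (t * q)"
      unfolding H_def using s1 s2 by (simp add: suminf_diff[symmetric] suminf_mult[symmetric] summable_mult)
    finally show ?thesis by (simp add: algebra_simps)
  qed
  have tq: "norm (s * q ^ N) < 1" for N
    by (induction N) (use s nq in \<open>auto simp: mult.assoc[symmetric] mult.commute[of q] simp del: norm_mult\<close>)
  have sk: "s * q ^ k \<noteq> 1" for k using tq[of k] by auto
  have it: "H s * qpf s q N = qpf (a * s) q N * H (s * q ^ N)" for N
  proof (induction N)
    case (Suc N)
    have r: "H (s * q ^ N) * (1 - s * q ^ N) = (1 - a * (s * q ^ N)) * H (s * q ^ N * q)" by (rule rec[OF tq])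
    have "H s * qpf s q (Suc N) = (H s * qpf s q N) * (1 - s * q ^ N)" by (simp add: qpf_Suc)
    also have "\<dots> = qpf (a * s) q N * (H (s * q ^ N) * (1 - s * q ^ N))" unfolding Suc by simp
    also have "\<dots> = qpf (a * s) q (Suc N) * H (s * q ^ Suc N)" unfolding r by (simp add: qpf_Suc mult_ac)
    finally show ?case .
  qed simp
  have "isCont H 0"
  proof -
    have "(H has_field_derivative (\<Sum>n. diffs (qbin q a) n * 0 ^ n)) (at 0)"
      unfolding H_def[abs_def] by (rule termdiffs_strong'[of 1]) (auto intro: qbin_summable[OF q])
    then show ?thesis by (rule DERIV_isCont)
  qed
  moreover have "(\<lambda>N. s * q ^ N) \<longlonglongrightarrow> 0" by (rule tendsto_mult_right_zero[OF LIMSEQ_power_zero[OF q]])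
  ultimately have "(\<lambda>N. H (s * q ^ N)) \<longlonglongrightarrow> H 0" by (rule isCont_tendsto_compose)
  moreover have "H 0 = 1" unfolding H_def using powser_zero[of "qbin q a"] by (simp add: qbin_def)
  ultimately have "(\<lambda>N. qpf (a * s) q N * H (s * q ^ N)) \<longlonglongrightarrow> qinf (a * s) q * 1"
    by (intro tendsto_mult qpf_LIMSEQ[OF q]) simp
  moreover have "(\<lambda>N. H s * qpf s q N) \<longlonglongrightarrow> H s * qinf s q"
    by (intro tendsto_mult tendsto_const qpf_LIMSEQ[OF q])
  ultimately have "H s * qinf s q = qinf (a * s) q * 1"
    unfolding it using LIMSEQ_unique by blast
  then show ?thesis using qinf_nonzero[OF q sk] by (simp add: H_def field_simps)
qed

lemma qinf_deriv:
  "norm q < 1 \<Longrightarrow> ((\<lambda>x. qinf x q) has_field_derivative deriv (\<lambda>x. qinf x q) x) (at x)"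
  using holomorphic_derivI[OF qinf_holomorphic open_UNIV] by simp

text \<open>The operator s d/ds applied to the q-binomial theorem. The factor w that it creates
  becomes the number of ones of a partition.\<close>

lemma q_binomial_deriv:
  assumes q: "norm q < 1" and s: "norm s < 1" and nz: "qinf (a * s) q \<noteq> 0"
  shows "(\<lambda>w. of_nat w * (qbin q a w * s ^ w)) sums (qinf (a * s) q / qinf s q * (lam q (a * s) - lam q s))"
proof -
  have sk: "s * q ^ k \<noteq> 1" for k
  proof
    assume "s * q ^ k = 1"
    moreover have "norm (s * q ^ k) \<le> norm s * 1" unfolding norm_mult norm_power using q by (intro mult_left_mono power_le_one) auto
    ultimately show False using s by simp
  qed
  have nz2: "qinf s q \<noteq> 0" by (rule qinf_nonzero[OF q sk])
  let ?H = "\<lambda>z. \<Sum>n. qbin q a n * z ^ n"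
  define D where "D = (\<Sum>n. diffs (qbin q a) n * s ^ n)"
  have d1: "(?H has_field_derivative D) (at s)"
    unfolding D_def by (rule termdiffs_strong'[of 1]) (use s in \<open>auto intro: qbin_summable[OF q]\<close>)
  have d2: "((\<lambda>z. qinf (a * z) q / qinf z q) has_field_derivative
     ((deriv (\<lambda>x. qinf x q) (a * s) * a) * qinf s q - qinf (a * s) q * deriv (\<lambda>x. qinf x q) s) / (qinf s q * qinf s q)) (at s)"
  proof (rule DERIV_divide[OF _ qinf_deriv[OF q] nz2])
    show "((\<lambda>z. qinf (a * z) q) has_field_derivative deriv (\<lambda>x. qinf x q) (a * s) * a) (at s)"
      by (rule DERIV_chain2[OF qinf_deriv[OF q]]) (auto intro!: derivative_eq_intros)
  qed
  have "(?H has_field_derivative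
     ((deriv (\<lambda>x. qinf x q) (a * s) * a) * qinf s q - qinf (a * s) q * deriv (\<lambda>x. qinf x q) s) / (qinf s q * qinf s q)) (at s)"
    by (rule DERIV_cong_ev[THEN iffD1, OF refl _ refl d2])
       (use s q_binomial[OF q] in \<open>auto simp: eventually_nhds_metric dist_norm intro!: exI[of _ "1 - norm s"] dest!: norm_triangle_ineq2[THEN order.strict_trans1]\<close>)
  from DERIV_unique[OF d1 this]
  have D: "D = ((deriv (\<lambda>x. qinf x q) (a * s) * a) * qinf s q - qinf (a * s) q * deriv (\<lambda>x. qinf x q) s) / (qinf s q * qinf s q)" .
  have "summable (\<lambda>n. diffs (qbin q a) n * s ^ n)"
  proof (rule termdiff_converges[of _ 1])
    show "summable (\<lambda>n. qbin q a n * x ^ n)" if "norm x < 1" for x using that by (rule qbin_summable[OF q])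
  qed (use s in simp)
  then have "(\<lambda>n. diffs (qbin q a) n * s ^ n) sums D" unfolding D_def by (rule summable_sums)
  then have "(\<lambda>n. s * (diffs (qbin q a) n * s ^ n)) sums (s * D)" by (rule sums_mult)
  then have "(\<lambda>n. of_nat (Suc n) * (qbin q a (Suc n) * s ^ Suc n)) sums (s * D)"
    by (simp add: diffs_def mult_ac)
  then have "(\<lambda>w. of_nat w * (qbin q a w * s ^ w)) sums (s * D + of_nat 0 * (qbin q a 0 * s ^ 0))"
    by (subst (asm) sums_Suc_iff) 
  moreover have "s * D = qinf (a * s) q / qinf s q * (lam q (a * s) - lam q s)"
    unfolding D lam_def using nz nz2 by (simp add: field_simps)
  ultimately show ?thesis by simp
qed

section \<open>Conjugation of partitions\<close>

definition parts_ge :: "nat multiset \<Rightarrow> nat \<Rightarrow> nat" where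
  "parts_ge \<pi> i = size {#p \<in># \<pi>. i \<le> p#}"

text \<open>The column lengths of the Ferrers diagram.\<close>

definition conjugate :: "nat multiset \<Rightarrow> nat multiset" where
  "conjugate \<pi> = mset (map (parts_ge \<pi>) [1..<Suc (largest_part \<pi>)])"

lemma largest_part_ge: "p \<in># \<pi> \<Longrightarrow> p \<le> largest_part \<pi>"
  by (auto simp: largest_part_def)

lemma sum_parts_ge:
  assumes "\<forall>p\<in>#\<pi>. p \<le> L"
  shows "(\<Sum>i\<in>{1..<Suc L}. parts_ge \<pi> i) = sum_mset \<pi>"
  using assms
proof (induction \<pi>)
  case (add p \<pi>)
  have "(\<Sum>i\<in>{1..<Suc L}. parts_ge (add_mset p \<pi>) i) = (\<Sum>i\<in>{1..<Suc L}. (if i \<le> p then 1 else 0) + parts_ge \<pi> i)"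
    by (intro sum.cong) (auto simp: parts_ge_def)
  also have "\<dots> = (\<Sum>i\<in>{1..<Suc L}. if i \<le> p then 1 else 0) + (\<Sum>i\<in>{1..<Suc L}. parts_ge \<pi> i)"
    by (rule sum.distrib)
  also have "(\<Sum>i\<in>{1..<Suc L}. if i \<le> p then 1 else 0) = card {i\<in>{1..<Suc L}. i \<le> p}"
    by (simp only: card_eq_sum sum.inter_filter[OF finite_atLeastLessThan])
  also have "{i\<in>{1..<Suc L}. i \<le> p} = {1..p}" using add.prems by auto
  also have "(\<Sum>i\<in>{1..<Suc L}. parts_ge \<pi> i) = sum_mset \<pi>" using add by simp
  finally show ?case by simp
qed (simp add: parts_ge_def)

lemma parts_ge_antimono: "i \<le> j \<Longrightarrow> parts_ge \<pi> j \<le> parts_ge \<pi> i"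
  by (induction \<pi>) (auto simp: parts_ge_def)

lemma parts_ge_eq_0: "(\<And>p. p \<in># \<pi> \<Longrightarrow> p < i) \<Longrightarrow> parts_ge \<pi> i = 0"
  by (induction \<pi>) (auto simp: parts_ge_def dest: leD)

lemma parts_ge_eq_count: "parts_ge \<pi> p = count \<pi> p + parts_ge \<pi> (Suc p)"
proof (induction \<pi>)
  case (add x \<pi>)
  then show ?case by (auto simp: parts_ge_def)
qed (simp add: parts_ge_def)

lemma conjugate_partition:
  assumes "\<pi> \<in> partitions n" and "n > 0"
  shows "conjugate \<pi> \<in> partitions n" "size (conjugate \<pi>) = largest_part \<pi>" "largest_part (conjugate \<pi>) = size \<pi>"
proof -
  have pos: "\<forall>p\<in>#\<pi>. 0 < p" and sm: "sum_mset \<pi> = n" using assms by (auto simp: partitions_def)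
  have ne: "\<pi> \<noteq> {#}" using sm assms(2) by auto
  define L where "L = largest_part \<pi>"
  have Lin: "L \<in># \<pi>" using ne Max_in[of "set_mset \<pi>"] by (simp add: L_def largest_part_def)
  have L1: "L \<ge> 1" using Lin pos by force
  have "parts_ge \<pi> i > 0" if "i \<le> L" for i
  proof -
    have "L \<in># {#p \<in># \<pi>. i \<le> p#}" using Lin that by simp
    then have "{#p \<in># \<pi>. i \<le> p#} \<noteq> {#}" by (metis empty_iff set_mset_empty)
    then show ?thesis unfolding parts_ge_def by (simp only: nonempty_has_size)
  qed
  moreover have "sum_mset (conjugate \<pi>) = n"
  proof -
    have "sum_mset (conjugate \<pi>) = (\<Sum>i\<in>{1..<Suc L}. parts_ge \<pi> i)"
      unfolding conjugate_def L_def[symmetric]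
      by (simp only: sum_mset_sum_list interv_sum_list_conv_sum_set_nat set_upt)
    then show ?thesis using sum_parts_ge[of \<pi> L] largest_part_ge[of _ \<pi>] sm by (simp add: L_def)
  qed
  ultimately show "conjugate \<pi> \<in> partitions n"
    by (auto simp: partitions_def conjugate_def L_def)
  show "size (conjugate \<pi>) = largest_part \<pi>" by (simp add: conjugate_def)
  have one: "parts_ge \<pi> 1 = size \<pi>"
    using pos by (induction \<pi>) (auto simp: parts_ge_def)
  have set: "set_mset (conjugate \<pi>) = parts_ge \<pi> ` {1..<Suc L}"
    by (simp add: conjugate_def L_def del: upt_Suc)
  have "Max (set_mset (conjugate \<pi>)) = size \<pi>"
    unfolding set
  proof (rule Max_eqI)
    show "size \<pi> \<in> parts_ge \<pi> ` {1..<Suc L}" using L1 one by (intro rev_image_eqI[of 1]) auto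
    show "y \<le> size \<pi>" if "y \<in> parts_ge \<pi> ` {1..<Suc L}" for y
      using that parts_ge_antimono[of 1 _ \<pi>] one by auto
  qed simp
  moreover have "conjugate \<pi> \<noteq> {#}" using set L1 by auto
  ultimately show "largest_part (conjugate \<pi>) = size \<pi>" by (simp add: largest_part_def)
qed

text \<open>The column lengths decrease, so their multiset determines their list, and the
  multiplicity of p is the difference of the columns p and p + 1.\<close>

lemma conjugate_inj: "inj_on conjugate (partitions n)"
proof (rule inj_onI)
  fix \<pi> \<rho> assume p: "\<pi> \<in> partitions n" "\<rho> \<in> partitions n" and eq: "conjugate \<pi> = conjugate \<rho>"
  define L where "L = largest_part \<pi>"
  have "size (conjugate \<pi>) = size (conjugate \<rho>)" using eq by simp
  then have L': "largest_part \<rho> = L" by (simp add: conjugate_def L_def del: upt_Suc)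
  have srt: "sorted (rev (map (parts_ge \<sigma>) [1..<Suc L]))" for \<sigma>
    unfolding rev_map[symmetric]
    by (auto simp: sorted_iff_nth_mono_less rev_nth intro!: parts_ge_antimono simp del: upt_Suc)
  have "mset (rev (map (parts_ge \<pi>) [1..<Suc L])) = mset (rev (map (parts_ge \<rho>) [1..<Suc L]))"
    using eq by (simp only: conjugate_def L' L_def[symmetric] mset_rev)
  then have "rev (map (parts_ge \<pi>) [1..<Suc L]) = rev (map (parts_ge \<rho>) [1..<Suc L])"
    using srt properties_for_sort by metis
  then have "map (parts_ge \<pi>) [1..<Suc L] = map (parts_ge \<rho>) [1..<Suc L]" by simp
  then have ge: "parts_ge \<pi> i = parts_ge \<rho> i" if "i \<in> {1..<Suc L}" for i
    using that by (simp del: upt_Suc)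
  have zero: "parts_ge \<sigma> i = 0" if "i > largest_part \<sigma>" for i \<sigma>
    by (rule parts_ge_eq_0) (use that largest_part_ge[of _ \<sigma>] in fastforce)
  have ge': "parts_ge \<pi> i = parts_ge \<rho> i" if "i \<ge> 1" for i
    using ge[of i] zero[of \<pi> i] zero[of \<rho> i] that L' by (cases "i \<le> L") (auto simp: L_def)
  show "\<pi> = \<rho>"
  proof (rule multiset_eqI)
    fix x
    show "count \<pi> x = count \<rho> x"
    proof (cases "x = 0")
      case True
      have "0 \<notin># \<pi>" "0 \<notin># \<rho>" using p by (auto simp: partitions_def)
      then show ?thesis using True by (simp add: not_in_iff)
    next
      case False
      then show ?thesis
        using parts_ge_eq_count[of \<pi> x] parts_ge_eq_count[of \<rho> x] ge'[of x] ge'[of "Suc x"] by simp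
    qed
  qed
qed

text \<open>Conjugation negates the rank and exchanges the number of parts with the largest part. So
  NT 3 sums the largest part over the partitions of rank 2 mod 5, the same partitions over which NT
  2 sums the number of parts.\<close>

lemma NT_diff_eq_rank_sum:
  assumes "n > 0"
  shows "NT 3 5 n - NT 2 5 n = (\<Sum>\<pi> | \<pi> \<in> partitions n \<and> [partition_rank \<pi> = 2] (mod 5). partition_rank \<pi>)"
proof -
  \<comment> \<open>An injective self-map of a finite set is onto.\<close>
  have bij: "bij_betw conjugate (partitions n) (partitions n)"
    unfolding bij_betw_def using conjugate_inj conjugate_partition(1)[OF _ assms]
    by (meson endo_inj_surj finite_partitions image_subsetI)
  have rank: "partition_rank (conjugate \<pi>) = - partition_rank \<pi>" if "\<pi> \<in> partitions n" for \<pi>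
    using conjugate_partition[OF that assms] by (simp add: partition_rank_def)
  have cg: "[- r = 3] (mod 5) \<longleftrightarrow> [r = 2] (mod 5)" for r :: int
    unfolding cong_def by presburger
  have "NT 3 5 n = (\<Sum>\<pi>\<in>partitions n. if [partition_rank \<pi> = 3] (mod 5) then int (size \<pi>) else 0)"
    unfolding NT_def by (simp add: sum.If_cases finite_partitions Int_def)
  also have "\<dots> = (\<Sum>\<pi>\<in>partitions n. if [partition_rank (conjugate \<pi>) = 3] (mod 5) then int (size (conjugate \<pi>)) else 0)"
    by (rule sum.reindex_bij_betw[OF bij, symmetric])
  also have "\<dots> = (\<Sum>\<pi>\<in>partitions n. if [partition_rank \<pi> = 2] (mod 5) then int (largest_part \<pi>) else 0)"
    by (intro sum.cong refl) (simp add: rank cg conjugate_partition(2)[OF _ assms])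
  also have "\<dots> = (\<Sum>\<pi> | \<pi> \<in> partitions n \<and> [partition_rank \<pi> = 2] (mod 5). int (largest_part \<pi>))"
    by (simp add: sum.If_cases finite_partitions Int_def)
  finally show ?thesis
    unfolding NT_def by (simp add: partition_rank_def sum_subtractf)
qed

section \<open>Generating functions of multisets\<close>

text \<open>The weight of a multiset in an Euler product. Sums run over all of
  \<open>msets S\<close> at once and are graded by size only in
  \<open>partition_series\<close>.\<close>

definition mpr :: "('a \<Rightarrow> 'b::comm_monoid_mult) \<Rightarrow> 'a multiset \<Rightarrow> 'b" where
  "mpr f M = (\<Prod>p\<in>#M. f p)"

definition msets :: "'a set \<Rightarrow> 'a multiset set" where
  "msets S = {M. set_mset M \<subseteq> S}"

lemma mpr_simps [simp]: "mpr f {#} = 1" "mpr f (add_mset p M) = f p * mpr f M" "mpr f (M + N) = mpr f M * mpr f N"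
  "mpr f (replicate_mset k p) = f p ^ k"
  by (simp_all add: mpr_def)

lemma mpr_norm: "norm (mpr f M) = mpr (\<lambda>p. norm (f p :: 'b :: real_normed_field)) M"
  by (induction M) (auto simp: norm_mult)

lemma mpr_nonneg: "(\<And>p. f p \<ge> (0::real)) \<Longrightarrow> mpr f M \<ge> 0"
  by (induction M) auto

lemma has_sum_geometric:
  fixes x :: "'b :: {real_normed_field, banach}"
  assumes "norm x < 1"
  shows "((\<lambda>k. x ^ k) has_sum (1 / (1 - x))) UNIV"
  by (rule norm_summable_imp_has_sum) (use assms in \<open>auto simp: norm_power geometric_sums\<close>)

text \<open>Euler product by induction on S: a multiset over \<open>insert p S\<close> is a
  multiplicity of p together with a multiset over S, and the multiplicities form a geometric
  series.\<close>

lemma msets_finite_has_sum: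
  fixes f :: "'a \<Rightarrow> 'b :: {real_normed_field, banach}"
  assumes "finite S" "\<And>p. p \<in> S \<Longrightarrow> norm (f p) < 1"
  shows "(\<lambda>M. norm (mpr f M)) summable_on msets S \<and> (mpr f has_sum (\<Prod>p\<in>S. 1 / (1 - f p))) (msets S)"
  using assms
proof (induction S rule: finite_induct)
  case empty
  have e: "msets {} = {{#}}" by (auto simp: msets_def)
  show ?case unfolding e by (intro conjI summable_on_finite has_sum_finiteI) simp_all
next
  case (insert p S)
  then have IH: "(\<lambda>M. norm (mpr f M)) summable_on msets S" "(mpr f has_sum (\<Prod>p\<in>S. 1 / (1 - f p))) (msets S)"
    and fp: "norm (f p) < 1" by auto
  define g where "g = (\<lambda>(k, M). replicate_mset k p + M)"
  have bij: "bij_betw g (UNIV \<times> msets S) (msets (insert p S))"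
  proof (rule bij_betw_byWitness[of _ "\<lambda>M. (count M p, filter_mset (\<lambda>x. x \<noteq> p) M)"])
    have c0: "count M p = 0" if "M \<in> msets S" for M
      using that insert.hyps(2) by (auto simp: msets_def count_eq_zero_iff)
    have fl: "filter_mset (\<lambda>x. x \<noteq> p) M = M" if "M \<in> msets S" for M
      using that insert.hyps(2) by (auto simp: msets_def filter_mset_eq_conv)
    show "\<forall>a\<in>UNIV \<times> msets S. (count (g a) p, filter_mset (\<lambda>x. x \<noteq> p) (g a)) = a"
      by (auto simp: g_def c0 fl)
    show "\<forall>M\<in>msets (insert p S). g (count M p, filter_mset (\<lambda>x. x \<noteq> p) M) = M"
      by (auto simp: g_def intro!: multiset_eqI)
    show "g ` (UNIV \<times> msets S) \<subseteq> msets (insert p S)"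
      by (auto simp: g_def msets_def dest!: in_diffD split: if_splits)
    show "(\<lambda>M. (count M p, filter_mset (\<lambda>x. x \<noteq> p) M)) ` msets (insert p S) \<subseteq> UNIV \<times> msets S"
      by (auto simp: msets_def)
  qed
  define F where "F = (\<lambda>(k, M). f p ^ k * mpr f M)"
  have Fg: "F x = mpr f (g x)" for x by (cases x) (simp add: F_def g_def)
  have nsum: "(\<lambda>x. norm (F x)) summable_on UNIV \<times> msets S"
  proof (rule summable_on_SigmaI)
    show "((\<lambda>M. norm (F (k, M))) has_sum (norm (f p) ^ k * infsum (\<lambda>M. norm (mpr f M)) (msets S))) (msets S)" for k
      unfolding F_def by (simp add: norm_mult norm_power) (intro has_sum_cmult_right has_sum_infsum IH)
    have "(\<lambda>k. norm (f p) ^ k) summable_on UNIV"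
      using has_sum_geometric[of "norm (f p)"] fp by (auto simp: summable_on_def)
    then show "(\<lambda>k. norm (f p) ^ k * infsum (\<lambda>M. norm (mpr f M)) (msets S)) summable_on UNIV"
      by (rule summable_on_cmult_left)
  qed auto
  have "(F has_sum (1 / (1 - f p) * (\<Prod>p\<in>S. 1 / (1 - f p)))) (UNIV \<times> msets S)"
  proof (rule has_sum_SigmaI)
    show "((\<lambda>M. F (k, M)) has_sum (f p ^ k * (\<Prod>p\<in>S. 1 / (1 - f p)))) (msets S)" for k
      unfolding F_def by (simp only: prod.case) (intro has_sum_cmult_right IH)
    show "((\<lambda>k. f p ^ k * (\<Prod>p\<in>S. 1 / (1 - f p))) has_sum (1 / (1 - f p) * (\<Prod>p\<in>S. 1 / (1 - f p)))) UNIV"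
      by (intro has_sum_cmult_left has_sum_geometric fp)
    show "F summable_on UNIV \<times> msets S" using nsum by (rule abs_summable_summable)
  qed
  then have "(mpr f has_sum (1 / (1 - f p) * (\<Prod>p\<in>S. 1 / (1 - f p)))) (msets (insert p S))"
    unfolding Fg[abs_def] by (subst (asm) has_sum_reindex_bij_betw[OF bij])
  moreover have "(\<lambda>M. norm (mpr f M)) summable_on msets (insert p S)"
    using nsum unfolding Fg by (subst (asm) summable_on_reindex_bij_betw[OF bij])
  ultimately show ?case using insert.hyps by simp
qed

text \<open>Passage to infinite S. The bound B on finite products of absolute values gives
  summability, and truncation to parts up to K gives the value. B is returned because
  \<open>crank_gf\<close> needs a bound uniform in a parameter.\<close>

lemma msets_has_sum:
  fixes f :: "nat \<Rightarrow> complex"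
  assumes f: "\<And>p. p \<in> S \<Longrightarrow> norm (f p) < 1"
    and lim: "(\<lambda>K. \<Prod>p\<in>S \<inter> {..K}. 1 / (1 - f p)) \<longlonglongrightarrow> l"
    and bd: "\<And>K. (\<Prod>p\<in>S \<inter> {..K}. 1 / (1 - norm (f p))) \<le> B"
  shows "(\<lambda>M. norm (mpr f M)) summable_on msets S" "(mpr f has_sum l) (msets S)"
    "infsum (\<lambda>M. norm (mpr f M)) (msets S) \<le> B"
proof -
  have fs: "sum (\<lambda>M. norm (mpr f M)) X \<le> B" if X: "finite X" "X \<subseteq> msets S" for X
  proof -
    obtain K where K: "\<And>M p. M \<in> X \<Longrightarrow> p \<in># M \<Longrightarrow> p \<le> K"
    proof -
      have "finite (\<Union>M\<in>X. set_mset M)" using X by simp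
      then obtain K where "\<forall>p\<in>(\<Union>M\<in>X. set_mset M). p \<le> K" using finite_nat_set_iff_bounded_le by blast
      then show ?thesis using that by blast
    qed
    have X': "X \<subseteq> msets (S \<inter> {..K})" using X K by (fastforce simp: msets_def)
    have h: "(mpr (\<lambda>p. norm (f p)) has_sum (\<Prod>p\<in>S \<inter> {..K}. 1 / (1 - norm (f p)))) (msets (S \<inter> {..K}))"
      using msets_finite_has_sum[of "S \<inter> {..K}" "\<lambda>p. norm (f p)"] f by auto
    have "sum (\<lambda>M. norm (mpr f M)) X \<le> (\<Prod>p\<in>S \<inter> {..K}. 1 / (1 - norm (f p)))"
      unfolding mpr_norm by (rule finite_sum_le_has_sum[OF h X(1) X' mpr_nonneg]) simp
    then show ?thesis using bd[of K] by simp
  qed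
  show ns: "(\<lambda>M. norm (mpr f M)) summable_on msets S"
    by (rule nonneg_bdd_above_summable_on) (auto intro!: bdd_aboveI2 fs)
  show "infsum (\<lambda>M. norm (mpr f M)) (msets S) \<le> B"
    by (rule infsum_le_finite_sums[OF ns fs])
  define G where "G K M = (if set_mset M \<subseteq> {..K} then mpr f M else 0)" for K :: nat and M
  have "(\<lambda>K. infsum (G K) (msets S)) \<longlonglongrightarrow> infsum (mpr f) (msets S)"
  proof (rule infsum_dominated_convergence[OF _ _ ns])
    fix M assume "M \<in> msets S"
    have "\<exists>K. \<forall>p\<in>set_mset M. p \<le> K" using finite_nat_set_iff_bounded_le[of "set_mset M"] by simp
    then obtain K where "set_mset M \<subseteq> {..K}" by auto
    have "\<forall>\<^sub>F k in sequentially. mpr f M = G k M"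
      using eventually_ge_at_top[of K]
    proof eventually_elim
      case (elim k)
      then have "set_mset M \<subseteq> {..k}" using \<open>set_mset M \<subseteq> {..K}\<close> by auto
      then show ?case by (simp add: G_def)
    qed
    then show "(\<lambda>K. G K M) \<longlonglongrightarrow> mpr f M" using tendsto_const by (rule Lim_transform_eventually[rotated])
  qed (auto simp: G_def)
  moreover have "infsum (G K) (msets S) = (\<Prod>p\<in>S \<inter> {..K}. 1 / (1 - f p))" for K
  proof -
    have "infsum (G K) (msets S) = infsum (mpr f) (msets (S \<inter> {..K}))"
      by (rule infsum_cong_neutral) (auto simp: G_def msets_def)
    also have "\<dots> = (\<Prod>p\<in>S \<inter> {..K}. 1 / (1 - f p))"
      using msets_finite_has_sum[of "S \<inter> {..K}" f] f by (auto intro: infsumI)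
    finally show ?thesis .
  qed
  ultimately have "infsum (mpr f) (msets S) = l" using lim LIMSEQ_unique by auto
  then show "(mpr f has_sum l) (msets S)" using abs_summable_summable[OF ns] has_sum_infsum by blast
qed

lemma partition_series:
  fixes G :: "nat multiset \<Rightarrow> complex"
  assumes s: "((\<lambda>\<pi>. G \<pi> * q ^ sum_mset \<pi>) has_sum l) (msets {0<..})"
  shows "(\<lambda>n. (\<Sum>\<pi>\<in>partitions n. G \<pi>) * q ^ n) sums l"
proof -
  have bij: "bij_betw (\<lambda>(n, \<pi>). \<pi>) (Sigma UNIV partitions) (msets {0<..})"
    by (rule bij_betw_byWitness[of _ "\<lambda>\<pi>. (sum_mset \<pi>, \<pi>)"]) (auto simp: partitions_def msets_def)
  have "((\<lambda>x. case x of (n, \<pi>) \<Rightarrow> G \<pi> * q ^ sum_mset \<pi>) has_sum l) (Sigma UNIV partitions)"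
    using has_sum_reindex_bij_betw[OF bij, of "\<lambda>\<pi>. G \<pi> * q ^ sum_mset \<pi>" l] s by (simp add: case_prod_unfold)
  then have "((\<lambda>n. \<Sum>\<pi>\<in>partitions n. G \<pi> * q ^ sum_mset \<pi>) has_sum l) UNIV"
    by (rule has_sum_SigmaD) (auto intro!: has_sum_finiteI finite_partitions)
  moreover have "(\<Sum>\<pi>\<in>partitions n. G \<pi> * q ^ sum_mset \<pi>) = (\<Sum>\<pi>\<in>partitions n. G \<pi>) * q ^ n" for n
    unfolding sum_distrib_right by (intro sum.cong refl) (auto simp: partitions_def)
  ultimately show ?thesis using has_sum_imp_sums by fastforce
qed

section \<open>Generating functions for the rank and the crank\<close>

lemma summable_on_nat_of_summable:
  fixes f :: "nat \<Rightarrow> real"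
  assumes "summable f" "\<And>n. f n \<ge> 0"
  shows "f summable_on UNIV"
  using assms summable_on_UNIV_nonneg_real_iff by blast

lemma qpf_of_real: "qpf (of_real x) (of_real r) n = of_real (\<Prod>k<n. 1 - x * r ^ k)"
  by (simp add: qpf_def)

lemma mpr_power: "mpr (\<lambda>p. (q::complex) ^ p * c) M = q ^ sum_mset M * c ^ size M"
  by (induction M) (auto simp: power_add mult_ac)

lemma prod_Suc_interval: "(\<Prod>p\<in>{1..n}. f p) = (\<Prod>k<n. f (Suc k))"
  by (rule prod.reindex_bij_witness[of _ Suc "\<lambda>p. p - 1"]) auto

lemma norm_power_Suc_less_1:
  assumes "norm (q::complex) < 1"
  shows "norm (q * q ^ k) < 1"
proof -
  have "norm (q * q ^ k) \<le> norm q * 1"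
    unfolding norm_mult norm_power using assms by (intro mult_left_mono power_le_one) auto
  then show ?thesis using assms by simp
qed

text \<open>Remove one largest part L + 1; the rest is any multiset of parts up to L + 1, and the
  rank is L minus its size. The condition |q| < |z| makes the inner geometric series converge, |zq|
  < 1 the outer sum.\<close>

lemma rank_gf:
  assumes q: "norm q < 1" "q \<noteq> 0" and z: "norm q < norm z" "norm (z * q) < 1"
  shows "(\<lambda>\<pi>. norm (z powi partition_rank \<pi> * q ^ sum_mset \<pi>)) summable_on msets {0<..}"
    "((\<lambda>\<pi>. z powi partition_rank \<pi> * q ^ sum_mset \<pi>) has_sum durf q (1 / z) z) (msets {0<..})"
proof -
  define T where "T \<pi> = z powi partition_rank \<pi> * q ^ sum_mset \<pi>" for \<pi>
  have z0: "z \<noteq> 0" using z q by auto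
  define g where "g = (\<lambda>(L, M). add_mset (Suc L) M)"
  define D where "D = Sigma UNIV (\<lambda>L. msets {1..Suc L})"
  have bij: "bij_betw g D (msets {0<..} - {{#}})"
  proof (rule bij_betw_byWitness[of _ "\<lambda>\<pi>. (largest_part \<pi> - 1, \<pi> - {#largest_part \<pi>#})"])
    have lp: "largest_part (add_mset (Suc L) M) = Suc L" if "M \<in> msets {1..Suc L}" for L M
      using that by (auto simp: largest_part_def msets_def intro!: Max_eqI)
    show "\<forall>a\<in>D. (largest_part (g a) - 1, g a - {#largest_part (g a)#}) = a"
      by (auto simp: D_def g_def lp)
    have mem: "largest_part \<pi> \<in># \<pi>" if "\<pi> \<noteq> {#}" for \<pi> :: "nat multiset"
      using that Max_in[of "set_mset \<pi>"] by (simp add: largest_part_def)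
    have pos: "largest_part \<pi> \<ge> 1" if "\<pi> \<in> msets {0<..} - {{#}}" for \<pi>
      using mem[of \<pi>] that by (force simp: msets_def)
    show "\<forall>\<pi>\<in>msets {0<..} - {{#}}. g (largest_part \<pi> - 1, \<pi> - {#largest_part \<pi>#}) = \<pi>"
    proof
      fix \<pi> :: "nat multiset" assume p: "\<pi> \<in> msets {0<..} - {{#}}"
      have "Suc (largest_part \<pi> - 1) = largest_part \<pi>" using pos[OF p] by simp
      then show "g (largest_part \<pi> - 1, \<pi> - {#largest_part \<pi>#}) = \<pi>"
        unfolding g_def prod.case using mem[of \<pi>] p by simp
    qed
    show "g ` D \<subseteq> msets {0<..} - {{#}}" by (force simp: g_def D_def msets_def)
    show "(\<lambda>\<pi>. (largest_part \<pi> - 1, \<pi> - {#largest_part \<pi>#})) ` (msets {0<..} - {{#}}) \<subseteq> D"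
    proof
      fix x assume "x \<in> (\<lambda>\<pi>. (largest_part \<pi> - 1, \<pi> - {#largest_part \<pi>#})) ` (msets {0<..} - {{#}})"
      then obtain \<pi> where p: "\<pi> \<in> msets {0<..} - {{#}}" "x = (largest_part \<pi> - 1, \<pi> - {#largest_part \<pi>#})" by blast
      have "set_mset (\<pi> - {#largest_part \<pi>#}) \<subseteq> {1..Suc (largest_part \<pi> - 1)}"
        using p(1) largest_part_ge[of _ \<pi>] pos[OF p(1)] by (auto simp: msets_def dest!: in_diffD)
      then show "x \<in> D" by (simp add: p(2) D_def msets_def)
    qed
  qed
  have fp: "norm (q ^ p * (1 / z)) < 1" if "p \<in> {1..Suc L}" for p L
  proof -
    have "norm (q ^ p) \<le> norm q ^ 1" unfolding norm_power using q that by (intro power_decreasing) auto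
    then have "norm (q ^ p * (1 / z)) \<le> norm q / norm z" by (simp add: norm_mult norm_divide divide_right_mono)
    also have "\<dots> < 1" using z z0 by (simp add: divide_less_eq)
    finally show ?thesis .
  qed
  have Tg: "T (g (L, M)) = z ^ L * q ^ Suc L * mpr (\<lambda>p. q ^ p * (1 / z)) M" if "M \<in> msets {1..Suc L}" for L M
  proof -
    have "largest_part (add_mset (Suc L) M) = Suc L"
      using that by (auto simp: largest_part_def msets_def intro!: Max_eqI)
    then have "partition_rank (add_mset (Suc L) M) = int L - int (size M)" by (simp add: partition_rank_def)
    then show ?thesis unfolding T_def g_def prod.case mpr_power
      using z0 by (simp add: power_int_diff power_add power_divide mult_ac)
  qed
  have in1: "((\<lambda>M. T (g (L, M))) has_sum gsum_term q (1 / z) z L) (msets {1..Suc L})"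
    and in2: "((\<lambda>M. norm (T (g (L, M)))) has_sum norm z ^ L * norm q ^ Suc L * (\<Prod>p\<in>{1..Suc L}. 1 / (1 - norm q ^ p / norm z))) (msets {1..Suc L})" for L
  proof -
    have "(mpr (\<lambda>p. q ^ p * (1 / z)) has_sum (\<Prod>p\<in>{1..Suc L}. 1 / (1 - q ^ p * (1 / z)))) (msets {1..Suc L})"
      using msets_finite_has_sum[of "{1..Suc L}" "\<lambda>p. q ^ p * (1 / z)"] fp by auto
    then have "((\<lambda>M. z ^ L * q ^ Suc L * mpr (\<lambda>p. q ^ p * (1 / z)) M) has_sum
       (z ^ L * q ^ Suc L * (\<Prod>p\<in>{1..Suc L}. 1 / (1 - q ^ p * (1 / z))))) (msets {1..Suc L})"
      by (rule has_sum_cmult_right)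
    moreover have "z ^ L * q ^ Suc L * (\<Prod>p\<in>{1..Suc L}. 1 / (1 - q ^ p * (1 / z))) = gsum_term q (1 / z) z L"
      unfolding gsum_term_def qpf_def prod_Suc_interval using z0 by (simp add: prod_dividef mult_ac)
    ultimately show "((\<lambda>M. T (g (L, M))) has_sum gsum_term q (1 / z) z L) (msets {1..Suc L})"
      using Tg by (subst has_sum_cong) auto
    have fp': "norm (norm q ^ p / norm z) < 1" if "p \<in> {1..Suc L}" for p
      using fp[OF that] by (simp add: norm_mult norm_divide norm_power)
    have "(mpr (\<lambda>p. norm q ^ p / norm z) has_sum (\<Prod>p\<in>{1..Suc L}. 1 / (1 - norm q ^ p / norm z))) (msets {1..Suc L})"
      using msets_finite_has_sum[of "{1..Suc L}" "\<lambda>p. norm q ^ p / norm z"] fp' by auto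
    then have "((\<lambda>M. norm z ^ L * norm q ^ Suc L * mpr (\<lambda>p. norm q ^ p / norm z) M) has_sum
       (norm z ^ L * norm q ^ Suc L * (\<Prod>p\<in>{1..Suc L}. 1 / (1 - norm q ^ p / norm z)))) (msets {1..Suc L})"
      by (rule has_sum_cmult_right)
    moreover have "norm (T (g (L, M))) = norm z ^ L * norm q ^ Suc L * mpr (\<lambda>p. norm q ^ p / norm z) M" if "M \<in> msets {1..Suc L}" for M
      unfolding Tg[OF that] norm_mult mpr_norm by (simp add: norm_mult norm_power norm_divide)
    ultimately show "((\<lambda>M. norm (T (g (L, M)))) has_sum norm z ^ L * norm q ^ Suc L * (\<Prod>p\<in>{1..Suc L}. 1 / (1 - norm q ^ p / norm z))) (msets {1..Suc L})"
      by (subst has_sum_cong) auto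
  qed
  define t where "t L = norm z ^ L * norm q ^ Suc L * (\<Prod>p\<in>{1..Suc L}. 1 / (1 - norm q ^ p / norm z))" for L
  have t0: "t L \<ge> 0" for L using in2[of L] unfolding t_def by (rule has_sum_nonneg) simp
  have x: "1 / z * q * q ^ k \<noteq> 1" for k
    by (rule norm_qpower_lt_1) (use q z z0 in \<open>auto simp: norm_divide divide_less_eq\<close>)
  have ts: "summable t"
  proof -
    \<comment> \<open>The series of absolute values is the same series at |q| and |z|, so its
      convergence is again \<open>gsum_eq_durf\<close>.\<close>
    define r where "r = complex_of_real (norm q)"
    define w where "w = complex_of_real (norm z)"
    have rr: "norm r < 1" using q by (simp add: r_def)
    have xx: "1 / w * r * r ^ k \<noteq> 1" for k
      by (rule norm_qpower_lt_1) (use q z z0 in \<open>auto simp: norm_divide divide_less_eq r_def w_def\<close>)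
    have ww: "norm (w * r) < 1" using z by (simp add: w_def r_def norm_mult)
    have "summable (gsum_term r (1 / w) w)" using gsum_eq_durf[OF rr xx ww] by (rule sums_summable)
    moreover have "gsum_term r (1 / w) w = (\<lambda>L. complex_of_real (t L))"
    proof (rule ext)
      show "gsum_term r (1 / w) w L = of_real (t L)" for L
        unfolding gsum_term_def t_def r_def w_def prod_Suc_interval qpf_def using z0
        by (simp add: prod_dividef mult_ac)
    qed
    ultimately show ?thesis by (simp only: summable_of_real_iff)
  qed
  have ns: "(\<lambda>x. norm (T (g x))) summable_on D"
    unfolding D_def
  proof (rule summable_on_SigmaI[where g = t])
    show "((\<lambda>M. norm (T (g (L, M)))) has_sum t L) (msets {1..Suc L})" for L
      using in2 by (simp only: t_def)
    show "t summable_on UNIV" by (rule summable_on_nat_of_summable[OF ts t0])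
  qed simp
  have "gsum_term q (1 / z) z sums (durf q (1 / z) z - 1)" by (rule gsum_eq_durf[OF q(1) x z(2)])
  moreover have "summable (\<lambda>L. norm (gsum_term q (1 / z) z L))"
  proof (rule summable_comparison_test'[OF ts, of 0])
    fix L
    have "norm (gsum_term q (1 / z) z L) \<le> t L"
      unfolding t_def by (rule norm_has_sum_bound[OF in2 in1])
    then show "norm (norm (gsum_term q (1 / z) z L)) \<le> t L" by simp
  qed
  ultimately have "(gsum_term q (1 / z) z has_sum (durf q (1 / z) z - 1)) UNIV"
    by (intro norm_summable_imp_has_sum) auto
  then have "((\<lambda>x. T (g x)) has_sum (durf q (1 / z) z - 1)) D"
    unfolding D_def using in1 abs_summable_summable[OF ns[unfolded D_def]]
    by (intro has_sum_SigmaI) auto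
  then have hs: "(T has_sum (durf q (1 / z) z - 1)) (msets {0<..} - {{#}})"
    by (subst (asm) has_sum_reindex_bij_betw[OF bij])
  have ns': "(\<lambda>\<pi>. norm (T \<pi>)) summable_on (msets {0<..} - {{#}})"
    using ns by (subst (asm) summable_on_reindex_bij_betw[OF bij])
  \<comment> \<open>The empty partition has no largest part to remove; it has rank 0 and contributes
    1.\<close>
  have ins: "msets {0<..} = insert {#} (msets {0<..} - {{#}})" by (auto simp: msets_def)
  have T0: "T {#} = 1" by (simp add: T_def partition_rank_def largest_part_def)
  show "(\<lambda>\<pi>. norm (z powi partition_rank \<pi> * q ^ sum_mset \<pi>)) summable_on msets {0<..}"
    unfolding T_def[symmetric] using ns' by (subst ins) (subst summable_on_insert_iff)
  have "(T has_sum (T {#} + (durf q (1 / z) z - 1))) (insert {#} (msets {0<..} - {{#}}))"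
    by (rule has_sum_insert[OF _ hs]) simp
  then show "((\<lambda>\<pi>. z powi partition_rank \<pi> * q ^ sum_mset \<pi>) has_sum durf q (1 / z) z) (msets {0<..})"
    unfolding T_def[symmetric] ins[symmetric] T0 by simp
qed

definition crank_prod :: "complex \<Rightarrow> complex \<Rightarrow> complex" where
  "crank_prod q z = qinf q q / (qinf (z * q) q * qinf (q / z) q)"

text \<open>Sort by the number w of ones. For w > 0 the ones contribute (q/z)^w, and a part p >= 2
  contributes q^p if p <= w and z q^p otherwise. Summing over these parts leaves (1-q)/(zq;q)_inf
  times the differentiated q-binomial series with a = zq and s = q/z, whence the argument as =
  q^2.\<close>

lemma crank_gf:
  assumes q: "norm q < 1" "q \<noteq> 0" and z: "norm z = 1"
  shows "((\<lambda>\<pi>. of_nat (num_ones \<pi>) * z powi partition_crank \<pi> * q ^ sum_mset \<pi>) has_sum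
     crank_prod q z * (lam q (q * q) - lam q (q / z))) (msets {0<..})"
proof -
  define T where "T \<pi> = of_nat (num_ones \<pi>) * z powi partition_crank \<pi> * q ^ sum_mset \<pi>" for \<pi>
  have z0: "z \<noteq> 0" using z by auto
  define g where "g = (\<lambda>(w, M). replicate_mset w (1::nat) + M)"
  define D where "D = (UNIV :: nat set) \<times> msets {2::nat..}"
  have c1: "count M 1 = 0" if "M \<in> msets {2::nat..}" for M
    using that by (force simp: msets_def count_eq_zero_iff)
  have bij: "bij_betw g D (msets {0<..})"
  proof (rule bij_betw_byWitness[of _ "\<lambda>M. (count M 1, filter_mset (\<lambda>x. x \<noteq> 1) M)"])
    have fl: "filter_mset (\<lambda>x. x \<noteq> 1) M = M" if "M \<in> msets {2::nat..}" for M
      using c1[OF that] by (intro multiset_eqI) auto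
    show "\<forall>a\<in>D. (count (g a) 1, filter_mset (\<lambda>x. x \<noteq> 1) (g a)) = a"
      by (auto simp: g_def D_def c1[unfolded One_nat_def] fl[unfolded One_nat_def])
    show "\<forall>M\<in>msets {0<..}. g (count M 1, filter_mset (\<lambda>x. x \<noteq> 1) M) = M"
      by (auto simp: g_def intro!: multiset_eqI)
    show "g ` D \<subseteq> msets {0<..}"
      by (force simp: g_def D_def msets_def split: if_splits)
    show "(\<lambda>M. (count M 1, filter_mset (\<lambda>x. x \<noteq> 1) M)) ` msets {0<..} \<subseteq> D"
      by (force simp: msets_def D_def)
  qed
  define f where "f w p = (if p \<le> w then q ^ p else z * q ^ p)" for w p :: nat
  have nf: "norm (f w p) = norm q ^ p" for w p by (simp add: f_def norm_mult norm_power z)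
  have Tg: "T (g (w, M)) = of_nat w * (q / z) ^ w * mpr (f w) M" if M: "M \<in> msets {2..}" for w M
  proof (cases "w = 0")
    case True
    then show ?thesis using c1[OF M] by (simp add: T_def g_def num_ones_def)
  next
    case False
    have no: "num_ones (replicate_mset w 1 + M) = w" using c1[OF M] by (simp add: num_ones_def)
    have "num_parts_gt_ones (replicate_mset w 1 + M) = size {#p \<in># M. w < p#}"
    proof -
      have "filter_mset (\<lambda>p. w < p) (replicate_mset k 1) = {#}" for k
        by (induction k) (use False in auto)
      then show ?thesis unfolding num_parts_gt_ones_def no by simp
    qed
    then have cr: "partition_crank (replicate_mset w 1 + M) = int (size {#p \<in># M. w < p#}) - int w"
      using no False by (simp add: partition_crank_def)
    have "mpr (f w) M = q ^ sum_mset M * z ^ size {#p \<in># M. w < p#}"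
      by (induction M) (auto simp: f_def power_add mult_ac)
    then show ?thesis
      unfolding T_def g_def prod.case no cr using z0
      by (simp add: power_int_diff power_add power_divide mult_ac)
  qed
  have rq: "norm (complex_of_real (norm q)) < 1" using q by simp
  obtain a where a: "a > 0" "\<And>n. a \<le> norm (qpf (of_real (norm q)) (of_real (norm q)) n)"
    using qpf_lower_bound[OF rq qpf_self_neq[OF rq]] by metis
  \<comment> \<open>Since |z| = 1, every factor has modulus |q|^p, so one bound serves all w and the
    outer sum is dominated by w |q|^w.\<close>
  define B where "B = 1 / a"
  have bd: "(\<Prod>p\<in>{2..} \<inter> {..K}. 1 / (1 - norm (f w p))) \<le> B" for K w
  proof -
    have pos: "1 - norm q ^ p > 0" if "p \<ge> 1" for p
      using q that by (simp add: power_less_one_iff)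
    have "(\<Prod>p\<in>{2..} \<inter> {..K}. 1 / (1 - norm (f w p))) \<le> (\<Prod>p\<in>{1..K}. 1 / (1 - norm q ^ p))"
      unfolding nf
    proof (rule prod_mono2)
      show "1 \<le> 1 / (1 - norm q ^ p)" if "p \<in> {1..K} - {2..} \<inter> {..K}" for p
        using pos[of p] that by (simp add: le_divide_eq)
      show "0 \<le> 1 / (1 - norm q ^ p)" if "p \<in> {2..} \<inter> {..K}" for p
        using pos[of p] that by simp
    qed auto
    also have "\<dots> = 1 / (\<Prod>k<K. 1 - norm q * norm q ^ k)"
      unfolding prod_Suc_interval by (simp add: prod_dividef)
    also have "\<dots> \<le> 1 / a"
    proof (rule divide_left_mono)
      have pp: "(\<Prod>k<K. 1 - norm q * norm q ^ k) > 0"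
      proof (rule prod_pos)
        show "0 < 1 - norm q * norm q ^ k" for k using pos[of "Suc k"] by simp
      qed
      have "norm (qpf (of_real (norm q)) (of_real (norm q)) K) = \<bar>\<Prod>k<K. 1 - norm q * norm q ^ k\<bar>"
        unfolding qpf_of_real by (simp only: norm_of_real)
      then show "a \<le> (\<Prod>k<K. 1 - norm q * norm q ^ k)" using a(2)[of K] pp by simp
      show "0 < (\<Prod>k<K. 1 - norm q * norm q ^ k) * a" using a(1) pp by simp
    qed simp
    finally show ?thesis by (simp add: B_def)
  qed
  have fl: "norm (f w p) < 1" if "p \<in> {2..}" for w p
    unfolding nf using q that by (simp add: power_less_one_iff)
  have zq: "z * q ^ Suc w * q ^ k \<noteq> 1" for w k
  proof
    assume "z * q ^ Suc w * q ^ k = 1"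
    then have "norm (q * q ^ (w + k)) = 1" by (metis norm_mult norm_one power_Suc power_add mult.assoc z mult_1)
    moreover have "norm (q * q ^ (w + k)) < 1" by (rule norm_power_Suc_less_1[OF q(1)])
    ultimately show False by simp
  qed
  have qz: "q / z * q ^ k \<noteq> 1" for k
  proof
    assume "q / z * q ^ k = 1"
    then have "norm (q * q ^ k) = 1" by (metis norm_mult norm_divide norm_one z div_by_1 times_divide_eq_left)
    moreover have "norm (q * q ^ k) < 1" by (rule norm_power_Suc_less_1[OF q(1)])
    ultimately show False by simp
  qed
  define l where "l w = 1 / (qpf (q * q) q (w - 1) * qinf (z * q ^ Suc w) q)" for w
  have lim: "(\<lambda>K. \<Prod>p\<in>{2..} \<inter> {..K}. 1 / (1 - f w p)) \<longlonglongrightarrow> l w" if w: "w \<ge> 1" for w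
  proof -
    have eq: "(\<Prod>p\<in>{2..} \<inter> {..w + n}. 1 / (1 - f w p)) = 1 / (qpf (q * q) q (w - 1) * qpf (z * q ^ Suc w) q n)" for n
    proof -
      have qq: "q * q * q ^ (a - 2) = q ^ a" if "2 \<le> a" for a
        using that by (metis le_add_diff_inverse power_add power2_eq_square)
      have qq2: "q * (q ^ w * q ^ (a - Suc w)) = q ^ a" if "Suc w \<le> a" for a
        using that by (metis le_add_diff_inverse power_add power_Suc mult.assoc)
      have un: "{2..} \<inter> {..w + n} = {2..w} \<union> {Suc w..w + n}" using w by auto
      have "(\<Prod>p\<in>{2..} \<inter> {..w + n}. 1 / (1 - f w p)) = (\<Prod>p\<in>{2..w}. 1 / (1 - f w p)) * (\<Prod>p\<in>{Suc w..w + n}. 1 / (1 - f w p))"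
        unfolding un by (rule prod.union_disjoint) auto
      also have "(\<Prod>p\<in>{2..w}. 1 / (1 - f w p)) = (\<Prod>k<w - 1. 1 / (1 - q * q * q ^ k))"
        by (rule prod.reindex_bij_witness[of _ "\<lambda>k. k + 2" "\<lambda>p. p - 2"]) (auto simp: f_def qq)
      also have "(\<Prod>p\<in>{Suc w..w + n}. 1 / (1 - f w p)) = (\<Prod>k<n. 1 / (1 - z * q ^ Suc w * q ^ k))"
        by (rule prod.reindex_bij_witness[of _ "\<lambda>k. k + Suc w" "\<lambda>p. p - Suc w"]) (auto simp: f_def power_add mult_ac qq2)
      finally show ?thesis by (simp add: qpf_def prod_dividef)
    qed
    have "(\<lambda>n. 1 / (qpf (q * q) q (w - 1) * qpf (z * q ^ Suc w) q n)) \<longlonglongrightarrow> l w"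
      unfolding l_def
    proof (intro tendsto_divide tendsto_mult tendsto_const qpf_LIMSEQ q)
      have "qpf (q * q) q (w - 1) \<noteq> 0"
      proof (rule qpf_nonzero)
        show "q * q * q ^ k \<noteq> 1" for k using qpf_self_neq[OF q(1), of "Suc k"] by (simp add: mult_ac)
      qed
      then show "qpf (q * q) q (w - 1) * qinf (z * q ^ Suc w) q \<noteq> 0" using qinf_nonzero[OF q(1) zq] by simp
    qed
    then have "(\<lambda>n. \<Prod>p\<in>{2..} \<inter> {..n + w}. 1 / (1 - f w p)) \<longlonglongrightarrow> l w" unfolding eq[symmetric] by (simp add: add.commute)
    then show ?thesis by (rule LIMSEQ_offset)
  qed
  have ms: "(\<lambda>M. norm (mpr (f w) M)) summable_on msets {2..}" "(mpr (f w) has_sum l w) (msets {2..})"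
    "infsum (\<lambda>M. norm (mpr (f w) M)) (msets {2..}) \<le> B" if "w \<ge> 1" for w
    using msets_has_sum[of "{2..}" "f w" "l w" B] fl lim[OF that] bd by blast+
  have in1: "((\<lambda>M. T (g (w, M))) has_sum (of_nat w * (q / z) ^ w * l w)) (msets {2..})" for w
  proof (cases "w = 0")
    case True
    then show ?thesis using Tg[of _ 0] by (subst has_sum_cong[of _ _ "\<lambda>_. 0"]) auto
  next
    case False
    then have "w \<ge> 1" by linarith
    then have "(mpr (f w) has_sum l w) (msets {2..})" by (rule ms(2))
    then have "((\<lambda>M. of_nat w * (q / z) ^ w * mpr (f w) M) has_sum (of_nat w * (q / z) ^ w * l w)) (msets {2..})"
      by (rule has_sum_cmult_right)
    then show ?thesis using Tg by (subst has_sum_cong) auto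
  qed
  define N where "N w = infsum (\<lambda>M. norm (T (g (w, M)))) (msets {2..})" for w
  have in2: "((\<lambda>M. norm (T (g (w, M)))) has_sum N w) (msets {2..})" and Nb: "N w \<le> of_nat w * norm q ^ w * B" for w
  proof -
    have e: "norm (T (g (w, M))) = of_nat w * norm q ^ w * norm (mpr (f w) M)" if "M \<in> msets {2..}" for M
      unfolding Tg[OF that] by (simp add: norm_mult norm_divide norm_power z)
    have "(\<lambda>M. norm (T (g (w, M)))) summable_on msets {2..} \<and> N w \<le> of_nat w * norm q ^ w * B"
    proof (cases "w = 0")
      case True
      then show ?thesis using e unfolding N_def by (auto simp: summable_on_0 infsum_0)
    next
      case False
      then have w: "w \<ge> 1" by linarith
      have "(\<lambda>M. of_nat w * norm q ^ w * norm (mpr (f w) M)) summable_on msets {2..}"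
        by (intro summable_on_cmult_right ms(1)[OF w])
      then have "(\<lambda>M. norm (T (g (w, M)))) summable_on msets {2..}"
        using e by (subst summable_on_cong) auto
      moreover have "N w = of_nat w * norm q ^ w * infsum (\<lambda>M. norm (mpr (f w) M)) (msets {2..})"
        unfolding N_def infsum_cmult_right'[symmetric] using e by (intro infsum_cong) auto
      ultimately show ?thesis using ms(3)[OF w] by (simp add: mult_left_mono)
    qed
    then show "((\<lambda>M. norm (T (g (w, M)))) has_sum N w) (msets {2..})" "N w \<le> of_nat w * norm q ^ w * B"
      by (auto simp: N_def)
  qed
  have N0: "N w \<ge> 0" for w using in2[of w] by (rule has_sum_nonneg) simp
  have sw: "summable (\<lambda>w. of_nat w * norm q ^ w * B)"
  proof -
    have "summable (\<lambda>n. of_nat (Suc n) * norm q ^ n)" using geometric_deriv_sums[of "norm q"] q sums_summable by fastforce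
    then have "summable (\<lambda>n. norm q * B * (of_nat (Suc n) * norm q ^ n))" by (rule summable_mult)
    then have "summable (\<lambda>n. of_nat (Suc n) * norm q ^ Suc n * B)" by (simp add: mult_ac)
    then show ?thesis by (subst (asm) summable_Suc_iff)
  qed
  have Ns: "summable N" by (rule summable_comparison_test'[OF sw, of 0]) (use N0 Nb in auto)
  have ns: "(\<lambda>x. norm (T (g x))) summable_on D"
    unfolding D_def
    by (rule summable_on_SigmaI[where g = N]) (use in2 Ns N0 summable_on_nat_of_summable in auto)
  have s1: "norm (q / z) < 1" using q z by (simp add: norm_divide)
  have nzq: "qinf (z * q * (q / z)) q \<noteq> 0"
  proof (rule qinf_nonzero[OF q(1)])
    show "z * q * (q / z) * q ^ k \<noteq> 1" for k using z0 qpf_self_neq[OF q(1), of "Suc k"] by (simp add: mult_ac)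
  qed
  have qb: "(\<lambda>w. of_nat w * (qbin q (z * q) w * (q / z) ^ w)) sums (qinf (z * q * (q / z)) q / qinf (q / z) q * (lam q (z * q * (q / z)) - lam q (q / z)))"
    by (rule q_binomial_deriv[OF q(1) s1 nzq])
  have zqq: "z * q * (q / z) = q * q" using z0 by simp
  have termE: "of_nat w * (q / z) ^ w * l w = (1 - q) / qinf (z * q) q * (of_nat w * (qbin q (z * q) w * (q / z) ^ w))" for w
  proof (cases w)
    case (Suc k)
    have n1: "qpf (z * q) q w \<noteq> 0"
    proof (rule qpf_nonzero)
      show "z * q * q ^ k \<noteq> 1" for k using zq[of 0 k] by simp
    qed
    have "1 - q \<noteq> 0" using q by auto
    moreover have "qpf q q w = (1 - q) * qpf (q * q) q (w - 1)" unfolding Suc qpf_Suc' by simp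
    moreover have "qinf (z * q) q = qpf (z * q) q w * qinf (z * q ^ Suc w) q"
      using qinf_split[OF q(1), of "z * q" w] by (simp add: mult_ac)
    ultimately show ?thesis unfolding l_def qbin_def using n1 by simp
  qed simp
  have val: "(\<lambda>w. of_nat w * (q / z) ^ w * l w) sums (crank_prod q z * (lam q (q * q) - lam q (q / z)))"
  proof -
    have "(\<lambda>w. of_nat w * (q / z) ^ w * l w) sums ((1 - q) / qinf (z * q) q * (qinf (q * q) q / qinf (q / z) q * (lam q (q * q) - lam q (q / z))))"
      unfolding termE using sums_mult[OF qb, of "(1 - q) / qinf (z * q) q"] by (simp only: zqq)
    moreover have "(1 - q) * qinf (q * q) q = qinf q q" using qinf_rec[OF q(1), of q] by simp
    ultimately show ?thesis unfolding crank_prod_def by (simp add: mult.assoc[symmetric])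
  qed
  moreover have "summable (\<lambda>w. norm (of_nat w * (q / z) ^ w * l w))"
  proof (rule summable_comparison_test'[OF Ns, of 0])
    fix w
    have "norm (of_nat w * (q / z) ^ w * l w) \<le> N w"
      by (rule norm_has_sum_bound[OF in2 in1])
    then show "norm (norm (of_nat w * (q / z) ^ w * l w)) \<le> N w" by simp
  qed
  ultimately have "((\<lambda>w. of_nat w * (q / z) ^ w * l w) has_sum (crank_prod q z * (lam q (q * q) - lam q (q / z)))) UNIV"
    by (intro norm_summable_imp_has_sum) auto
  then have "((\<lambda>x. T (g x)) has_sum (crank_prod q z * (lam q (q * q) - lam q (q / z)))) D"
    unfolding D_def using in1 abs_summable_summable[OF ns[unfolded D_def]]
    by (intro has_sum_SigmaI) auto
  then have "(T has_sum (crank_prod q z * (lam q (q * q) - lam q (q / z)))) (msets {0<..})"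
    by (subst (asm) has_sum_reindex_bij_betw[OF bij])
  then show ?thesis unfolding T_def[abs_def] .
qed

section \<open>Dissections\<close>

lemma theta_weight_summable:
  fixes q C :: complex
  assumes q: "norm q < 1" "q \<noteq> 0" and C: "C \<noteq> 0" and d: "d \<ge> 1" and f: "\<And>m. norm (f m) \<le> K"
  shows "(\<lambda>m. ((- 1) powi m * q powi tri m) ^ d * C powi m * f m) summable_on UNIV"
proof -
  have K0: "K \<ge> 0" using f[of 0] norm_ge_zero order_trans by blast
  have "(\<lambda>m. (norm q powi (int d * tri m) * norm C powi m) * K) summable_on UNIV"
    using q C d by (intro summable_on_cmult_left summable_theta) auto
  then have "(\<lambda>m. norm (((- 1) powi m * q powi tri m) ^ d * C powi m * f m)) summable_on UNIV"
  proof (rule summable_on_comparison_test)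
    fix m
    have "norm (((- 1) powi m * q powi tri m) ^ d) = norm q powi (int d * tri m)"
      by (simp add: norm_mult norm_power norm_power_int power_int_power' mult.commute)
    then have "norm (((- 1) powi m * q powi tri m) ^ d * C powi m * f m) = norm q powi (int d * tri m) * norm C powi m * norm (f m)"
      by (simp add: norm_mult norm_power_int)
    then show "norm (((- 1) powi m * q powi tri m) ^ d * C powi m * f m) \<le> (norm q powi (int d * tri m) * norm C powi m) * K"
      using f by (simp add: mult_left_mono)
  qed simp
  then show ?thesis by (rule abs_summable_summable)
qed

lemma infsum_mod_5:
  fixes F :: "int \<Rightarrow> complex"
  assumes "F summable_on UNIV"
  shows "infsum F UNIV = (\<Sum>j<5. \<Sum>\<^sub>\<infinity>m. F (5 * m + int j))"
proof -
  have bij: "bij_betw (\<lambda>(j, m). 5 * m + int j) ({..<5} \<times> UNIV) UNIV"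
    by (rule bij_betw_byWitness[of _ "\<lambda>n. (nat (n mod 5), n div 5)"]) (auto simp: nat_less_iff)
  have "infsum F UNIV = infsum (\<lambda>x. F (case x of (j, m) \<Rightarrow> 5 * m + int j)) ({..<5} \<times> UNIV)"
    by (rule infsum_reindex_bij_betw[OF bij, symmetric])
  also have "\<dots> = infsum (\<lambda>(j, m). F (5 * m + int j)) ({..<5} \<times> UNIV)"
    by (rule infsum_cong) auto
  also have "\<dots> = infsum (\<lambda>j. infsum (\<lambda>m. F (5 * m + int j)) UNIV) {..<5}"
  proof (rule infsum_Sigma'_banach[symmetric])
    have "(\<lambda>x. F (case x of (j, m) \<Rightarrow> 5 * m + int j)) summable_on ({..<5} \<times> UNIV)"
      using assms by (subst summable_on_reindex_bij_betw[OF bij])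
    then show "(\<lambda>(j, m). F (5 * m + int j)) summable_on ({..<5::nat} \<times> UNIV)"
      by (simp add: case_prod_unfold)
  qed
  finally show ?thesis by simp
qed

lemma tri_mod_5: "tri (5 * m + j) = 25 * tri m + (5 * j - 10) * m + tri j"
  by (rule tri_eqI) (use two_tri[of m] two_tri[of j] in \<open>simp add: algebra_simps\<close>)

text \<open>Putting n = 5m + j turns a theta weight of base q into one of base q^25 whose linear
  weight is a power of q^5; other powers of q stay outside the sum. The sign splits because 5 is
  odd.\<close>

lemma theta_weight_mod_5:
  fixes q :: complex
  assumes q: "q \<noteq> 0"
  shows "((- 1) powi (5 * m + j) * q powi tri (5 * m + j)) ^ d * (q powi b) powi (5 * m + j) =
    ((- 1) powi j * q powi tri j) ^ d * q powi (b * j) * (((- 1) powi m * (q ^ 25) powi tri m) ^ d * ((q ^ 5) powi (int d * (j - 2) + b)) powi m)"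
proof -
  have e1: "(- 1 :: complex) powi (5 * m + j) = (- 1) powi j * (- 1) powi m"
    by (auto simp: power_int_minus_one_minus power_int_add power_int_def even_nat_iff uminus_power_if)
  have e2: "q powi tri (5 * m + j) = q powi tri j * (q ^ 25) powi tri m * (q ^ 5) powi ((j - 2) * m)"
  proof -
    have "(q ^ 25) powi tri m = q powi (25 * tri m)" "(q ^ 5) powi ((j - 2) * m) = q powi (5 * ((j - 2) * m))"
      using power_int_mult[of q 25 "tri m"] power_int_mult[of q 5 "(j - 2) * m"] by simp_all
    then show ?thesis
      unfolding tri_mod_5 using q by (simp flip: power_int_add add: algebra_simps)
  qed
  have e3: "(q powi b) powi (5 * m + j) = q powi (b * j) * (q ^ 5) powi (b * m)"
  proof -
    have "(q ^ 5) powi (b * m) = q powi (5 * (b * m))" using power_int_mult[of q 5 "b * m"] by simp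
    moreover have "(q powi b) powi (5 * m + j) = q powi (b * (5 * m + j))" by (rule power_int_mult[symmetric])
    ultimately show ?thesis using q by (simp flip: power_int_add add: algebra_simps)
  qed
  have e4: "((q ^ 5) powi (int d * (j - 2) + b)) powi m = ((q ^ 5) powi ((j - 2) * m)) ^ d * (q ^ 5) powi (b * m)"
  proof -
    have "((q ^ 5) powi (int d * (j - 2) + b)) powi m = (q ^ 5) powi ((int d * (j - 2) + b) * m)"
      by (rule power_int_mult[symmetric])
    also have "\<dots> = (q ^ 5) powi ((j - 2) * m * int d + b * m)" by (simp add: algebra_simps)
    also have "\<dots> = (q ^ 5) powi ((j - 2) * m * int d) * (q ^ 5) powi (b * m)"
      using q by (simp add: power_int_add)
    also have "(q ^ 5) powi ((j - 2) * m * int d) = ((q ^ 5) powi ((j - 2) * m)) ^ d"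
      by (simp add: power_int_mult)
    finally show ?thesis .
  qed
  show ?thesis unfolding e1 e2 e3 e4 by (simp add: power_mult_distrib mult_ac)
qed

text \<open>The parameter is y = q^5 and not q, so that all that depends on y alone is unchanged
  when q is multiplied by a fifth root of unity.\<close>

locale five_dissection =
  fixes y :: complex
  assumes y1: "norm y < 1" and y0: "y \<noteq> 0"
begin

definition "Q = y ^ 5"
definition "th x = jth Q x"
definition "J = qinf Q Q"
text \<open>\<open>al\<close> and \<open>be\<close> are the Rogers-Ramanujan products (y, y^4;
  y^5)_inf and (y^2, y^3; y^5)_inf.\<close>

definition "al = th y"
definition "be = th (y ^ 2)"

definition "thy i = th (y powi i)"
definition "ty t i = th (t * y powi i)"

text \<open>Lambert series of level d and base Q; j moves the poles in t, c is the linear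
  weight.\<close>

definition lam_sum :: "nat \<Rightarrow> complex \<Rightarrow> int \<Rightarrow> int \<Rightarrow> complex" where
  "lam_sum d t j c = (\<Sum>\<^sub>\<infinity>m. ((- 1) powi m * Q powi tri m) ^ d * (y powi c) powi m / (1 - t * y powi j * Q powi m))"

definition theta_sum :: "int \<Rightarrow> complex" where
  "theta_sum c = (\<Sum>\<^sub>\<infinity>m. ((- 1) powi m * Q powi tri m) ^ 3 * (y powi c) powi m)"

lemma Q1: "norm Q < 1" using y1 by (simp add: Q_def norm_power power_less_one_iff)
lemma Q0: "Q \<noteq> 0" using y0 by (simp add: Q_def)

lemma powi_neq_1: "j \<noteq> 0 \<Longrightarrow> y powi j \<noteq> 1"
proof
  assume j: "j \<noteq> 0" "y powi j = 1"
  have "norm y powi \<bar>j\<bar> = 1"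
  proof (cases "j \<ge> 0")
    case True
    then show ?thesis using j by (metis abs_of_nonneg norm_power_int norm_one)
  next
    case False
    have "norm y powi j = 1" using j by (metis norm_power_int norm_one)
    then show ?thesis using False by (simp add: power_int_minus)
  qed
  moreover have "norm y powi \<bar>j\<bar> = norm y ^ nat \<bar>j\<bar>" by (simp add: power_int_def)
  moreover have "norm y ^ nat \<bar>j\<bar> < 1" using y1 j by (simp add: power_less_one_iff)
  ultimately show False by simp
qed

lemma yQ: "y powi j * Q powi m = y powi (j + 5 * m)"
  unfolding Q_def using y0 power_int_mult[of y 5 m] by (simp add: power_int_add)

lemma th_shift: "x \<noteq> 0 \<Longrightarrow> th (x * Q) = - th x / x"
  unfolding th_def by (rule jth_shift[OF Q1 Q0])

lemma th_inverse: "x \<noteq> 0 \<Longrightarrow> th (Q / x) = th x"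
  unfolding th_def by (rule jth_inverse[OF Q0])

lemma th_nonzero: "x \<noteq> 0 \<Longrightarrow> (\<And>m. x * Q powi m \<noteq> 1) \<Longrightarrow> th x \<noteq> 0"
  unfolding th_def by (rule jth_nonzero[OF Q1 Q0])

lemma th_gen_nonzero: "(\<And>m. t * y powi m \<noteq> 1) \<Longrightarrow> t \<noteq> 0 \<Longrightarrow> th (t * y powi j) \<noteq> 0"
  using y0 by (intro th_nonzero) (auto simp: mult.assoc yQ)

lemma J_nonzero: "J \<noteq> 0" unfolding J_def by (rule qinf_self_nonzero[OF Q1])

lemma th_y_nonzero: "\<not> 5 dvd j \<Longrightarrow> th (y powi j) \<noteq> 0"
proof (rule th_nonzero)
  show "y powi j * Q powi m \<noteq> 1" if "\<not> 5 dvd j" for m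
    unfolding yQ using that by (intro powi_neq_1) presburger
qed (use y0 in simp)

lemma th_values:
  "th (y powi 1) = al" "th (y powi 2) = be" "th (y powi 3) = be" "th (y powi 4) = al"
  "th (y powi (-1)) = - al / y" "th (y powi (-2)) = - be / y ^ 2" "th (y powi (-3)) = - be / y ^ 3" "th (y powi (-4)) = - al / y ^ 4"
proof -
  show 1: "th (y powi 1) = al" "th (y powi 2) = be" by (simp_all add: al_def be_def)
  have "Q / y ^ 2 = y ^ 3" "Q / y = y ^ 4" using y0 by (simp_all add: Q_def eval_nat_numeral)
  then show 3: "th (y powi 3) = be" "th (y powi 4) = al"
    using th_inverse[of "y ^ 2"] th_inverse[of y] y0 by (simp_all add: al_def be_def)
  have neg: "th (y powi (- int k)) = - th (y powi (5 - int k)) / y ^ k" for k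
  proof -
    have "y powi (- int k) * Q = y powi (5 - int k)"
      using yQ[of "- int k" 1] by simp
    then have "th (y powi (5 - int k)) = - th (y powi (- int k)) / y powi (- int k)"
      using th_shift[of "y powi (- int k)"] y0 by simp
    then show ?thesis using y0 by (simp add: power_int_minus field_simps)
  qed
  show "th (y powi (-1)) = - al / y" "th (y powi (-2)) = - be / y ^ 2" "th (y powi (-3)) = - be / y ^ 3" "th (y powi (-4)) = - al / y ^ 4"
    using neg[of 1] neg[of 2] neg[of 3] neg[of 4] 1 3 by simp_all
qed

lemmas thy_values = th_values[folded thy_def]

lemma al_be_nonzero: "al \<noteq> 0" "be \<noteq> 0"
  using th_y_nonzero[of 1] th_y_nonzero[of 2] th_values by simp_all

section \<open>Partial fractions with poles at powers of y\<close>

lemma pow_dist: "y powi i = y powi j * Q powi m \<Longrightarrow> i = j + 5 * m"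
proof -
  assume "y powi i = y powi j * Q powi m"
  then have "y powi (i - (j + 5 * m)) = 1" unfolding yQ using y0 by (simp add: power_int_diff)
  then show ?thesis using powi_neq_1[of "i - (j + 5 * m)"] by auto
qed

text \<open>Three theta factors below and none above, hence level 3. The exponent 3i - s comes from
  b^3 divided by the product of the three b. As Q = y^5, incongruence modulo 5 keeps the classes of
  poles apart.\<close>

lemma pf_3:
  assumes t: "t \<noteq> 0" "\<And>m. t * y powi m \<noteq> 1"
    and ijk: "\<not> 5 dvd (j - i)" "\<not> 5 dvd (k - i)" "\<not> 5 dvd (k - j)" and s: "s = i + j + k"
  shows "J ^ 2 / (ty t i * ty t j * ty t k) =
    lam_sum 3 t i (3 * i - s) / (thy (j - i) * thy (k - i)) +
    lam_sum 3 t j (3 * j - s) / (thy (i - j) * thy (k - j)) +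
    lam_sum 3 t k (3 * k - s) / (thy (i - k) * thy (j - k))"
proof -
  define bi bj bk where "bi = y powi i" and "bj = y powi j" and "bk = y powi k"
  have ne: "bi \<noteq> bj" "bi \<noteq> bk" "bj \<noteq> bk"
    unfolding bi_def bj_def bk_def using pow_dist[of i j 0] pow_dist[of i k 0] pow_dist[of j k 0] ijk by auto
  have n0: "bi \<noteq> 0" "bj \<noteq> 0" "bk \<noteq> 0" using y0 by (auto simp: bi_def bj_def bk_def)
  have q3: "1 / (bi * bj * bk) * (y powi l) ^ 3 = y powi (3 * l - s)" for l
    unfolding bi_def bj_def bk_def s using y0 power_int_mult[of y l 3]
    by (simp add: power_int_diff power_int_add mult.commute[of 3])
  have "(\<Prod>a\<in>{}. jth Q (t * a)) / (\<Prod>b\<in>{bi, bj, bk}. jth Q (t * b)) =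
    (\<Sum>b\<in>{bi, bj, bk}. (\<Prod>a\<in>{}. jth Q (a / b)) / ((\<Prod>b'\<in>{bi, bj, bk}-{b}. jth Q (b' / b)) * qinf Q Q ^ 2) *
      (\<Sum>\<^sub>\<infinity>m. ((- 1) powi m * Q powi tri m) ^ 3 * (\<Prod>{} / \<Prod>{bi, bj, bk} * b ^ 3) powi m / (1 - t * b * Q powi m)))"
  proof (rule theta_partial_fractions[OF Q1 Q0])
    show "card {bi, bj, bk} = card {} + 3" using ne by simp
    show "b = b' \<and> m = 0" if "b \<in> {bi, bj, bk}" "b' \<in> {bi, bj, bk}" "b = b' * Q powi m" for b b' m
    proof -
      note h = that
      obtain u where u: "b = y powi u" "u \<in> {i, j, k}"
        using h(1) by (auto simp: bi_def bj_def bk_def)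
      obtain v where v: "b' = y powi v" "v \<in> {i, j, k}"
        using h(2) by (auto simp: bi_def bj_def bk_def)
      note uv = u(1) v(1) u(2) v(2)
      have "u = v + 5 * m" using that(3) uv by (intro pow_dist) simp
      moreover have "u = v" using calculation uv(3,4) ijk by (auto; presburger)
      ultimately show ?thesis using uv by simp
    qed
    show "t * b * Q powi m \<noteq> 1" if "b \<in> {bi, bj, bk}" for b m
      using that t(2) by (auto simp: bi_def bj_def bk_def mult.assoc yQ)
  qed (use t n0 in auto)
  moreover have "{bi, bj, bk} - {bi} = {bj, bk}" "{bi, bj, bk} - {bj} = {bi, bk}" "{bi, bj, bk} - {bk} = {bi, bj}"
    using ne by auto
  ultimately have E: "1 / (th (t * bi) * th (t * bj) * th (t * bk)) =
     1 / (th (bj / bi) * th (bk / bi) * J ^ 2) * lam_sum 3 t i (3 * i - s) +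
     1 / (th (bi / bj) * th (bk / bj) * J ^ 2) * lam_sum 3 t j (3 * j - s) +
     1 / (th (bi / bk) * th (bj / bk) * J ^ 2) * lam_sum 3 t k (3 * k - s)"
    using ne q3[of i] q3[of j] q3[of k] unfolding lam_sum_def bi_def[symmetric] bj_def[symmetric] bk_def[symmetric]
    by (simp add: th_def J_def mult.assoc add.assoc)
  have R: "bj / bi = y powi (j - i)" "bk / bi = y powi (k - i)" "bi / bj = y powi (i - j)"
     "bk / bj = y powi (k - j)" "bi / bk = y powi (i - k)" "bj / bk = y powi (j - k)"
    using y0 by (simp_all add: bi_def bj_def bk_def power_int_diff)
  have "J ^ 2 / (th (t * bi) * th (t * bj) * th (t * bk)) = J ^ 2 * (1 / (th (t * bi) * th (t * bj) * th (t * bk)))" by simp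
  then show ?thesis unfolding E R unfolding bi_def bj_def bk_def ty_def thy_def using J_nonzero by (simp add: distrib_left)
qed

text \<open>One theta factor above and two below. Through s = i + j - k the index k adjusts the
  linear weights without moving the poles.\<close>

lemma pf_2:
  assumes t: "t \<noteq> 0" "\<And>m. t * y powi m \<noteq> 1"
    and ij: "\<not> 5 dvd (j - i)" and s: "s = i + j - k"
  shows "J ^ 2 * ty t k / (ty t i * ty t j) =
    thy (k - i) / thy (j - i) * lam_sum 1 t i (i - s) +
    thy (k - j) / thy (i - j) * lam_sum 1 t j (j - s)"
proof -
  define bi bj where "bi = y powi i" and "bj = y powi j"
  define a where "a = y powi k"
  have ne: "bi \<noteq> bj"
    unfolding bi_def bj_def using pow_dist[of i j 0] ij by auto
  have n0: "bi \<noteq> 0" "bj \<noteq> 0" "a \<noteq> 0" using y0 by (auto simp: bi_def bj_def a_def)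
  have q3: "a / (bi * bj) * y powi l = y powi (l - s)" for l
    unfolding bi_def bj_def a_def s using y0
    by (simp add: power_int_diff power_int_add)
  have "(\<Prod>a\<in>{a}. jth Q (t * a)) / (\<Prod>b\<in>{bi, bj}. jth Q (t * b)) =
    (\<Sum>b\<in>{bi, bj}. (\<Prod>a\<in>{a}. jth Q (a / b)) / ((\<Prod>b'\<in>{bi, bj}-{b}. jth Q (b' / b)) * qinf Q Q ^ 2) *
      (\<Sum>\<^sub>\<infinity>m. ((- 1) powi m * Q powi tri m) ^ 1 * (\<Prod>{a} / \<Prod>{bi, bj} * b ^ 1) powi m / (1 - t * b * Q powi m)))"
  proof (rule theta_partial_fractions[OF Q1 Q0])
    show "card {bi, bj} = card {a} + 1" using ne by simp
    show "b = b' \<and> m = 0" if "b \<in> {bi, bj}" "b' \<in> {bi, bj}" "b = b' * Q powi m" for b b' m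
    proof -
      note h = that
      obtain u where u: "b = y powi u" "u \<in> {i, j}"
        using h(1) by (auto simp: bi_def bj_def)
      obtain v where v: "b' = y powi v" "v \<in> {i, j}"
        using h(2) by (auto simp: bi_def bj_def)
      note uv = u(1) v(1) u(2) v(2)
      have "u = v + 5 * m" using that(3) uv by (intro pow_dist) simp
      moreover have "u = v" using calculation uv(3,4) ij by (auto; presburger)
      ultimately show ?thesis using uv by simp
    qed
    show "t * b * Q powi m \<noteq> 1" if "b \<in> {bi, bj}" for b m
      using that t(2) by (auto simp: bi_def bj_def mult.assoc yQ)
  qed (use t n0 in auto)
  moreover have "{bi, bj} - {bi} = {bj}" "{bi, bj} - {bj} = {bi}"
    using ne by auto
  ultimately have E: "th (t * a) / (th (t * bi) * th (t * bj)) =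
     th (a / bi) / (th (bj / bi) * J ^ 2) * lam_sum 1 t i (i - s) +
     th (a / bj) / (th (bi / bj) * J ^ 2) * lam_sum 1 t j (j - s)"
    using ne q3[of i] q3[of j] unfolding lam_sum_def bi_def[symmetric] bj_def[symmetric]
    by (simp add: th_def J_def mult.assoc add.assoc)
  have R: "bj / bi = y powi (j - i)" "bi / bj = y powi (i - j)"
     "a / bi = y powi (k - i)" "a / bj = y powi (k - j)"
    using y0 by (simp_all add: bi_def bj_def a_def power_int_diff)
  have "J ^ 2 * th (t * a) / (th (t * bi) * th (t * bj)) = J ^ 2 * (th (t * a) / (th (t * bi) * th (t * bj)))" by simp
  then show ?thesis unfolding E R unfolding bi_def bj_def a_def ty_def thy_def using J_nonzero by (simp add: distrib_left)
qed

lemma pf_1: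
  assumes t: "t \<noteq> 0" "\<And>m. t * y powi m \<noteq> 1"
  shows "J ^ 2 / ty t i = lam_sum 1 t i 0"
proof -
  define b where "b = y powi i"
  have b0: "b \<noteq> 0" using y0 by (simp add: b_def)
  have "(\<Prod>a\<in>{}. jth Q (t * a)) / (\<Prod>c\<in>{b}. jth Q (t * c)) =
    (\<Sum>c\<in>{b}. (\<Prod>a\<in>{}. jth Q (a / c)) / ((\<Prod>b'\<in>{b}-{c}. jth Q (b' / c)) * qinf Q Q ^ 2) *
      (\<Sum>\<^sub>\<infinity>m. ((- 1) powi m * Q powi tri m) ^ 1 * (\<Prod>{} / \<Prod>{b} * c ^ 1) powi m / (1 - t * c * Q powi m)))"
  proof (rule theta_partial_fractions[OF Q1 Q0])
    show "c = c' \<and> m = 0" if "c \<in> {b}" "c' \<in> {b}" "c = c' * Q powi m" for c c' m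
      using pow_dist[of i i m] that by (auto simp: b_def)
    show "t * c * Q powi m \<noteq> 1" if "c \<in> {b}" for c m
      using that t(2) by (auto simp: b_def mult.assoc yQ)
  qed (use t b0 in auto)
  then have "1 / th (t * b) = 1 / J ^ 2 * lam_sum 1 t i 0"
    using b0 by (simp add: lam_sum_def b_def[symmetric] th_def J_def)
  then have "J ^ 2 * (1 / th (t * b)) = J ^ 2 * (1 / J ^ 2 * lam_sum 1 t i 0)" by (simp only:)
  then show ?thesis unfolding b_def ty_def using J_nonzero by simp
qed


text \<open>Up to the factor y^(1/5), the reciprocal of the Rogers-Ramanujan continued fraction at
  y.\<close>

definition "r = be / al"

lemma r_nonzero: "r \<noteq> 0" using al_be_nonzero by (simp add: r_def)

lemma be_eq: "be = r * al" using al_be_nonzero by (simp add: r_def)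

text \<open>The index set is dictated by \<open>gsum q 3 1\<close>, whose j-th piece has weight 3j -
  5: the indices must add up to 5. The sets {0,1,4} and {0,2,3} do, and they share j = 0.\<close>

lemma rel_014:
  assumes t: "t \<noteq> 0" "\<And>m. t * y powi m \<noteq> 1"
  shows "r * lam_sum 3 t 0 (-5) - y * lam_sum 3 t 1 (-2) + y ^ 7 * lam_sum 3 t 4 7 =
    al * be * (J ^ 2 / (ty t 0 * ty t 1 * ty t 4))"
proof -
  have 1: "al * be * (u / (- al / y * be)) = - (y * u)" "al * be * (u / (al * al)) = r * u" for u
    using y0 al_be_nonzero by (simp_all add: r_def)
  have "y ^ 7 = y ^ 4 * y ^ 3" by (subst power_add[symmetric]) simp
  then have "- al / y ^ 4 * (- be / y ^ 3) = al * be / y ^ 7" by simp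
  then have 2: "al * be * (u / (- al / y ^ 4 * (- be / y ^ 3))) = y ^ 7 * u" for u
    using y0 al_be_nonzero by simp
  have e: "J ^ 2 / (ty t 0 * ty t 1 * ty t 4) = lam_sum 3 t 0 (3 * 0 - 5) / (thy (1 - 0) * thy (4 - 0)) +
     lam_sum 3 t 1 (3 * 1 - 5) / (thy (0 - 1) * thy (4 - 1)) + lam_sum 3 t 4 (3 * 4 - 5) / (thy (0 - 4) * thy (1 - 4))"
    by (rule pf_3[OF t]) presburger+
  have i: "3 * 0 - 5 = (-5::int)" "3 * 1 - 5 = (-2::int)" "3 * 4 - 5 = (7::int)" "1 - 0 = (1::int)" "4 - 0 = (4::int)"
    "0 - 1 = (-1::int)" "4 - 1 = (3::int)" "0 - 4 = (-4::int)" "1 - 4 = (-3::int)" by simp_all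
  show ?thesis
    unfolding e unfolding i thy_values distrib_left 1 2 by simp
qed

lemma rel_023:
  assumes t: "t \<noteq> 0" "\<And>m. t * y powi m \<noteq> 1"
  shows "lam_sum 3 t 0 (-5) / r - y ^ 2 * lam_sum 3 t 2 1 + y ^ 4 * lam_sum 3 t 3 4 =
    al * be * (J ^ 2 / (ty t 0 * ty t 2 * ty t 3))"
proof -
  have 1: "al * be * (u / (- be / y ^ 2 * al)) = - (y ^ 2 * u)" "al * be * (u / (be * be)) = u / r" for u
    using y0 al_be_nonzero by (simp_all add: r_def)
  have "y ^ 4 = y ^ 3 * y" by (simp add: eval_nat_numeral)
  then have "- be / y ^ 3 * (- al / y) = al * be / y ^ 4" by simp
  then have 2: "al * be * (u / (- be / y ^ 3 * (- al / y))) = y ^ 4 * u" for u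
    using y0 al_be_nonzero by simp
  have e: "J ^ 2 / (ty t 0 * ty t 2 * ty t 3) = lam_sum 3 t 0 (3 * 0 - 5) / (thy (2 - 0) * thy (3 - 0)) +
     lam_sum 3 t 2 (3 * 2 - 5) / (thy (0 - 2) * thy (3 - 2)) + lam_sum 3 t 3 (3 * 3 - 5) / (thy (0 - 3) * thy (2 - 3))"
    by (rule pf_3[OF t]) presburger+
  have i: "3 * 0 - 5 = (-5::int)" "3 * 2 - 5 = (1::int)" "3 * 3 - 5 = (4::int)" "2 - 0 = (2::int)" "3 - 0 = (3::int)"
    "0 - 2 = (-2::int)" "3 - 2 = (1::int)" "0 - 3 = (-3::int)" "2 - 3 = (-1::int)" by simp_all
  show ?thesis
    unfolding e unfolding i thy_values distrib_left 1 2 by simp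
qed

text \<open>For \<open>gsum q 3 0\<close> the weights are 3j - 6; {0,2,4} and {1,2,3} add up to 6
  and share j = 2.\<close>

lemma rel_024:
  assumes t: "t \<noteq> 0" "\<And>m. t * y powi m \<noteq> 1"
  shows "lam_sum 3 t 0 (-6) - y ^ 2 * lam_sum 3 t 2 0 / r + y ^ 6 * lam_sum 3 t 4 6 =
    al * be * (J ^ 2 / (ty t 0 * ty t 2 * ty t 4))"
  unfolding pf_3[OF t, of 2 0 4 6, simplified] using y0 al_be_nonzero
  by (simp add: thy_values r_def field_simps eval_nat_numeral)

lemma rel_123:
  assumes t: "t \<noteq> 0" "\<And>m. t * y powi m \<noteq> 1"
  shows "lam_sum 3 t 1 (-3) - y * r * lam_sum 3 t 2 0 + y ^ 3 * lam_sum 3 t 3 3 =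
    al * be * (J ^ 2 / (ty t 1 * ty t 2 * ty t 3))"
  unfolding pf_3[OF t, of 2 1 3 6, simplified] using y0 al_be_nonzero
  by (simp add: thy_values r_def field_simps eval_nat_numeral)

text \<open>At level one the weights are j - 1 for \<open>gsum q 1 1\<close> and j - 2 for
  \<open>gsum q 1 0\<close>. In each case the five indices fall into two pairs, joined by a suitable
  numerator, and one index of weight 0, which \<open>pf_1\<close> evaluates.\<close>

lemma rel_02:
  assumes t: "t \<noteq> 0" "\<And>m. t * y powi m \<noteq> 1"
  shows "lam_sum 1 t 0 (-1) + y * lam_sum 1 t 2 1 =
    r * (J ^ 2 * ty t 1 / (ty t 0 * ty t 2))"
  unfolding pf_2[OF t, of 2 0 1 1, simplified] using y0 al_be_nonzero
  by (simp add: thy_values r_def field_simps eval_nat_numeral)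

lemma rel_34:
  assumes t: "t \<noteq> 0" "\<And>m. t * y powi m \<noteq> 1"
  shows "lam_sum 1 t 3 2 - y * lam_sum 1 t 4 3 =
    J ^ 2 * ty t 6 / (ty t 3 * ty t 4) / r"
  unfolding pf_2[OF t, of 4 3 1 6, simplified] using y0 al_be_nonzero
  by (simp add: thy_values r_def field_simps eval_nat_numeral)

lemma rel_04:
  assumes t: "t \<noteq> 0" "\<And>m. t * y powi m \<noteq> 1"
  shows "lam_sum 1 t 0 (-2) + y ^ 2 * lam_sum 1 t 4 2 =
    J ^ 2 * ty t 2 / (ty t 0 * ty t 4) / r"
  unfolding pf_2[OF t, of 4 0 2 2, simplified] using y0 al_be_nonzero
  by (simp add: thy_values r_def field_simps eval_nat_numeral)

lemma rel_13:
  assumes t: "t \<noteq> 0" "\<And>m. t * y powi m \<noteq> 1"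
  shows "lam_sum 1 t 1 (-1) + y * lam_sum 1 t 3 1 =
    r * (J ^ 2 * ty t 2 / (ty t 1 * ty t 3))"
  unfolding pf_2[OF t, of 3 1 2 2, simplified] using y0 al_be_nonzero
  by (simp add: thy_values r_def field_simps eval_nat_numeral)

section \<open>Quasi-periodicity in t and identities of quintuple product type\<close>

lemma ty_shift: "t \<noteq> 0 \<Longrightarrow> ty t (i + 5) = - ty t i / (t * y powi i)"
  using th_shift[of "t * y powi i"] y0 yQ[of i 1] by (simp add: ty_def mult.assoc)

lemma ty_shift': "t \<noteq> 0 \<Longrightarrow> ty (t * Q) i = - ty t i / (t * y powi i)"
  using th_shift[of "t * y powi i"] y0 by (simp add: ty_def mult_ac)

lemma theta_sum_summable: "(\<lambda>m. ((- 1) powi m * Q powi tri m) ^ 3 * (y powi c) powi m) summable_on UNIV"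
  using theta_weight_summable[OF Q1 Q0, of "y powi c" 3 "\<lambda>_. 1" 1] y0 by simp

lemma minus_one_powi_shift: "(- 1 :: complex) powi (m - 1) = - ((- 1) powi m)"
  by (simp add: power_int_diff)

text \<open>Replacing m by m - 1 divides the cubed theta weight by Q^(3m) = y^(15m), up to sign,
  which moves c by 15.\<close>

lemma theta_sum_shift: "theta_sum c = - theta_sum (c - 15) / y powi c"
proof -
  have "theta_sum c = (\<Sum>\<^sub>\<infinity>m. ((- 1) powi (m - 1) * Q powi tri (m - 1)) ^ 3 * (y powi c) powi (m - 1))"
    unfolding theta_sum_def by (rule infsum_reindex_bij_witness[of _ "\<lambda>m. m - 1" "\<lambda>m. m + 1"]) auto
  also have "\<dots> = (\<Sum>\<^sub>\<infinity>m. - 1 / y powi c * (((- 1) powi m * Q powi tri m) ^ 3 * (y powi (c - 15)) powi m))"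
  proof (rule infsum_cong)
    fix m
    have "tri (m - 1) = tri m - m" using tri_add1[of "m - 1"] by simp
    then have a: "Q powi tri (m - 1) = Q powi tri m / Q powi m" using Q0 by (simp add: power_int_diff)
    have b: "(y powi c) powi (m - 1) = (y powi c) powi m / y powi c" using y0 by (simp add: power_int_diff)
    have "(y powi (c - 15)) powi m = (y powi c) powi m / (y powi 15) powi m"
      using y0 by (simp add: power_int_diff power_int_divide_distrib)
    moreover have "(y powi 15) powi m = (Q powi m) ^ 3"
      unfolding Q_def using power_int_mult[of y 15 m] power_int_mult[of y 5 m] power_int_mult[of y "5 * m" 3] by (simp add: mult_ac)
    ultimately have c: "(y powi (c - 15)) powi m = (y powi c) powi m / (Q powi m) ^ 3" by simp
    show "((- 1) powi (m - 1) * Q powi tri (m - 1)) ^ 3 * (y powi c) powi (m - 1) =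
      - 1 / y powi c * (((- 1) powi m * Q powi tri m) ^ 3 * (y powi (c - 15)) powi m)"
      unfolding minus_one_powi_shift a b c by (simp add: power_mult_distrib power_divide)
  qed
  also have "\<dots> = - 1 / y powi c * theta_sum (c - 15)" unfolding theta_sum_def by (rule infsum_cmult_right')
  finally show ?thesis by simp
qed

lemma theta_sum_neg: "theta_sum c = - theta_sum (- c) / y powi c"
proof -
  have "theta_sum c = (\<Sum>\<^sub>\<infinity>m. ((- 1) powi (- m - 1) * Q powi tri (- m - 1)) ^ 3 * (y powi c) powi (- m - 1))"
    unfolding theta_sum_def by (rule infsum_reindex_bij_witness[of _ "\<lambda>m. - m - 1" "\<lambda>m. - m - 1"]) auto
  also have "\<dots> = (\<Sum>\<^sub>\<infinity>m. - 1 / y powi c * (((- 1) powi m * Q powi tri m) ^ 3 * (y powi (- c)) powi m))"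
  proof (rule infsum_cong)
    fix m
    have a: "(- 1 :: complex) powi (- m - 1) = - ((- 1) powi m)"
      by (simp add: power_int_diff power_int_minus flip: power_int_inverse)
    have b: "(y powi c) powi (- m - 1) = (y powi (- c)) powi m / y powi c"
      using y0 by (simp add: power_int_diff power_int_minus power_int_inverse)
    show "((- 1) powi (- m - 1) * Q powi tri (- m - 1)) ^ 3 * (y powi c) powi (- m - 1) =
      - 1 / y powi c * (((- 1) powi m * Q powi tri m) ^ 3 * (y powi (- c)) powi m)"
      unfolding a b tri_minus by (simp add: power_mult_distrib)
  qed
  also have "\<dots> = - 1 / y powi c * theta_sum (- c)" unfolding theta_sum_def by (rule infsum_cmult_right')
  finally show ?thesis by simp
qed

lemma lam_summable:
  assumes t: "t \<noteq> 0" "\<And>m. t * y powi m \<noteq> 1" and d: "d \<ge> 1"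
  shows "(\<lambda>m. ((- 1) powi m * Q powi tri m) ^ d * (y powi c) powi m / (1 - t * y powi j * Q powi m)) summable_on UNIV"
proof -
  obtain K where K: "\<And>m. norm (1 / (1 - t * y powi j * Q powi m)) \<le> K"
    by (rule norm_one_minus_powi_bounded_below[OF Q1 Q0, of "t * y powi j"]) (use t y0 in \<open>auto simp: mult.assoc yQ\<close>)
  have c0: "y powi c \<noteq> 0" using y0 by simp
  show ?thesis using theta_weight_summable[OF Q1 Q0 c0 d K] by simp
qed

text \<open>Reindexing restores the poles and leaves a factor 1/u^3 with u = Q^m. The expansion
  1/(u^3 (1 - Xu)) = X^3/(1 - Xu) + 1/u^3 + X/u^2 + X^2/u reproduces the Lambert series and adds
  three theta series.\<close>

lemma lam_sum_shift:
  assumes t: "t \<noteq> 0" "\<And>m. t * y powi m \<noteq> 1"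
  shows "lam_sum 3 (t * Q) j c = - ((t * y powi j) ^ 3 * lam_sum 3 t j c + theta_sum (c - 15) +
     t * y powi j * theta_sum (c - 10) + (t * y powi j) ^ 2 * theta_sum (c - 5)) / y powi c"
proof -
  define X where "X = t * y powi j"
  define W where "W m = ((- 1) powi m * Q powi tri m) ^ 3 * (y powi c) powi m" for m
  have X: "X * Q powi m \<noteq> 1" for m using t(2) by (simp add: X_def mult.assoc yQ)
  have ex: "((- 1) powi m * Q powi tri m) ^ 3 * (y powi (c - 5 * k)) powi m = W m / (Q powi m) ^ nat k" if "k \<ge> 0" for k m
  proof -
    have "(y powi (5 * k)) powi m = (Q powi m) powi k"
      unfolding Q_def using power_int_mult[of y "5 * k" m] power_int_mult[of y 5 m] power_int_mult[of y "5 * m" k] by (simp add: mult_ac)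
    also have "\<dots> = (Q powi m) ^ nat k" using that by (simp add: power_int_def)
    finally show ?thesis using y0 by (simp add: W_def power_int_diff power_int_divide_distrib)
  qed
  have s: "(\<lambda>m. ((- 1) powi m * Q powi tri m) ^ 3 * (y powi c') powi m) summable_on UNIV" for c' by (rule theta_sum_summable)
  have sl: "(\<lambda>m. W m / (1 - X * Q powi m)) summable_on UNIV" unfolding W_def X_def by (rule lam_summable[OF t]) simp
  have "lam_sum 3 (t * Q) j c = (\<Sum>\<^sub>\<infinity>m. ((- 1) powi (m - 1) * Q powi tri (m - 1)) ^ 3 * (y powi c) powi (m - 1) / (1 - t * Q * y powi j * Q powi (m - 1)))"
    unfolding lam_sum_def by (rule infsum_reindex_bij_witness[of _ "\<lambda>m. m - 1" "\<lambda>m. m + 1"]) auto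
  also have "\<dots> = (\<Sum>\<^sub>\<infinity>m. - 1 / y powi c * (X ^ 3 * (W m / (1 - X * Q powi m)) + (((- 1) powi m * Q powi tri m) ^ 3 * (y powi (c - 15)) powi m)
      + X * (((- 1) powi m * Q powi tri m) ^ 3 * (y powi (c - 10)) powi m) + X ^ 2 * (((- 1) powi m * Q powi tri m) ^ 3 * (y powi (c - 5)) powi m)))"
  proof (rule infsum_cong)
    fix m
    define u where "u = Q powi m"
    have u0: "u \<noteq> 0" using Q0 by (simp add: u_def)
    have Xu: "1 - X * u \<noteq> 0" using X[of m] by (simp add: u_def)
    have "tri (m - 1) = tri m - m" using tri_add1[of "m - 1"] by simp
    then have a: "Q powi tri (m - 1) = Q powi tri m / u" using Q0 by (simp add: power_int_diff u_def)
    have b: "(y powi c) powi (m - 1) = (y powi c) powi m / y powi c" using y0 by (simp add: power_int_diff)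
    have dd: "t * Q * y powi j * Q powi (m - 1) = X * u"
      using Q0 by (simp add: power_int_diff X_def u_def)
    have e: "((- 1) powi m * Q powi tri m) ^ 3 * (y powi (c - 15)) powi m = W m / u ^ 3"
      "((- 1) powi m * Q powi tri m) ^ 3 * (y powi (c - 10)) powi m = W m / u ^ 2"
      "((- 1) powi m * Q powi tri m) ^ 3 * (y powi (c - 5)) powi m = W m / u"
      using ex[of 3 m] ex[of 2 m] ex[of 1 m] by (simp_all add: u_def)
    have l: "((- 1) powi (m - 1) * Q powi tri (m - 1)) ^ 3 * (y powi c) powi (m - 1) = - W m / u ^ 3 / y powi c"
      unfolding minus_one_powi_shift a b W_def by (simp add: power_mult_distrib power_divide)
    have "1 / u ^ 3 / (1 - X * u) = X ^ 3 / (1 - X * u) + 1 / u ^ 3 + X / u ^ 2 + X ^ 2 / u"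
      using u0 Xu by (simp add: divide_simps) (simp add: algebra_simps eval_nat_numeral)
    then have "W m * (1 / u ^ 3 / (1 - X * u)) = W m * (X ^ 3 / (1 - X * u) + 1 / u ^ 3 + X / u ^ 2 + X ^ 2 / u)" by simp
    also have "\<dots> = X ^ 3 * (W m / (1 - X * u)) + W m / u ^ 3 + X * (W m / u ^ 2) + X ^ 2 * (W m / u)"
      by (simp add: distrib_left mult_ac)
    finally have F: "W m * (1 / u ^ 3 / (1 - X * u)) = X ^ 3 * (W m / (1 - X * u)) + W m / u ^ 3 + X * (W m / u ^ 2) + X ^ 2 * (W m / u)" .
    show "((- 1) powi (m - 1) * Q powi tri (m - 1)) ^ 3 * (y powi c) powi (m - 1) / (1 - t * Q * y powi j * Q powi (m - 1)) =
      - 1 / y powi c * (X ^ 3 * (W m / (1 - X * Q powi m)) + (((- 1) powi m * Q powi tri m) ^ 3 * (y powi (c - 15)) powi m)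
      + X * (((- 1) powi m * Q powi tri m) ^ 3 * (y powi (c - 10)) powi m) + X ^ 2 * (((- 1) powi m * Q powi tri m) ^ 3 * (y powi (c - 5)) powi m))"
      unfolding e l dd u_def[symmetric] F[symmetric] by simp
  qed
  also have "\<dots> = - 1 / y powi c * (X ^ 3 * (\<Sum>\<^sub>\<infinity>m. W m / (1 - X * Q powi m)) + theta_sum (c - 15) + X * theta_sum (c - 10) + X ^ 2 * theta_sum (c - 5))"
    unfolding theta_sum_def infsum_cmult_right'
    by (intro arg_cong[of _ _ "(*) (- 1 / y powi c)"] infsumI has_sum_add has_sum_cmult_right has_sum_infsum s sl)
  also have "(\<Sum>\<^sub>\<infinity>m. W m / (1 - X * Q powi m)) = lam_sum 3 t j c"
    unfolding lam_sum_def W_def X_def ..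
  finally have F: "lam_sum 3 (t * Q) j c = - 1 / y powi c * (X ^ 3 * lam_sum 3 t j c + theta_sum (c - 15) + X * theta_sum (c - 10) + X ^ 2 * theta_sum (c - 5))" .
  have neg: "- 1 / v * S = - S / v" for v S :: complex by simp
  show ?thesis using F unfolding neg X_def .
qed

text \<open>Comparing each relation between Lambert series at \<^term>\<open>t\<close> and at \<^term>\<open>t * Q\<close> leaves a polynomial in \<^term>\<open>t\<close>;
  its constant term is a quintuple-product identity.\<close>

lemma quadratic_const_term:
  fixes a b c :: complex
  assumes "\<And>t. t \<noteq> 0 \<Longrightarrow> (\<And>m. t * y powi m \<noteq> 1) \<Longrightarrow> a + b * t + c * t ^ 2 = 0"
  shows "a = 0"
proof -
  have t0: "(-1) * y powi m \<noteq> 1" for m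
  proof
    assume h: "(-1) * y powi m = 1"
    have "y powi (2 * m) = (y powi m) ^ 2" by (metis mult.commute power_int_mult power_int_numeral)
    also have "\<dots> = 1" using h by (simp add: power2_eq_square) (metis minus_mult_minus mult_1 add.inverse_inverse)
    finally have "m = 0" using powi_neq_1[of "2 * m"] by auto
    then show False using h by simp
  qed
  \<comment> \<open>The test points -y^n tend to 0 and avoid the poles, which are powers of
    y.\<close>
  have z: "a + b * (- (y ^ n)) + c * (- (y ^ n)) ^ 2 = 0" for n
  proof (rule assms)
    show "- (y ^ n) * y powi m \<noteq> 1" for m
      using t0[of "int n + m"] y0 by (simp add: power_int_add)
  qed (use y0 in simp)
  have "(\<lambda>n. a + b * (- (y ^ n)) + c * (- (y ^ n)) ^ 2) \<longlonglongrightarrow> a + b * (- 0) + c * (- 0) ^ 2"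
    by (intro tendsto_intros LIMSEQ_power_zero y1)
  then show ?thesis unfolding z by (simp add: LIMSEQ_const_iff)
qed

lemma gen_shift: "(\<And>m. t * y powi m \<noteq> 1) \<Longrightarrow> t * Q * y powi m \<noteq> 1"
  using yQ[of m 1] by (metis mult.assoc mult.commute power_int_1_right)

text \<open>Up to theta sums, t -> tQ multiplies the theta quotient and all three Lambert terms of
  \<open>rel_014\<close> by the same factor -t^3 y^5. The resulting identity evaluates the part of
  Euler's product with exponents 0 mod 5.\<close>

lemma theta_sum_r:
  "r * theta_sum (-5) = y * theta_sum (-2) + theta_sum (-8)"
proof -
  have "r * y ^ 5 * theta_sum (-20) - y ^ 3 * theta_sum (-17) + theta_sum (-8) = 0"
  proof (rule quadratic_const_term)
    fix t assume t: "t \<noteq> 0" "\<And>m. t * y powi m \<noteq> 1"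
    have t': "t * Q \<noteq> 0" "\<And>m. t * Q * y powi m \<noteq> 1" using t Q0 gen_shift by auto
    have "al * be * (J ^ 2 / (ty (t * Q) 0 * ty (t * Q) 1 * ty (t * Q) 4)) = - (t ^ 3 * y ^ 5) * (al * be * (J ^ 2 / (ty t 0 * ty t 1 * ty t 4)))"
      unfolding ty_shift'[OF t(1)] using t y0 by (simp add: field_simps eval_nat_numeral)
    then have "r * lam_sum 3 (t * Q) 0 (-5) - y * lam_sum 3 (t * Q) 1 (-2) + y ^ 7 * lam_sum 3 (t * Q) 4 7 =
      - (t ^ 3 * y ^ 5) * (r * lam_sum 3 t 0 (-5) - y * lam_sum 3 t 1 (-2) + y ^ 7 * lam_sum 3 t 4 7)"
      unfolding rel_014[OF t] rel_014[OF t'] .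
    moreover have "lam_sum 3 (t * Q) 0 (-5) = - (t ^ 3 * lam_sum 3 t 0 (-5) + theta_sum (-20) + t * theta_sum (-15) + t ^ 2 * theta_sum (-10)) * y ^ 5"
      using lam_sum_shift[OF t, of 0 "-5"] by (simp add: power_int_minus divide_inverse)
    moreover have "lam_sum 3 (t * Q) 1 (-2) = - ((t * y) ^ 3 * lam_sum 3 t 1 (-2) + theta_sum (-17) + t * y * theta_sum (-12) + (t * y) ^ 2 * theta_sum (-7)) * y ^ 2"
      using lam_sum_shift[OF t, of 1 "-2"] by (simp add: power_int_minus divide_inverse)
    moreover have "y ^ 7 * lam_sum 3 (t * Q) 4 7 = - ((t * y ^ 4) ^ 3 * lam_sum 3 t 4 7 + theta_sum (-8) + t * y ^ 4 * theta_sum (-3) + (t * y ^ 4) ^ 2 * theta_sum 2)"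
      using lam_sum_shift[OF t, of 4 7] y0 by simp
    ultimately show "r * y ^ 5 * theta_sum (-20) - y ^ 3 * theta_sum (-17) + theta_sum (-8)
       + (r * y ^ 5 * theta_sum (-15) - y ^ 4 * theta_sum (-12) + y ^ 4 * theta_sum (-3)) * t
       + (r * y ^ 5 * theta_sum (-10) - y ^ 5 * theta_sum (-7) + y ^ 8 * theta_sum 2) * t ^ 2 = 0"
      by algebra
  qed
  moreover have "theta_sum (-5) = - theta_sum (-20) * y ^ 5" "theta_sum (-2) = - theta_sum (-17) * y ^ 2"
    using theta_sum_shift[of "-5"] theta_sum_shift[of "-2"] by (simp_all add: power_int_minus divide_inverse)
  ultimately show ?thesis by (simp add: algebra_simps eval_nat_numeral add_eq_0_iff)
qed

text \<open>The companion from \<open>rel_023\<close>, for the exponents 2 mod 5 in Euler's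
  product.\<close>

lemma theta_sum_inverse_r:
  "theta_sum (-5) / r = y ^ 2 * theta_sum 1 + theta_sum (-11)"
proof -
  have "y ^ 5 * theta_sum (-20) * (1 / r) - y * theta_sum (-14) + theta_sum (-11) = 0"
  proof (rule quadratic_const_term)
    fix t assume t: "t \<noteq> 0" "\<And>m. t * y powi m \<noteq> 1"
    have t': "t * Q \<noteq> 0" "\<And>m. t * Q * y powi m \<noteq> 1" using t Q0 gen_shift by auto
    have "al * be * (J ^ 2 / (ty (t * Q) 0 * ty (t * Q) 2 * ty (t * Q) 3)) = - (t ^ 3 * y ^ 5) * (al * be * (J ^ 2 / (ty t 0 * ty t 2 * ty t 3)))"
      unfolding ty_shift'[OF t(1)] using t y0 by (simp add: field_simps eval_nat_numeral)
    then have "lam_sum 3 (t * Q) 0 (-5) / r - y ^ 2 * lam_sum 3 (t * Q) 2 1 + y ^ 4 * lam_sum 3 (t * Q) 3 4 =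
      - (t ^ 3 * y ^ 5) * (lam_sum 3 t 0 (-5) / r - y ^ 2 * lam_sum 3 t 2 1 + y ^ 4 * lam_sum 3 t 3 4)"
      unfolding rel_023[OF t] rel_023[OF t'] .
    then have "lam_sum 3 (t * Q) 0 (-5) * (1 / r) - y * (y * lam_sum 3 (t * Q) 2 1) + y ^ 4 * lam_sum 3 (t * Q) 3 4 =
      - (t ^ 3 * y ^ 5) * (lam_sum 3 t 0 (-5) * (1 / r) - y ^ 2 * lam_sum 3 t 2 1 + y ^ 4 * lam_sum 3 t 3 4)"
      by (simp add: power2_eq_square mult.assoc)
    moreover have "lam_sum 3 (t * Q) 0 (-5) = - (t ^ 3 * lam_sum 3 t 0 (-5) + theta_sum (-20) + t * theta_sum (-15) + t ^ 2 * theta_sum (-10)) * y ^ 5"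
      using lam_sum_shift[OF t, of 0 "-5"] by (simp add: power_int_minus divide_inverse)
    moreover have "y * lam_sum 3 (t * Q) 2 1 = - ((t * y ^ 2) ^ 3 * lam_sum 3 t 2 1 + theta_sum (-14) + t * y ^ 2 * theta_sum (-9) + (t * y ^ 2) ^ 2 * theta_sum (-4))"
      using lam_sum_shift[OF t, of 2 1] y0 by simp
    moreover have "y ^ 4 * lam_sum 3 (t * Q) 3 4 = - ((t * y ^ 3) ^ 3 * lam_sum 3 t 3 4 + theta_sum (-11) + t * y ^ 3 * theta_sum (-6) + (t * y ^ 3) ^ 2 * theta_sum (-1))"
      using lam_sum_shift[OF t, of 3 4] y0 by simp
    ultimately show "y ^ 5 * theta_sum (-20) * (1 / r) - y * theta_sum (-14) + theta_sum (-11)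
       + (y ^ 5 * theta_sum (-15) * (1 / r) - y ^ 3 * theta_sum (-9) + y ^ 3 * theta_sum (-6)) * t
       + (y ^ 5 * theta_sum (-10) * (1 / r) - y ^ 5 * theta_sum (-4) + y ^ 6 * theta_sum (-1)) * t ^ 2 = 0"
      by algebra
  qed
  moreover have "theta_sum (-5) = - theta_sum (-20) * y ^ 5" "theta_sum 1 * y = - theta_sum (-14)"
    using theta_sum_shift[of "-5"] theta_sum_shift[of "1"] y0 by (simp_all add: power_int_minus divide_inverse)
  ultimately show ?thesis by (simp add: algebra_simps eval_nat_numeral add_eq_0_iff)
qed

end

lemma sum_lessThan_5: "(\<Sum>j<(5::nat). f j) = f 0 + f 1 + f 2 + f 3 + (f 4 :: complex)"
  by (simp add: eval_nat_numeral)

lemma tri_values [simp]: "tri 1 = 1" "tri 2 = 3" "tri 3 = 6" "tri 4 = 10"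
  by (simp_all add: tri_def)

context five_dissection
begin

section \<open>Splitting Lambert series of base q modulo 5\<close>

lemma root_norm: "q ^ 5 = y \<Longrightarrow> norm q < 1" "q ^ 5 = y \<Longrightarrow> q \<noteq> 0"
proof -
  assume q: "q ^ 5 = y"
  show "q \<noteq> 0" using q y0 by auto
  have "norm q ^ 5 < 1 ^ 5" using q y1 by (metis norm_power power_one)
  then show "norm q < 1" using power_less_imp_less_base[of "norm q" 5 1] by simp
qed

text \<open>Mixed bases: the theta weight is in q, the denominator in y = q^5, and t will be z^5.
  This is the form that averaging over fifth roots of unity in z leaves behind.\<close>

definition gsum :: "complex \<Rightarrow> nat \<Rightarrow> int \<Rightarrow> complex \<Rightarrow> complex" where
  "gsum q d b t = (\<Sum>\<^sub>\<infinity>n. ((- 1) powi n * q powi tri n) ^ d * (q powi b) powi n / (1 - t * y powi n))"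

lemma generic_bound:
  assumes t: "t \<noteq> 0" "\<And>m. t * y powi m \<noteq> 1"
  obtains K where "\<And>m. norm (1 / (1 - t * y powi m)) \<le> K"
  using norm_one_minus_powi_bounded_below[OF y1 y0 t] by blast

lemma gsum_summable:
  assumes q: "q ^ 5 = y" and t: "t \<noteq> 0" "\<And>m. t * y powi m \<noteq> 1" and d: "d \<ge> 1"
  shows "(\<lambda>n. ((- 1) powi n * q powi tri n) ^ d * (q powi b) powi n / (1 - t * y powi n)) summable_on UNIV"
proof -
  obtain K where K: "\<And>m. norm (1 / (1 - t * y powi m)) \<le> K" using generic_bound[OF t] by blast
  have b0: "q powi b \<noteq> 0" using root_norm[OF q] by simp
  show ?thesis using theta_weight_summable[OF root_norm[OF q] b0 d K] by simp
qed

lemma gsum_dissect: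
  assumes q: "q ^ 5 = y" and t: "t \<noteq> 0" "\<And>m. t * y powi m \<noteq> 1" and d: "d \<ge> 1"
  shows "gsum q d b t = (\<Sum>j<5. ((- 1) powi int j * q powi tri (int j)) ^ d * q powi (b * int j) * lam_sum d t (int j) (int d * (int j - 2) + b))"
  unfolding gsum_def infsum_mod_5[OF gsum_summable[OF q t d]]
proof (rule sum.cong[OF refl])
  fix j :: nat
  have "q ^ 25 = (q ^ 5) ^ 5" by (simp flip: power_mult)
  then have Q: "q ^ 25 = Q" by (simp add: Q_def q)
  have "(\<Sum>\<^sub>\<infinity>m. ((- 1) powi (5 * m + int j) * q powi tri (5 * m + int j)) ^ d * (q powi b) powi (5 * m + int j) / (1 - t * y powi (5 * m + int j)))
    = (\<Sum>\<^sub>\<infinity>m. ((- 1) powi int j * q powi tri (int j)) ^ d * q powi (b * int j) *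
      (((- 1) powi m * Q powi tri m) ^ d * (y powi (int d * (int j - 2) + b)) powi m / (1 - t * y powi int j * Q powi m)))"
  proof (rule infsum_cong)
    fix m
    have "t * y powi (5 * m + int j) = t * y powi int j * Q powi m"
      by (simp only: mult.assoc yQ add.commute)
    then show "((- 1) powi (5 * m + int j) * q powi tri (5 * m + int j)) ^ d * (q powi b) powi (5 * m + int j) / (1 - t * y powi (5 * m + int j))
       = ((- 1) powi int j * q powi tri (int j)) ^ d * q powi (b * int j) *
      (((- 1) powi m * Q powi tri m) ^ d * (y powi (int d * (int j - 2) + b)) powi m / (1 - t * y powi int j * Q powi m))"
      unfolding theta_weight_mod_5[OF root_norm(2)[OF q]] Q q by simp
  qed
  also have "\<dots> = ((- 1) powi int j * q powi tri (int j)) ^ d * q powi (b * int j) * lam_sum d t (int j) (int d * (int j - 2) + b)"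
    unfolding lam_sum_def by (rule infsum_cmult_right')
  finally show "(\<Sum>\<^sub>\<infinity>m. ((- 1) powi (5 * m + int j) * q powi tri (5 * m + int j)) ^ d * (q powi b) powi (5 * m + int j) / (1 - t * y powi (5 * m + int j)))
    = ((- 1) powi int j * q powi tri (int j)) ^ d * q powi (b * int j) * lam_sum d t (int j) (int d * (int j - 2) + b)" .
qed

lemma pentagonal_theta_sum: "J = theta_sum (-5)"
proof -
  have "J = (\<Sum>\<^sub>\<infinity>m. (- 1) powi m * Q powi (tri m + m * m))"
    unfolding J_def by (rule pentagonal[OF Q1 Q0, symmetric])
  also have "\<dots> = theta_sum (-5)"
    unfolding theta_sum_def
  proof (rule infsum_cong)
    fix m
    have e: "tri m + m * m = tri m * 3 - m" using two_tri[of m] by (simp add: algebra_simps)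
    have s: "((- 1 :: complex) powi m) ^ 3 = (- 1) powi m"
      by (cases "even m") (auto simp: power_int_def uminus_power_if even_nat_iff)
    have "(y powi (-5)) powi m = 1 / Q powi m"
      unfolding Q_def using power_int_mult[of y 5 m] power_int_mult[of y "-5" m] y0 by (simp add: power_int_minus divide_inverse)
    moreover have "(Q powi tri m) ^ 3 = Q powi (tri m * 3)" using power_int_mult[of Q "tri m" 3] by simp
    ultimately show "(- 1) powi m * Q powi (tri m + m * m) = ((- 1) powi m * Q powi tri m) ^ 3 * (y powi (-5)) powi m"
      unfolding e using Q0 by (simp add: power_mult_distrib s power_int_diff)
  qed
  finally show ?thesis .
qed

text \<open>Ramanujan's splitting of Euler's product. The five pieces have exponents 0, 2, 2, 0, 1
  mod 5; \<open>theta_sum_r\<close> and \<open>theta_sum_inverse_r\<close> combine the two pairs,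
  and the last piece is Euler's product of base Q.\<close>

lemma pentagonal_dissection:
  assumes q: "q ^ 5 = y"
  shows "qinf q q = J * (r - q - q ^ 2 / r)"
proof -
  note qn = root_norm[OF q]
  have "q ^ 25 = (q ^ 5) ^ 5" by (simp flip: power_mult)
  then have Q: "q ^ 25 = Q" by (simp add: Q_def q)
  have "qinf q q = (\<Sum>\<^sub>\<infinity>m. (- 1) powi m * q powi (tri m + m * m))"
    by (rule pentagonal[OF qn, symmetric])
  also have "\<dots> = (\<Sum>\<^sub>\<infinity>m. ((- 1) powi m * q powi tri m) ^ 3 * (q powi (-1)) powi m)"
  proof (rule infsum_cong)
    fix m
    have e: "tri m + m * m = tri m * 3 - m" using two_tri[of m] by (simp add: algebra_simps)
    have s: "((- 1 :: complex) powi m) ^ 3 = (- 1) powi m"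
      by (cases "even m") (auto simp: power_int_def uminus_power_if even_nat_iff)
    have "(q powi (-1)) powi m = 1 / q powi m"
      by (simp add: power_int_minus power_int_inverse divide_inverse)
    moreover have "(q powi tri m) ^ 3 = q powi (tri m * 3)" using power_int_mult[of q "tri m" 3] by simp
    ultimately show "(- 1) powi m * q powi (tri m + m * m) = ((- 1) powi m * q powi tri m) ^ 3 * (q powi (-1)) powi m"
      unfolding e using qn by (simp add: power_mult_distrib s power_int_diff)
  qed
  also have "\<dots> = (\<Sum>j<5. \<Sum>\<^sub>\<infinity>m. ((- 1) powi (5 * m + int j) * q powi tri (5 * m + int j)) ^ 3 * (q powi (-1)) powi (5 * m + int j))"
  proof (rule infsum_mod_5)
    have "q powi (-1) \<noteq> 0" using qn by simp
    from theta_weight_summable[OF qn this, of 3 "\<lambda>_. 1" 1]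
    show "(\<lambda>m. ((- 1) powi m * q powi tri m) ^ 3 * (q powi (-1)) powi m) summable_on UNIV" by simp
  qed
  also have "\<dots> = (\<Sum>j<5. ((- 1) powi int j * q powi tri (int j)) ^ 3 * q powi (- 1 * int j) * theta_sum (int 3 * (int j - 2) + - 1))"
    unfolding theta_weight_mod_5[OF qn(2)] Q q theta_sum_def infsum_cmult_right' ..
  also have "\<dots> = theta_sum (-7) - q ^ 2 * theta_sum (-4) + q ^ 7 * theta_sum (-1) - q ^ 15 * theta_sum 2 + q ^ 26 * theta_sum 5"
  proof -
    have "(- 1 * (q * 1)) ^ 3 * q powi (-1) = - (q ^ 2)" "((q ^ 3)) ^ 3 * q powi (-2) = q ^ 7"
      "(- (q ^ 6)) ^ 3 * q powi (-3) = - (q ^ 15)" "((q ^ 10)) ^ 3 * q powi (-4) = q ^ 26"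
      using qn by (simp_all add: power_int_minus divide_simps flip: power_mult) (simp_all flip: power_add power_Suc2 power_Suc)
    then show ?thesis unfolding sum_lessThan_5 by simp
  qed
  also have "\<dots> = r * theta_sum (-5) - q * theta_sum (-5) - q ^ 2 * (theta_sum (-5) / r)"
  proof -
    have th8: "theta_sum (-7) = theta_sum (-8)"
      using theta_sum_neg[of "-7"] theta_sum_shift[of 7] y0 by (simp add: power_int_minus divide_inverse)
    have th11: "theta_sum (-4) = theta_sum (-11)"
      using theta_sum_neg[of "-4"] theta_sum_shift[of 4] y0 by (simp add: power_int_minus divide_inverse)
    have th2: "q ^ 15 * theta_sum 2 = - y * theta_sum (-2)"
      using theta_sum_neg[of 2] y0 by (simp add: q[symmetric] divide_simps) (simp add: eval_nat_numeral mult_ac)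
    have th5: "q ^ 26 * theta_sum 5 = - q * theta_sum (-5)"
      using theta_sum_neg[of 5] y0 by (simp add: q[symmetric] divide_simps) (simp add: eval_nat_numeral mult_ac)
    have th1: "q ^ 7 * theta_sum (-1) = - (q ^ 2) * (y ^ 2 * theta_sum 1)"
      using theta_sum_neg[of 1] y0 by (simp add: q[symmetric] divide_simps) (simp add: eval_nat_numeral mult_ac)
    show ?thesis unfolding th8 th11 th2 th5 th1 theta_sum_r theta_sum_inverse_r by (simp add: algebra_simps)
  qed
  finally show ?thesis unfolding pentagonal_theta_sum by (simp add: algebra_simps)
qed

text \<open>\<open>rel_014\<close> removes the pieces 1 and 4, \<open>rel_023\<close> the pieces 2
  and 3. Piece 0 is left with the coefficient 1 - r q^4/y + q/r, which by q^5 = y is -q^4/y times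
  the factor in \<open>pentagonal_dissection\<close>.\<close>

lemma gsum_3_1:
  assumes q: "q ^ 5 = y" and t: "t \<noteq> 0" "\<And>m. t * y powi m \<noteq> 1"
  shows "gsum q 3 1 t = - (r - q - q ^ 2 / r) * (q ^ 4 / y) * lam_sum 3 t 0 (-5) +
     al * be * J ^ 2 * (q ^ 4 / y / (ty t 0 * ty t 1 * ty t 4) - q / (ty t 0 * ty t 2 * ty t 3))"
proof -
  note qn = root_norm[OF q]
  have "gsum q 3 1 t = lam_sum 3 t 0 (-5) - q ^ 4 * lam_sum 3 t 1 (-2) + q ^ 11 * lam_sum 3 t 2 1 - q ^ 21 * lam_sum 3 t 3 4 + q ^ 34 * lam_sum 3 t 4 7"
    using gsum_dissect[OF q t, of 3 1] unfolding sum_lessThan_5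
    by (simp flip: power_mult power_Suc power_Suc2 power_add)
  moreover define iy ir where "iy = 1 / y" and "ir = 1 / r"
  moreover have "iy * y = 1" "ir * r = 1" using y0 r_nonzero by (simp_all add: iy_def ir_def)
  moreover note rel_014[OF t] rel_023[OF t] q
  moreover define a0 a1 a2 a3 a4 where "a0 = lam_sum 3 t 0 (-5)" and "a1 = lam_sum 3 t 1 (-2)" and "a2 = lam_sum 3 t 2 1" and "a3 = lam_sum 3 t 3 4" and "a4 = lam_sum 3 t 4 7"
  moreover define u1 u2 where "u1 = 1 / (ty t 0 * ty t 1 * ty t 4)" and "u2 = 1 / (ty t 0 * ty t 2 * ty t 3)"
  ultimately have A: "gsum q 3 1 t = a0 - q ^ 4 * a1 + q ^ 11 * a2 - q ^ 21 * a3 + q ^ 34 * a4"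
    "iy * y = 1" "ir * r = 1" "r * a0 - y * a1 + y ^ 7 * a4 = al * be * (J ^ 2 * u1)"
    "a0 * ir - y ^ 2 * a2 + y ^ 4 * a3 = al * be * (J ^ 2 * u2)" "q ^ 5 = y" by (simp_all)
  have "gsum q 3 1 t = - (r - q - q ^ 2 * ir) * (q ^ 4 * iy) * a0 + al * be * J ^ 2 * (q ^ 4 * iy * u1 - q * u2)"
    using A by algebra
  then show ?thesis by (simp add: iy_def ir_def a0_def u1_def u2_def)
qed

text \<open>Here the relations share piece 2, whose coefficient q^9 + y^2/r - q^3 y r is -y q^3
  times the same factor.\<close>

lemma gsum_3_0:
  assumes q: "q ^ 5 = y" and t: "t \<noteq> 0" "\<And>m. t * y powi m \<noteq> 1"
  shows "gsum q 3 0 t = - (r - q - q ^ 2 / r) * (y * q ^ 3) * lam_sum 3 t 2 0 +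
     al * be * J ^ 2 * (1 / (ty t 0 * ty t 2 * ty t 4) - q ^ 3 / (ty t 1 * ty t 2 * ty t 3))"
proof -
  note qn = root_norm[OF q]
  have "gsum q 3 0 t = lam_sum 3 t 0 (-6) - q ^ 3 * lam_sum 3 t 1 (-3) + q ^ 9 * lam_sum 3 t 2 0 - q ^ 18 * lam_sum 3 t 3 3 + q ^ 30 * lam_sum 3 t 4 6"
    using gsum_dissect[OF q t, of 3 0] unfolding sum_lessThan_5
    by (simp flip: power_mult power_Suc power_Suc2 power_add)
  moreover define iy ir where "iy = 1 / y" and "ir = 1 / r"
  moreover have "iy * y = 1" "ir * r = 1" using y0 r_nonzero by (simp_all add: iy_def ir_def)
  moreover note rel_024[OF t] rel_123[OF t] q
  moreover define a0 a1 a2 a3 a4 where "a0 = lam_sum 3 t 0 (-6)" and "a1 = lam_sum 3 t 1 (-3)" and "a2 = lam_sum 3 t 2 0" and "a3 = lam_sum 3 t 3 3" and "a4 = lam_sum 3 t 4 6"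
  moreover define u1 u2 where "u1 = 1 / (ty t 0 * ty t 2 * ty t 4)" and "u2 = 1 / (ty t 1 * ty t 2 * ty t 3)"
  ultimately have A: "gsum q 3 0 t = a0 - q ^ 3 * a1 + q ^ 9 * a2 - q ^ 18 * a3 + q ^ 30 * a4"
    "ir * r = 1" "a0 - y ^ 2 * a2 * ir + y ^ 6 * a4 = al * be * (J ^ 2 * u1)"
    "a1 - y * r * a2 + y ^ 3 * a3 = al * be * (J ^ 2 * u2)" "q ^ 5 = y" by (simp_all)
  have "gsum q 3 0 t = - (r - q - q ^ 2 * ir) * (y * q ^ 3) * a2 + al * be * J ^ 2 * (u1 - q ^ 3 * u2)"
    using A by algebra
  then show ?thesis by (simp add: ir_def a2_def u1_def u2_def)
qed

text \<open>At level one the two pairs and the single index exhaust the pieces, so that only theta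
  quotients remain.\<close>

lemma gsum_1_1:
  assumes q: "q ^ 5 = y" and t: "t \<noteq> 0" "\<And>m. t * y powi m \<noteq> 1"
  shows "gsum q 1 1 t = J ^ 2 * (r * (ty t 1 / (ty t 0 * ty t 2)) - q ^ 2 / ty t 1 - y * q ^ 4 / r * (ty t 6 / (ty t 3 * ty t 4)))"
proof -
  note qn = root_norm[OF q]
  have "gsum q 1 1 t = lam_sum 1 t 0 (-1) - q ^ 2 * lam_sum 1 t 1 0 + q ^ 5 * lam_sum 1 t 2 1 - q ^ 9 * lam_sum 1 t 3 2 + q ^ 14 * lam_sum 1 t 4 3"
  proof -
    have e: "q ^ 5 = q ^ 3 * (q * q)" "q ^ 2 = q * q" by (simp_all add: eval_nat_numeral)
    show ?thesis
      using gsum_dissect[OF q t, of 1 1] unfolding sum_lessThan_5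
      by (simp flip: power_mult power_Suc power_Suc2 power_add add: e)
  qed
  moreover define ir where "ir = 1 / r"
  moreover have "ir * r = 1" using r_nonzero by (simp_all add: ir_def)
  moreover note rel_02[OF t] rel_34[OF t] pf_1[OF t, of 1] q
  moreover define a0 a1 a2 a3 a4 where "a0 = lam_sum 1 t 0 (-1)" and "a1 = lam_sum 1 t 1 0" and "a2 = lam_sum 1 t 2 1" and "a3 = lam_sum 1 t 3 2" and "a4 = lam_sum 1 t 4 3"
  moreover define u1 u2 u3 where "u1 = ty t 1 / (ty t 0 * ty t 2)" and "u2 = 1 / ty t 1" and "u3 = ty t 6 / (ty t 3 * ty t 4)"
  ultimately have A: "gsum q 1 1 t = a0 - q ^ 2 * a1 + q ^ 5 * a2 - q ^ 9 * a3 + q ^ 14 * a4"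
    "ir * r = 1" "a0 + y * a2 = r * (J ^ 2 * u1)" "a3 - y * a4 = J ^ 2 * u3 * ir" "J ^ 2 * u2 = a1" "q ^ 5 = y" by (simp_all)
  have "gsum q 1 1 t = J ^ 2 * (r * u1 - q ^ 2 * u2 - y * q ^ 4 * ir * u3)"
    using A by algebra
  then show ?thesis by (simp add: ir_def u1_def u2_def u3_def)
qed

lemma gsum_1_0:
  assumes q: "q ^ 5 = y" and t: "t \<noteq> 0" "\<And>m. t * y powi m \<noteq> 1"
  shows "gsum q 1 0 t = J ^ 2 * (ty t 2 / (ty t 0 * ty t 4) / r - q * r * (ty t 2 / (ty t 1 * ty t 3)) + q ^ 3 / ty t 2)"
proof -
  note qn = root_norm[OF q]
  have "gsum q 1 0 t = lam_sum 1 t 0 (-2) - q * lam_sum 1 t 1 (-1) + q ^ 3 * lam_sum 1 t 2 0 - q ^ 6 * lam_sum 1 t 3 1 + q ^ 10 * lam_sum 1 t 4 2"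
    using gsum_dissect[OF q t, of 1 0] unfolding sum_lessThan_5
    by (simp flip: power_mult power_Suc power_Suc2 power_add)
  moreover define ir where "ir = 1 / r"
  moreover have "ir * r = 1" using r_nonzero by (simp_all add: ir_def)
  moreover note rel_04[OF t] rel_13[OF t] pf_1[OF t, of 2] q
  moreover define a0 a1 a2 a3 a4 where "a0 = lam_sum 1 t 0 (-2)" and "a1 = lam_sum 1 t 1 (-1)" and "a2 = lam_sum 1 t 2 0" and "a3 = lam_sum 1 t 3 1" and "a4 = lam_sum 1 t 4 2"
  moreover define u1 u2 u3 where "u1 = ty t 2 / (ty t 0 * ty t 4)" and "u2 = ty t 2 / (ty t 1 * ty t 3)" and "u3 = 1 / ty t 2"
  ultimately have A: "gsum q 1 0 t = a0 - q * a1 + q ^ 3 * a2 - q ^ 6 * a3 + q ^ 10 * a4"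
    "ir * r = 1" "a0 + y ^ 2 * a4 = J ^ 2 * u1 * ir" "a1 + y * a3 = r * (J ^ 2 * u2)" "J ^ 2 * u3 = a2" "q ^ 5 = y" by (simp_all)
  have "gsum q 1 0 t = J ^ 2 * (u1 * ir - q * r * u2 + q ^ 3 * u3)"
    using A by algebra
  then show ?thesis by (simp add: ir_def u1_def u2_def u3_def)
qed

end

section \<open>Second-order jets\<close>

text \<open>Taylor coefficients at 0 up to order two; c is half the second derivative. Comparing
  jets of products replaces division by a function that vanishes at 0.\<close>

definition jet :: "(complex \<Rightarrow> complex) \<Rightarrow> complex \<Rightarrow> complex \<Rightarrow> complex \<Rightarrow> bool" where
  "jet f a b c \<longleftrightarrow> (\<exists>F. f has_fps_expansion F \<and> fps_nth F 0 = a \<and> fps_nth F 1 = b \<and> fps_nth F 2 = c)"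

lemma jet_mult:
  assumes "jet f a b c" "jet g a' b' c'"
  shows "jet (\<lambda>u. f u * g u) (a * a') (a * b' + b * a') (a * c' + b * b' + c * a')"
proof -
  obtain F G where "f has_fps_expansion F" "fps_nth F 0 = a" "fps_nth F 1 = b" "fps_nth F 2 = c"
     "g has_fps_expansion G" "fps_nth G 0 = a'" "fps_nth G 1 = b'" "fps_nth G 2 = c'"
    using assms unfolding jet_def by blast
  then show ?thesis unfolding jet_def
    by (intro exI[of _ "F * G"]) (auto intro!: fps_expansion_intros simp: fps_mult_nth eval_nat_numeral)
qed

lemma jet_add:
  assumes "jet f a b c" "jet g a' b' c'"
  shows "jet (\<lambda>u. f u + g u) (a + a') (b + b') (c + c')"
proof -
  obtain F G where "f has_fps_expansion F" "fps_nth F 0 = a" "fps_nth F 1 = b" "fps_nth F 2 = c"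
     "g has_fps_expansion G" "fps_nth G 0 = a'" "fps_nth G 1 = b'" "fps_nth G 2 = c'"
    using assms unfolding jet_def by blast
  then show ?thesis unfolding jet_def
    by (intro exI[of _ "F + G"]) (auto intro!: fps_expansion_intros)
qed

lemma jet_const: "jet (\<lambda>_. k) k 0 0"
  unfolding jet_def by (intro exI[of _ "fps_const k"]) auto

lemma jet_exp: "jet (\<lambda>u. exp (k * u)) 1 k (k ^ 2 / 2)"
  unfolding jet_def
  by (intro exI[of _ "fps_exp k"]) (auto intro!: fps_expansion_intros simp: fact_numeral)

lemma jet_reflect:
  assumes "jet f a b c"
  shows "jet (\<lambda>u. f (- u)) a (- b) c"
proof -
  obtain F where F: "f has_fps_expansion F" "fps_nth F 0 = a" "fps_nth F 1 = b" "fps_nth F 2 = c"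
    using assms unfolding jet_def by blast
  have "(\<lambda>u::complex. (- 1) * u) has_fps_expansion (fps_const (- 1) * fps_X)"
    by (intro fps_expansion_intros)
  from has_fps_expansion_compose[OF F(1) this]
  have "(f \<circ> (\<lambda>u. (- 1) * u)) has_fps_expansion (Abs_fps (\<lambda>n. (- 1) ^ n * fps_nth F n))"
    unfolding fps_compose_linear by simp
  then show ?thesis unfolding jet_def using F(2-4) by (intro exI) (auto simp: o_def)
qed

lemma jet_analytic:
  assumes "f analytic_on {0}"
  shows "\<exists>b c. jet f (f 0) b c"
proof -
  have F: "f has_fps_expansion fps_expansion f 0" by (rule analytic_at_imp_has_fps_expansion_0[OF assms])
  have "fps_nth (fps_expansion f 0) 0 = f 0" using has_fps_expansion_imp_0_eq_fps_nth_0[OF F] by simp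
  then show ?thesis unfolding jet_def using F by (intro exI conjI) auto
qed

text \<open>Continuity extends an equality from the punctured neighbourhood to 0. The identities
  below are available only there, because u = 0 is a pole of the Lambert series.\<close>

lemma jet_unique:
  assumes "jet f a b c" "jet g a' b' c'" "\<forall>\<^sub>F u in at 0. f u = g u"
  shows "a = a'" "b = b'" "c = c'"
proof -
  obtain F where F: "f has_fps_expansion F" "fps_nth F 0 = a" "fps_nth F 1 = b" "fps_nth F 2 = c"
    using assms unfolding jet_def by blast
  obtain G where G: "g has_fps_expansion G" "fps_nth G 0 = a'" "fps_nth G 1 = b'" "fps_nth G 2 = c'"
    using assms unfolding jet_def by blast
  have "f \<midarrow>0\<rightarrow> f 0" "g \<midarrow>0\<rightarrow> g 0"
    using has_fps_expansion_imp_continuous[OF F(1), of UNIV] has_fps_expansion_imp_continuous[OF G(1), of UNIV]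
    by (auto simp: continuous_at)
  moreover have "f \<midarrow>0\<rightarrow> g 0"
    using calculation(2) Lim_transform_eventually[of g "g 0" "at 0" f] assms(3) by (simp add: eq_commute)
  ultimately have "f 0 = g 0" using LIM_unique by blast
  then have "\<forall>\<^sub>F u in nhds 0. f u = g u"
    using assms(3) unfolding eventually_at_filter by (auto elim!: eventually_mono)
  then have "g has_fps_expansion F"
    using F(1) has_fps_expansion_cong by blast
  then have "F = G" using G(1) fps_expansion_unique_complex by blast
  then show "a = a'" "b = b'" "c = c'" using F G by auto
qed

lemma jet_deriv:
  assumes "jet f a b c"
  shows "f 0 = a" "(f has_field_derivative b) (at 0)"
proof -
  obtain F where F: "f has_fps_expansion F" "fps_nth F 0 = a" "fps_nth F 1 = b" "fps_nth F 2 = c"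
    using assms unfolding jet_def by blast
  show "f 0 = a" using has_fps_expansion_imp_0_eq_fps_nth_0[OF F(1)] F by simp
  have "f analytic_on {0}" using F(1) has_fps_expansion_imp_analytic_0 by blast
  then have "f field_differentiable (at 0)" by (rule analytic_on_imp_differentiable_at) simp
  moreover have "deriv f 0 = b" using fps_nth_fps_expansion[OF F(1), of 1] F by simp
  ultimately show "(f has_field_derivative b) (at 0)" using field_differentiable_derivI by blast
qed

context five_dissection
begin

lemma th_analytic:
  assumes "x \<noteq> 0"
  shows "(\<lambda>u. th (exp (k * u) * x)) analytic_on {0}"
proof -
  have "(\<lambda>u. th (exp (k * u) * x)) holomorphic_on UNIV"
    unfolding th_def jth_def by (intro holomorphic_intros qinf_holomorphic' Q1) (use assms in auto)
  then show ?thesis using analytic_on_holomorphic by blast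
qed

text \<open>The inversion x -> Q/x exchanges u and -u between the indices 1 and 4 and between 2 and
  3, which leaves four unknown coefficients. At index 0 the zero 1 - exp(5u) multiplies an even
  function, so its jet is explicit.\<close>

lemma jets_ty:
  obtains x1 x2 z1 z2 where
    "jet (\<lambda>u. ty (exp (5 * u)) 0) 0 (- 5 * J ^ 2) (- 25 / 2 * J ^ 2)"
    "jet (\<lambda>u. ty (exp (5 * u)) 1) al (al * x1) (al * x2)"
    "jet (\<lambda>u. ty (exp (5 * u)) 2) be (be * z1) (be * z2)"
    "jet (\<lambda>u. ty (exp (5 * u)) 3) be (- be * z1) (be * z2)"
    "jet (\<lambda>u. ty (exp (5 * u)) 4) al (- al * x1) (al * x2)"
proof -
  have a1: "(\<lambda>u. th (exp (5 * u) * y)) analytic_on {0}" and a2: "(\<lambda>u. th (exp (5 * u) * y ^ 2)) analytic_on {0}"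
    using th_analytic y0 by auto
  obtain b c where j1: "jet (\<lambda>u. ty (exp (5 * u)) 1) al b c"
    using jet_analytic[OF a1] by (auto simp: ty_def al_def)
  obtain b' c' where j2: "jet (\<lambda>u. ty (exp (5 * u)) 2) be b' c'"
    using jet_analytic[OF a2] by (auto simp: ty_def be_def)
  have r4: "ty (exp (5 * u)) 4 = ty (exp (5 * (- u))) 1" for u
  proof -
    have "exp (5 * u) * y ^ 4 = Q / (exp (5 * (- u)) * y)"
      unfolding Q_def using y0 by (simp add: exp_minus divide_inverse eval_nat_numeral)
    then show ?thesis using th_inverse[of "exp (5 * (- u)) * y"] y0 by (simp add: ty_def)
  qed
  have r3: "ty (exp (5 * u)) 3 = ty (exp (5 * (- u))) 2" for u
  proof -
    have "exp (5 * u) * y ^ 3 = Q / (exp (5 * (- u)) * y ^ 2)"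
      unfolding Q_def using y0 by (simp add: exp_minus field_simps eval_nat_numeral)
    then show ?thesis using th_inverse[of "exp (5 * (- u)) * y ^ 2"] y0 by (simp add: ty_def)
  qed
  have j4: "jet (\<lambda>u. ty (exp (5 * u)) 4) al (- b) c" unfolding r4 by (rule jet_reflect[OF j1])
  have j3: "jet (\<lambda>u. ty (exp (5 * u)) 3) be (- b') c'" unfolding r3 by (rule jet_reflect[OF j2])
  have "(\<lambda>u. qinf (exp (5 * u) * Q) Q) holomorphic_on UNIV"
    by (intro holomorphic_intros qinf_holomorphic' Q1)
  then have "(\<lambda>u. qinf (exp (5 * u) * Q) Q) analytic_on {0}" using analytic_on_holomorphic by blast
  then obtain kb kc where k: "jet (\<lambda>u. qinf (exp (5 * u) * Q) Q) J kb kc"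
    using jet_analytic[of "\<lambda>u. qinf (exp (5 * u) * Q) Q"] by (auto simp: J_def)
  have "ty (exp (5 * u)) 0 = (1 + (- 1) * exp (5 * u)) * (qinf (exp (5 * u) * Q) Q * qinf (exp (5 * (- u)) * Q) Q)" for u
    unfolding ty_def th_def jth_def using qinf_rec[OF Q1, of "exp (5 * u)"]
    by (simp add: exp_minus divide_inverse mult_ac)
  moreover have "jet (\<lambda>u. (1 + (- 1) * exp (5 * u)) * (qinf (exp (5 * u) * Q) Q * qinf (exp (5 * (- u)) * Q) Q)) 0 (- 5 * J ^ 2) (- 25 / 2 * J ^ 2)"
  proof -
    note j = jet_mult[OF jet_add[OF jet_const[of 1] jet_mult[OF jet_const[of "- 1"] jet_exp[of 5]]] jet_mult[OF k jet_reflect[OF k]]]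
    then show ?thesis by (simp add: power2_eq_square)
  qed
  ultimately have j0: "jet (\<lambda>u. ty (exp (5 * u)) 0) 0 (- 5 * J ^ 2) (- 25 / 2 * J ^ 2)" by simp
  show ?thesis
    by (rule that[of "b / al" "c / al" "b' / be" "c' / be"])
       (use j0 j1 j2 j3 j4 al_be_nonzero in simp_all)
qed

text \<open>For m nonzero the moduli of exp(5u) and y^(-m) differ when u is small. For m = 0, |u| <
  1 gives |5u| < 2 pi, so exp(5u) = 1 only at u = 0.\<close>

lemma generic_near_1: "\<forall>\<^sub>F u in at 0. \<forall>m. exp (5 * u) * y powi m \<noteq> 1"
proof -
  have "((\<lambda>u::complex. norm (exp (5 * u))) \<longlongrightarrow> norm (exp (5 * (0::complex)))) (at 0)" by (intro tendsto_intros)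
  then have l: "((\<lambda>u::complex. norm (exp (5 * u))) \<longlongrightarrow> 1) (at 0)" by simp
  have "\<forall>\<^sub>F u::complex in at 0. norm (exp (5 * u)) < 1 / norm y"
    by (rule order_tendstoD(2)[OF l]) (use y1 y0 in \<open>simp add: field_simps\<close>)
  moreover have "\<forall>\<^sub>F u::complex in at 0. norm (exp (5 * u)) > norm y"
    by (rule order_tendstoD(1)[OF l]) (use y1 in simp)
  moreover have "\<forall>\<^sub>F u::complex in at 0. u \<noteq> 0 \<and> norm u < 1"
    unfolding eventually_at by (rule exI[of _ 1]) (auto simp: dist_norm)
  ultimately show ?thesis
  proof eventually_elim
    case (elim u)
    show ?case
    proof
      fix m
      show "exp (5 * u) * y powi m \<noteq> 1"
      proof
        assume h: "exp (5 * u) * y powi m = 1"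
        then have n: "norm (exp (5 * u)) * norm y powi m = 1" by (metis norm_mult norm_power_int norm_one)
        consider "m = 0" | "m \<ge> 1" | "m \<le> -1" by linarith
        then show False
        proof cases
          case 1
          then have "exp (5 * u) = 1" using h by simp
          then obtain n :: int where n: "Im (5 * u) = of_int (2 * n) * pi" and re: "Re (5 * u) = 0" unfolding exp_eq_1 by auto
          have "\<bar>Im u\<bar> < 1" using elim(3) abs_Im_le_cmod[of u] by linarith
          then have "\<bar>of_int (2 * n) * pi\<bar> < 5" using n by simp
          then have "\<bar>of_int n :: real\<bar> * (2 * pi) < 5" by (simp add: abs_mult)
          moreover have "2 * pi > 6" using pi_gt3 by simp
          ultimately have "\<bar>of_int n :: real\<bar> < 1"
            by (smt (verit) mult_less_cancel_right2 mult_left_mono)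
          then have "n = 0" by linarith
          then have "u = 0" using n re by (simp add: complex_eq_iff)
          then show False using elim(3) by simp
        next
          case 2
          have "norm y powi m \<le> norm y"
            using power_decreasing[of 1 "nat m" "norm y"] 2 y1 by (simp add: power_int_def)
          then have "norm (exp (5 * u)) * norm y powi m \<le> norm (exp (5 * u)) * norm y" by (intro mult_left_mono) auto
          also have "\<dots> < 1" using elim(1) y0 by (simp add: field_simps)
          finally show False using n by simp
        next
          case 3
          have "norm y powi (- m) \<le> norm y"
            using power_decreasing[of 1 "nat (- m)" "norm y"] 3 y1 by (simp add: power_int_def)
          moreover have "norm (exp (5 * u)) = norm y powi (- m)"
            using n y0 by (simp add: power_int_minus field_simps)
          ultimately show False using elim(2) by simp
        qed
      qed
    qed
  qed
qed

end

section \<open>Weierstrass relations\<close>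

lemma jet_scaled: "jet f a b c \<Longrightarrow> a = 0 \<Longrightarrow> c = 5 / 2 * b \<Longrightarrow> \<exists>n. jet f 0 n (5 / 2 * n)"
  by blast

lemma jet_eq: "jet f a b c \<Longrightarrow> a = a' \<Longrightarrow> b = b' \<Longrightarrow> c = c' \<Longrightarrow> jet f a' b' c'"
  by simp

text \<open>Pure algebra of jets: \<open>T0\<close> to \<open>T4\<close> stand for the five theta
  factors and K for J^2. W1 at order two and W2, W3 at order one give R1 to R3. R2 and R3 determine
  x1 and z1, while x2 and z2 enter the total only through x2 - z2, which R1 supplies.\<close>

lemma crank_rank_numerator_jet:
  fixes al be r y K x1 x2 z1 z2 :: complex and T0 T1 T2 T3 T4 :: "complex \<Rightarrow> complex"
  assumes j0: "jet T0 0 (- 5 * K) (- 25 / 2 * K)" and j1: "jet T1 al (al * x1) (al * x2)"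
    and j2: "jet T2 be (be * z1) (be * z2)" and j3: "jet T3 be (- be * z1) (be * z2)" and j4: "jet T4 al (- al * x1) (al * x2)"
    and W1: "\<forall>\<^sub>F u in at 0. T2 u * T3 u + (- (r ^ 2)) * (T1 u * T4 u) = r * y * (exp ((- 5) * u) * (T0 u * T0 u))"
    and W2: "\<forall>\<^sub>F u in at 0. T2 u * T2 u + (- r) * (T1 u * T3 u) = (- y / r) * (T0 u * T4 u)"
    and W3: "\<forall>\<^sub>F u in at 0. r * (T1 u * T1 u) + (- 1) * (exp (5 * u) * (T3 u * T4 u)) = r ^ 2 * (T0 u * T2 u)"
    and nz: "r \<noteq> 0" "al \<noteq> 0" and be: "be = r * al"
    and p: "p0 = r ^ 4 - 3 * y / r" "p1 = r ^ 3 + 2 * y / r ^ 2" "p2 = 2 * r ^ 2 - y / r ^ 3" "p3 = 3 * r + y / r ^ 4"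
  shows "\<exists>n. jet (\<lambda>u. exp (1 * u) * (p2 * r * (T1 u * T1 u * (T3 u * T4 u)) + (- p0) * (T0 u * (T2 u * (T3 u * T4 u)))
     + y * p3 / r * (exp ((- 5) * u) * (T0 u * (T1 u * T1 u * T2 u))) + (- p2 / r) * (T1 u * (T2 u * T2 u * T3 u))
     + r * p1 * (T0 u * (T2 u * T2 u * T4 u)) + (- 5 * y) * (T0 u * (T1 u * (T3 u * T4 u))))
     + 2 * al * be * (exp (2 * u) * (p3 * (T2 u * T3 u) + (- p1) * (T1 u * T4 u) + 5 * y * (T0 u * T4 u) + (- p2) * (T1 u * T3 u))))
     0 n (5 / 2 * n)"
proof -
  note m = jet_mult and c = jet_const and pl = jet_add
  \<comment> \<open>A homogeneous scaling: in r, g, \<rho> and w each jet is a monomial in g and r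
    times a polynomial in \<rho>, w and the unknown coefficients, so the powers of g and r
    cancel.\<close>
  define g where "g = al / r ^ 2"
  define \<rho> where "\<rho> = y / r ^ 5"
  define w where "w = K / g"
  have g: "g \<noteq> 0" using nz by (simp add: g_def)
  have s: "al = g * r ^ 2" "be = g * r ^ 3" "y = \<rho> * r ^ 5" "K = w * g"
    using nz g by (simp_all add: g_def be \<rho>_def w_def eval_nat_numeral)
  have ps: "p0 = r ^ 4 * (1 - 3 * \<rho>)" "p1 = r ^ 3 * (1 + 2 * \<rho>)" "p2 = r ^ 2 * (2 - \<rho>)" "p3 = r * (3 + \<rho>)"
    unfolding p \<rho>_def using nz by (simp_all add: field_simps eval_nat_numeral)
  have cancel: "a = b" if "X = Y" "X = c * a" "Y = c * b" "c \<noteq> 0" for a b c X Y :: complex using that by simp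
  have R1: "2 * z2 - z1 ^ 2 - 2 * x2 + x1 ^ 2 = 25 * (\<rho> * w ^ 2)"
  proof -
    have "be ^ 2 * (2 * z2 - z1 ^ 2) - r ^ 2 * al ^ 2 * (2 * x2 - x1 ^ 2) = 25 * (r * y * K ^ 2)"
      using jet_unique(3)[OF pl[OF m[OF j2 j3] m[OF c[of "- (r ^ 2)"] m[OF j1 j4]]] m[OF c[of "r * y"] m[OF jet_exp[of "- 5"] m[OF j0 j0]]] W1]
      by (simp add: algebra_simps power2_eq_square)
    moreover have "be ^ 2 * (2 * z2 - z1 ^ 2) - r ^ 2 * al ^ 2 * (2 * x2 - x1 ^ 2) = r ^ 6 * g ^ 2 * (2 * z2 - z1 ^ 2 - 2 * x2 + x1 ^ 2)"
      unfolding s by algebra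
    moreover have "25 * (r * y * K ^ 2) = r ^ 6 * g ^ 2 * (25 * (\<rho> * w ^ 2))"
      unfolding s(3,4) by algebra
    ultimately show ?thesis by (rule cancel) (use nz g in simp)
  qed
  have R2: "3 * z1 - x1 = 5 * (\<rho> * w)"
  proof -
    have "- y / r = - \<rho> * r ^ 4" unfolding s using nz by (simp add: eval_nat_numeral)
    note W2' = W2[unfolded this]
    have "2 * be ^ 2 * z1 + r * al * be * (z1 - x1) = 5 * \<rho> * r ^ 4 * K * al"
      using jet_unique(2)[OF pl[OF m[OF j2 j2] m[OF c[of "- r"] m[OF j1 j3]]] m[OF c[of "- \<rho> * r ^ 4"] m[OF j0 j4]] W2']
      by (simp add: algebra_simps power2_eq_square)
    moreover have "2 * be ^ 2 * z1 + r * al * be * (z1 - x1) = r ^ 6 * g ^ 2 * (3 * z1 - x1)"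
      unfolding s by algebra
    moreover have "5 * \<rho> * r ^ 4 * K * al = r ^ 6 * g ^ 2 * (5 * (\<rho> * w))"
      unfolding s(1,4) by algebra
    ultimately show ?thesis by (rule cancel) (use nz g in simp)
  qed
  have R3: "3 * x1 + z1 = 5 - 5 * w"
  proof -
    have "2 * r * al ^ 2 * x1 + al * be * (x1 + z1) = 5 * (al * be) - 5 * (r ^ 2 * K * be)"
      using jet_unique(2)[OF pl[OF m[OF c[of r] m[OF j1 j1]] m[OF c[of "- 1"] m[OF jet_exp[of 5] m[OF j3 j4]]]] m[OF c[of "r ^ 2"] m[OF j0 j2]] W3]
      by (simp add: algebra_simps power2_eq_square)
    moreover have "2 * r * al ^ 2 * x1 + al * be * (x1 + z1) = r ^ 5 * g ^ 2 * (3 * x1 + z1)"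
      unfolding s by algebra
    moreover have "5 * (al * be) - 5 * (r ^ 2 * K * be) = r ^ 5 * g ^ 2 * (5 - 5 * w)"
      unfolding s(1,2,4) by algebra
    ultimately show ?thesis by (rule cancel) (use nz g in simp)
  qed
  define P where "P = \<rho> * w"
  have z1: "z1 = (1 - w + 3 * P) / 2" and x1: "x1 = (3 - 3 * w - P) / 2"
    using R2 R3 unfolding P_def by algebra+
  have coeffs: "p2 * r = r ^ 3 * (2 - \<rho>)" "y * p3 / r = \<rho> * r ^ 5 * (3 + \<rho>)" "- p2 / r = - (r * (2 - \<rho>))"
    unfolding ps s(3) using nz by (simp_all add: eval_nat_numeral)
  have J1: "jet (\<lambda>u. p2 * r * (T1 u * T1 u * (T3 u * T4 u))) (g ^ 4 * r ^ 12 * (2 - \<rho>) * (1)) (g ^ 4 * r ^ 12 * (2 - \<rho>) * (x1 - z1)) (g ^ 4 * r ^ 12 * (2 - \<rho>) * (3 * x2 + z2 - x1 ^ 2 - x1 * z1))"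
    by (rule jet_eq[OF m[OF c[of "p2 * r"] m[OF m[OF j1 j1] m[OF j3 j4]]]]; (unfold coeffs)?; (unfold ps s)?; algebra)
  have J2: "jet (\<lambda>u. (- p0) * (T0 u * (T2 u * (T3 u * T4 u)))) (g ^ 4 * r ^ 12 * (5 * (1 - 3 * \<rho>) * w) * (0)) (g ^ 4 * r ^ 12 * (5 * (1 - 3 * \<rho>) * w) * (1)) (g ^ 4 * r ^ 12 * (5 * (1 - 3 * \<rho>) * w) * (5 / 2 - x1))"
    by (rule jet_eq[OF m[OF c[of "- p0"] m[OF j0 m[OF j2 m[OF j3 j4]]]]]; (unfold coeffs)?; (unfold ps s)?; algebra)
  have J3: "jet (\<lambda>u. y * p3 / r * (exp ((- 5) * u) * (T0 u * (T1 u * T1 u * T2 u)))) (g ^ 4 * r ^ 12 * (- 5 * \<rho> * (3 + \<rho>) * w) * (0)) (g ^ 4 * r ^ 12 * (- 5 * \<rho> * (3 + \<rho>) * w) * (1)) (g ^ 4 * r ^ 12 * (- 5 * \<rho> * (3 + \<rho>) * w) * (- 5 / 2 + 2 * x1 + z1))"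
    by (rule jet_eq[OF m[OF c[of "y * p3 / r"] m[OF jet_exp[of "- 5"] m[OF j0 m[OF m[OF j1 j1] j2]]]]]; (unfold coeffs)?; (unfold ps s)?; algebra)
  have J4: "jet (\<lambda>u. (- p2 / r) * (T1 u * (T2 u * T2 u * T3 u))) (g ^ 4 * r ^ 12 * (- (2 - \<rho>)) * (1)) (g ^ 4 * r ^ 12 * (- (2 - \<rho>)) * (x1 + z1)) (g ^ 4 * r ^ 12 * (- (2 - \<rho>)) * (3 * z2 + x2 - z1 ^ 2 + x1 * z1))"
    by (rule jet_eq[OF m[OF c[of "- p2 / r"] m[OF j1 m[OF m[OF j2 j2] j3]]]]; (unfold coeffs)?; (unfold ps s)?; algebra)
  have J5: "jet (\<lambda>u. r * p1 * (T0 u * (T2 u * T2 u * T4 u))) (g ^ 4 * r ^ 12 * (- 5 * (1 + 2 * \<rho>) * w) * (0)) (g ^ 4 * r ^ 12 * (- 5 * (1 + 2 * \<rho>) * w) * (1)) (g ^ 4 * r ^ 12 * (- 5 * (1 + 2 * \<rho>) * w) * (5 / 2 + 2 * z1 - x1))"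
    by (rule jet_eq[OF m[OF c[of "r * p1"] m[OF j0 m[OF m[OF j2 j2] j4]]]]; (unfold coeffs)?; (unfold ps s)?; algebra)
  have J6: "jet (\<lambda>u. (- 5 * y) * (T0 u * (T1 u * (T3 u * T4 u)))) (g ^ 4 * r ^ 12 * (25 * \<rho> * w) * (0)) (g ^ 4 * r ^ 12 * (25 * \<rho> * w) * (1)) (g ^ 4 * r ^ 12 * (25 * \<rho> * w) * (5 / 2 - z1))"
    by (rule jet_eq[OF m[OF c[of "- 5 * y"] m[OF j0 m[OF j1 m[OF j3 j4]]]]]; (unfold coeffs)?; (unfold ps s)?; algebra)
  have K1: "jet (\<lambda>u. p3 * (T2 u * T3 u)) (g ^ 2 * r ^ 7 * (3 + \<rho>) * (1)) (g ^ 2 * r ^ 7 * (3 + \<rho>) * (0)) (g ^ 2 * r ^ 7 * (3 + \<rho>) * (2 * z2 - z1 ^ 2))"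
    by (rule jet_eq[OF m[OF c[of p3] m[OF j2 j3]]]; (unfold coeffs)?; (unfold ps s)?; algebra)
  have K2: "jet (\<lambda>u. (- p1) * (T1 u * T4 u)) (g ^ 2 * r ^ 7 * (- (1 + 2 * \<rho>)) * (1)) (g ^ 2 * r ^ 7 * (- (1 + 2 * \<rho>)) * (0)) (g ^ 2 * r ^ 7 * (- (1 + 2 * \<rho>)) * (2 * x2 - x1 ^ 2))"
    by (rule jet_eq[OF m[OF c[of "- p1"] m[OF j1 j4]]]; (unfold coeffs)?; (unfold ps s)?; algebra)
  have K3: "jet (\<lambda>u. 5 * y * (T0 u * T4 u)) (g ^ 2 * r ^ 7 * (- 25 * \<rho> * w) * (0)) (g ^ 2 * r ^ 7 * (- 25 * \<rho> * w) * (1)) (g ^ 2 * r ^ 7 * (- 25 * \<rho> * w) * (5 / 2 - x1))"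
    by (rule jet_eq[OF m[OF c[of "5 * y"] m[OF j0 j4]]]; (unfold coeffs)?; (unfold ps s)?; algebra)
  have K4: "jet (\<lambda>u. (- p2) * (T1 u * T3 u)) (g ^ 2 * r ^ 7 * (- (2 - \<rho>)) * (1)) (g ^ 2 * r ^ 7 * (- (2 - \<rho>)) * (x1 - z1)) (g ^ 2 * r ^ 7 * (- (2 - \<rho>)) * (x2 + z2 - x1 * z1))"
    by (rule jet_eq[OF m[OF c[of "- p2"] m[OF j1 j3]]]; (unfold coeffs)?; (unfold ps s)?; algebra)
  define CB where "CB = - 2 * (2 - \<rho>) * z1 - w * (15 * \<rho> + 5 * \<rho> ^ 2)"
  define CC where "CC = (2 - \<rho>) * (- (25 * (\<rho> * w ^ 2)) - 2 * x1 * z1) + w * (5 * (1 - 3 * \<rho>) * (5 / 2 - x1)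
      - 5 * \<rho> * (3 + \<rho>) * (- 5 / 2 + 2 * x1 + z1) - 5 * (1 + 2 * \<rho>) * (5 / 2 + 2 * z1 - x1) + 25 * \<rho> * (5 / 2 - z1))"
  define RB where "RB = - 25 * \<rho> * w - (2 - \<rho>) * (x1 - z1)"
  define RC where "RC = 25 * (\<rho> * w ^ 2) * (2 + 3 / 2 * \<rho>) - (2 - \<rho>) * ((x1 - z1) ^ 2 / 2) - 25 * \<rho> * w * (5 / 2 - x1)"
  have JC: "jet (\<lambda>u. p2 * r * (T1 u * T1 u * (T3 u * T4 u)) + (- p0) * (T0 u * (T2 u * (T3 u * T4 u)))
     + y * p3 / r * (exp ((- 5) * u) * (T0 u * (T1 u * T1 u * T2 u))) + (- p2 / r) * (T1 u * (T2 u * T2 u * T3 u))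
     + r * p1 * (T0 u * (T2 u * T2 u * T4 u)) + (- 5 * y) * (T0 u * (T1 u * (T3 u * T4 u)))) 0 (g ^ 4 * r ^ 12 * CB) (g ^ 4 * r ^ 12 * CC)"
    by (rule jet_eq[OF pl[OF pl[OF pl[OF pl[OF pl[OF J1 J2] J3] J4] J5] J6]]; (unfold CB_def CC_def R1[symmetric])?; algebra)
  have JR: "jet (\<lambda>u. p3 * (T2 u * T3 u) + (- p1) * (T1 u * T4 u) + 5 * y * (T0 u * T4 u) + (- p2) * (T1 u * T3 u)) 0 (g ^ 2 * r ^ 7 * RB) (g ^ 2 * r ^ 7 * RC)"
    by (rule jet_eq[OF pl[OF pl[OF pl[OF K1 K2] K3] K4]]; (unfold RB_def RC_def R1[symmetric])?; algebra)
  note JN = pl[OF m[OF jet_exp[of 1] JC] m[OF c[of "2 * al * be"] m[OF jet_exp[of 2] JR]]]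
  \<comment> \<open>This says that the coefficient of u^2 is 5/2 times that of u, once exp(u) and
    exp(2u) have added CB and 4 RB to CC + 2 RC.\<close>
  have key: "CC + 2 * RC = 3 / 2 * CB + RB"
    unfolding CC_def RC_def CB_def RB_def z1 x1 P_def by (simp add: field_simps power2_eq_square)
  show ?thesis
  proof (rule jet_scaled[OF JN], goal_cases)
    case 1
    show ?case by simp
  next
    case 2
    have "2 * al * be = 2 * g ^ 2 * r ^ 5" unfolding s by algebra
    with key show ?case by simp algebra
  qed
qed

context five_dissection
begin

section \<open>Three-term theta relations\<close>

lemma ty_nonzero: "t \<noteq> 0 \<Longrightarrow> (\<And>m. t * y powi m \<noteq> 1) \<Longrightarrow> ty t i \<noteq> 0"
  unfolding ty_def by (rule th_gen_nonzero)

text \<open>\<open>pf_2\<close> cleared of its denominator, with the theta constants named, so that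
  elimination between instances is polynomial.\<close>

lemma pf_2_scaled:
  assumes t: "t \<noteq> 0" "\<And>m. t * y powi m \<noteq> 1"
    and ij: "\<not> 5 dvd (j - i)" and s: "s = i + j - k"
    and A: "thy (k - i) / thy (j - i) = A" and B: "thy (k - j) / thy (i - j) = B"
  shows "J ^ 2 * ty t k = (A * lam_sum 1 t i (i - s) + B * lam_sum 1 t j (j - s)) * (ty t i * ty t j)"
proof -
  have "ty t i * ty t j \<noteq> 0" using ty_nonzero[OF t] by simp
  then show ?thesis using pf_2[OF t ij s] unfolding A B by (metis nonzero_divide_eq_eq)
qed

text \<open>In each of the following relations the same three level-one Lambert series occur in the partial fractions of three theta quotients,
  and eliminating them leaves the relation.\<close>

lemma weierstrass_1:
  assumes t: "t \<noteq> 0" "\<And>m. t * y powi m \<noteq> 1"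
  shows "ty t 2 * ty t 3 + (- (r ^ 2)) * (ty t 1 * ty t 4) = r * y * (1 / t * (ty t 0 * ty t 0))"
proof -
  define ir where "ir = 1 / r"
  have ir: "ir * r = 1" using r_nonzero by (simp add: ir_def)
  have e1: "J ^ 2 * ty t 3 = (r * lam_sum 1 t 0 (0 - (-2)) + (- y * r) * lam_sum 1 t 1 (1 - (-2))) * (ty t 0 * ty t 1)"
    by (rule pf_2_scaled[OF t]) (use y0 al_be_nonzero in \<open>simp_all add: thy_values r_def\<close>)
  have e2: "J ^ 2 * ty t 4 = (ir * lam_sum 1 t 0 (0 - (-2)) + (- (y ^ 2)) * lam_sum 1 t 2 (2 - (-2))) * (ty t 0 * ty t 2)"
    by (rule pf_2_scaled[OF t]) (use y0 al_be_nonzero in \<open>simp_all add: thy_values r_def ir_def\<close>)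
  have e3: "J ^ 2 * ty t 5 = (1 * lam_sum 1 t 1 (1 - (-2)) + (- y * r) * lam_sum 1 t 2 (2 - (-2))) * (ty t 1 * ty t 2)"
    by (rule pf_2_scaled[OF t]) (use y0 al_be_nonzero in \<open>simp_all add: thy_values r_def\<close>)
  have t5: "ty t 5 = - (1 / t) * ty t 0" using ty_shift[OF t(1), of 0] by simp
  have "J ^ 2 * (ir * (ty t 2 * ty t 3) - r * (ty t 1 * ty t 4) + y * (ty t 0 * ty t 5)) = 0"
    using e1 e2 e3 ir by algebra
  then have "ir * (ty t 2 * ty t 3) - r * (ty t 1 * ty t 4) + y * (ty t 0 * ty t 5) = 0" using J_nonzero by simp
  then show ?thesis using ir t5 by algebra
qed

lemma weierstrass_2:
  assumes t: "t \<noteq> 0" "\<And>m. t * y powi m \<noteq> 1"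
  shows "ty t 2 * ty t 2 + (- r) * (ty t 1 * ty t 3) = (- y / r) * (ty t 0 * ty t 4)"
proof -
  define ir where "ir = 1 / r"
  have ir: "ir * r = 1" using r_nonzero by (simp add: ir_def)
  have e1: "J ^ 2 * ty t 2 = (r * lam_sum 1 t 0 (0 - (-1)) + (- y) * lam_sum 1 t 1 (1 - (-1))) * (ty t 0 * ty t 1)"
    by (rule pf_2_scaled[OF t]) (use y0 al_be_nonzero in \<open>simp_all add: thy_values r_def\<close>)
  have e2: "J ^ 2 * ty t 3 = (1 * lam_sum 1 t 0 (0 - (-1)) + (- (y ^ 2) * ir) * lam_sum 1 t 2 (2 - (-1))) * (ty t 0 * ty t 2)"
    by (rule pf_2_scaled[OF t]) (use y0 al_be_nonzero in \<open>simp_all add: thy_values r_def ir_def\<close>)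
  have e3: "J ^ 2 * ty t 4 = (r * lam_sum 1 t 1 (1 - (-1)) + (- y * r) * lam_sum 1 t 2 (2 - (-1))) * (ty t 1 * ty t 2)"
    by (rule pf_2_scaled[OF t]) (use y0 al_be_nonzero in \<open>simp_all add: thy_values r_def\<close>)
  have "J ^ 2 * (ty t 2 * ty t 2 - r * (ty t 1 * ty t 3) + y * ir * (ty t 0 * ty t 4)) = 0"
    using e1 e2 e3 ir by algebra
  then have "ty t 2 * ty t 2 - r * (ty t 1 * ty t 3) + y * ir * (ty t 0 * ty t 4) = 0" using J_nonzero by simp
  then show ?thesis by (simp add: ir_def algebra_simps add_eq_0_iff)
qed

lemma weierstrass_3:
  assumes t: "t \<noteq> 0" "\<And>m. t * y powi m \<noteq> 1"
  shows "r * (ty t 1 * ty t 1) + (- 1) * (t * (ty t 3 * ty t 4)) = r ^ 2 * (ty t 0 * ty t 2)"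
proof -
  define ir iy where "ir = 1 / r" and "iy = 1 / y"
  have ir: "ir * r = 1" "iy * y = 1" using r_nonzero y0 by (simp_all add: ir_def iy_def)
  have e1: "J ^ 2 * ty t 1 = (ir * lam_sum 1 t 0 (0 - 2) + y * lam_sum 1 t 3 (3 - 2)) * (ty t 0 * ty t 3)"
    by (rule pf_2_scaled[OF t]) (use y0 al_be_nonzero in \<open>simp_all add: thy_values r_def ir_def eval_nat_numeral\<close>)
  have e2: "J ^ 2 * ty t 2 = (ir * lam_sum 1 t 1 (1 - 2) + (y * ir) * lam_sum 1 t 3 (3 - 2)) * (ty t 1 * ty t 3)"
    by (rule pf_2_scaled[OF t]) (use y0 al_be_nonzero in \<open>simp_all add: thy_values r_def ir_def eval_nat_numeral\<close>)
  \<comment> \<open>Index -1 stands for 4: with k = -1 the weights agree with those in e1 and e2,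
    and \<open>ty_shift\<close> converts the factor afterwards.\<close>
  have e3: "J ^ 2 * ty t (-1) = (- iy * lam_sum 1 t 0 (0 - 2) + (r * iy) * lam_sum 1 t 1 (1 - 2)) * (ty t 0 * ty t 1)"
    by (rule pf_2_scaled[OF t]) (use y0 al_be_nonzero in \<open>simp_all add: thy_values r_def iy_def eval_nat_numeral\<close>)
  have "ty t 4 = - ty t (-1) / (t * y powi (-1))" using ty_shift[OF t(1), of "-1"] by simp
  then have t4: "y * ty t (-1) = - (t * ty t 4)" using t y0 by (simp add: power_int_minus field_simps)
  have "J ^ 2 * (r * (ty t 1 * ty t 1) + y * ty t (-1) * ty t 3 - r ^ 2 * (ty t 0 * ty t 2)) = 0"
    using e1 e2 e3 ir by algebra
  then have "r * (ty t 1 * ty t 1) + y * ty t (-1) * ty t 3 - r ^ 2 * (ty t 0 * ty t 2) = 0" using J_nonzero by simp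
  then show ?thesis using t4 by algebra
qed

text \<open>\<open>p0\<close> to \<open>p3\<close>, followed by 5, are the coefficients in q of the
  product of r - x - x^2/r over the four other conjugates x = root5^k q, reduced by q^5 = y.\<close>

definition "p0 = r ^ 4 - 3 * y / r"
definition "p1 = r ^ 3 + 2 * y / r ^ 2"
definition "p2 = 2 * r ^ 2 - y / r ^ 3"
definition "p3 = 3 * r + y / r ^ 4"

text \<open>Each summand pairs a coefficient of the quartic cofactor with one of the split Lambert
  series so that the powers of q add up to 2 or 7, times the product of all five theta
  factors.\<close>

definition crank_num :: "complex \<Rightarrow> complex" where
  "crank_num t = p2 * r * (ty t 1 * ty t 1 * (ty t 3 * ty t 4)) + (- p0) * (ty t 0 * (ty t 2 * (ty t 3 * ty t 4)))
     + y * p3 / r * (1 / t * (ty t 0 * (ty t 1 * ty t 1 * ty t 2))) + (- p2 / r) * (ty t 1 * (ty t 2 * ty t 2 * ty t 3))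
     + r * p1 * (ty t 0 * (ty t 2 * ty t 2 * ty t 4)) + (- 5 * y) * (ty t 0 * (ty t 1 * (ty t 3 * ty t 4)))"

definition rank_num :: "complex \<Rightarrow> complex" where
  "rank_num t = p3 * (ty t 2 * ty t 3) + (- p1) * (ty t 1 * ty t 4) + 5 * y * (ty t 0 * ty t 4) + (- p2) * (ty t 1 * ty t 3)"

text \<open>For the denominator the ratio 5/2 is a symmetry: u -> -u multiplies it by -exp(-5u).
  That the numerator has the same ratio is the content of
  \<open>crank_rank_numerator_jet\<close>.\<close>

lemma numerator_jet:
  "(\<exists>n. jet (\<lambda>u. exp (1 * u) * crank_num (exp (5 * u)) + 2 * al * be * (exp (2 * u) * rank_num (exp (5 * u)))) 0 n (5 / 2 * n))
   \<and> (\<exists>D. D \<noteq> 0 \<and> jet (\<lambda>u. ty (exp (5 * u)) 0 * (ty (exp (5 * u)) 1 * (ty (exp (5 * u)) 2 * (ty (exp (5 * u)) 3 * ty (exp (5 * u)) 4)))) 0 D (5 / 2 * D))"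
proof -
  obtain x1 x2 z1 z2 where
    j0: "jet (\<lambda>u. ty (exp (5 * u)) 0) 0 (- 5 * J ^ 2) (- 25 / 2 * J ^ 2)" and
    j1: "jet (\<lambda>u. ty (exp (5 * u)) 1) al (al * x1) (al * x2)" and
    j2: "jet (\<lambda>u. ty (exp (5 * u)) 2) be (be * z1) (be * z2)" and
    j3: "jet (\<lambda>u. ty (exp (5 * u)) 3) be (- be * z1) (be * z2)" and
    j4: "jet (\<lambda>u. ty (exp (5 * u)) 4) al (- al * x1) (al * x2)"
    by (rule jets_ty)
  note m = jet_mult
  have inv: "1 / exp (5 * u) = exp ((- 5) * u)" for u :: complex by (simp add: exp_minus divide_inverse)
  have t0: "exp (5 * u) \<noteq> 0" for u :: complex by simp
  have W1: "\<forall>\<^sub>F u in at 0. ty (exp (5 * u)) 2 * ty (exp (5 * u)) 3 + (- (r ^ 2)) * (ty (exp (5 * u)) 1 * ty (exp (5 * u)) 4)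
      = r * y * (exp ((- 5) * u) * (ty (exp (5 * u)) 0 * ty (exp (5 * u)) 0))"
    using generic_near_1 by eventually_elim (use weierstrass_1[OF t0] inv in metis)
  have W2: "\<forall>\<^sub>F u in at 0. ty (exp (5 * u)) 2 * ty (exp (5 * u)) 2 + (- r) * (ty (exp (5 * u)) 1 * ty (exp (5 * u)) 3)
      = (- y / r) * (ty (exp (5 * u)) 0 * ty (exp (5 * u)) 4)"
    using generic_near_1 by eventually_elim (use weierstrass_2[OF t0] in metis)
  have W3: "\<forall>\<^sub>F u in at 0. r * (ty (exp (5 * u)) 1 * ty (exp (5 * u)) 1) + (- 1) * (exp (5 * u) * (ty (exp (5 * u)) 3 * ty (exp (5 * u)) 4))
      = r ^ 2 * (ty (exp (5 * u)) 0 * ty (exp (5 * u)) 2)"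
    using generic_near_1 by eventually_elim (use weierstrass_3[OF t0] in metis)
  have 1: "\<exists>n. jet (\<lambda>u. exp (1 * u) * crank_num (exp (5 * u)) + 2 * al * be * (exp (2 * u) * rank_num (exp (5 * u)))) 0 n (5 / 2 * n)"
    unfolding crank_num_def rank_num_def inv
    by (rule crank_rank_numerator_jet[OF j0 j1 j2 j3 j4 W1 W2 W3 r_nonzero al_be_nonzero(1) be_eq p0_def p1_def p2_def p3_def])
  note JD = m[OF j0 m[OF j1 m[OF j2 m[OF j3 j4]]]]
  have "jet (\<lambda>u. ty (exp (5 * u)) 0 * (ty (exp (5 * u)) 1 * (ty (exp (5 * u)) 2 * (ty (exp (5 * u)) 3 * ty (exp (5 * u)) 4)))) 0
     (- 5 * J ^ 2 * (al ^ 2 * be ^ 2)) (5 / 2 * (- 5 * J ^ 2 * (al ^ 2 * be ^ 2)))"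
    using JD by (simp add: algebra_simps power2_eq_square)
  moreover have "- 5 * J ^ 2 * (al ^ 2 * be ^ 2) \<noteq> 0" using J_nonzero al_be_nonzero by simp
  ultimately show ?thesis using 1 by blast
qed

end

section \<open>Fifth roots of unity\<close>

definition root5 :: complex where
  "root5 = exp (2 * of_real pi * \<i> * of_nat 1 / of_nat 5)"

lemma root5_power: "root5 ^ n = exp (2 * of_real pi * \<i> * of_nat n / of_nat 5)"
  unfolding root5_def exp_of_nat_mult[symmetric] by (simp add: mult_ac)

lemma root5_power_eq_1: "root5 ^ n = 1 \<longleftrightarrow> n mod 5 = 0"
  unfolding root5_power using complex_root_unity_eq_1[of 5 n] by (simp add: dvd_eq_mod_eq_0)

lemma root5_power_5: "(root5 ^ j) ^ 5 = 1"
  unfolding power_mult[symmetric] root5_power_eq_1 by simp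

lemma root5_nonzero [simp]: "root5 \<noteq> 0"
  by (simp add: root5_def)

lemma norm_unity5: "w ^ 5 = 1 \<Longrightarrow> norm (w :: complex) = 1"
  by (metis norm_one norm_power norm_ge_zero power_eq_1_iff zero_neq_numeral)

lemma norm_root5 [simp]: "norm root5 = 1"
  using norm_unity5[of "root5 ^ 1"] root5_power_5[of 1] by simp

lemma root5_sum: "(\<Sum>j<5. (root5 ^ j) ^ n) = (if n mod 5 = 0 then 5 else 0)"
proof -
  have e: "(root5 ^ j) ^ n = (root5 ^ n) ^ j" for j by (metis power_mult mult.commute)
  show ?thesis
  proof (cases "n mod 5 = 0")
    case True
    then have "root5 ^ n = 1" by (simp add: root5_power_eq_1)
    then show ?thesis using True by (simp add: e)
  next
    case False
    then have "root5 ^ n \<noteq> 1" by (simp add: root5_power_eq_1)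
    then show ?thesis using False unfolding e by (simp add: geometric_sum root5_power_5)
  qed
qed

lemma unity5_powi:
  fixes w :: complex
  assumes "w ^ 5 = 1"
  shows "w powi m = w ^ nat (m mod 5)"
proof -
  have w: "w \<noteq> 0" using assms by auto
  have "w powi m = w powi (5 * (m div 5) + m mod 5)" by simp
  also have "\<dots> = (w powi 5) powi (m div 5) * w powi (m mod 5)" by (subst power_int_add) (use w in \<open>simp_all add: power_int_mult\<close>)
  also have "w powi 5 = 1" using assms by (simp add: power_int_def)
  finally show ?thesis by (simp add: power_int_def)
qed

lemma root5_sum_powi: "(\<Sum>j<5. (root5 ^ j) ^ k * (root5 ^ j) powi m) = (if (int k + m) mod 5 = 0 then 5 else 0)"
proof -
  have "(\<Sum>j<5. (root5 ^ j) ^ k * (root5 ^ j) powi m) = (\<Sum>j<5. (root5 ^ j) ^ (k + nat (m mod 5)))"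
    by (simp add: unity5_powi[OF root5_power_5] power_add)
  moreover have "(k + nat (m mod 5)) mod 5 = 0 \<longleftrightarrow> (int k + m) mod 5 = 0"
  proof -
    have "int (k + nat (m mod 5)) mod 5 = (int k + m) mod 5" by (simp add: mod_simps)
    moreover have "N mod 5 = 0 \<longleftrightarrow> int N mod 5 = 0" for N by presburger
    ultimately show ?thesis by (simp only:)
  qed
  ultimately show ?thesis by (simp add: root5_sum)
qed

text \<open>The weight (root5^k)^3 keeps the exponents n with n + 3 divisible by 5, here 2 and 7.
  Degree 8 is that of a product of two quartics.\<close>

lemma root5_extract:
  fixes a0 :: complex
  shows "(\<Sum>k<5. (root5 ^ k) ^ 3 * (a0 + a1 * (root5 ^ k * q) + a2 * (root5 ^ k * q) ^ 2 + a3 * (root5 ^ k * q) ^ 3 + a4 * (root5 ^ k * q) ^ 4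
     + a5 * (root5 ^ k * q) ^ 5 + a6 * (root5 ^ k * q) ^ 6 + a7 * (root5 ^ k * q) ^ 7 + a8 * (root5 ^ k * q) ^ 8)) = 5 * (a2 * q ^ 2 + a7 * q ^ 7)"
proof -
  have e: "w ^ 3 * (a0 + a1 * (w * q) + a2 * (w * q) ^ 2 + a3 * (w * q) ^ 3 + a4 * (w * q) ^ 4
     + a5 * (w * q) ^ 5 + a6 * (w * q) ^ 6 + a7 * (w * q) ^ 7 + a8 * (w * q) ^ 8) =
     a0 * w ^ 3 + (a1 * q) * w ^ 4 + (a2 * q ^ 2) * w ^ 5 + (a3 * q ^ 3) * w ^ 6 + (a4 * q ^ 4) * w ^ 7
     + (a5 * q ^ 5) * w ^ 8 + (a6 * q ^ 6) * w ^ 9 + (a7 * q ^ 7) * w ^ 10 + (a8 * q ^ 8) * w ^ 11" for w :: complex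
    by algebra
  show ?thesis unfolding e sum.distrib sum_distrib_left[symmetric] root5_sum by simp
qed

text \<open>For a fifth root of unity w, the factor 1 + wx + ... + (wx)^4 turns the denominator into
  1 - x^5. The weights w^4 and w^3 then pick the coefficients of w and w^2 in the numerator.\<close>

lemma root5_filter:
  fixes x a :: complex
  assumes x: "x ^ 5 \<noteq> 1"
  shows "(\<Sum>j<5. (root5 ^ j) ^ 4 * ((1 - root5 ^ j * a) / (1 - root5 ^ j * x))) = 5 * (x - a) / (1 - x ^ 5)"
    and "(\<Sum>j<5. (root5 ^ j) ^ 3 * ((1 - root5 ^ j * a) / (1 - root5 ^ j * x))) = 5 * (x ^ 2 - a * x) / (1 - x ^ 5)"
proof -
  have g: "(1 - w * a) / (1 - w * x) = (1 - w * a) * (1 + w * x + (w * x) ^ 2 + (w * x) ^ 3 + (w * x) ^ 4) / (1 - x ^ 5)"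
    if w: "w ^ 5 = 1" for w
  proof -
    have "1 - x ^ 5 = (1 - w * x) * (1 + w * x + (w * x) ^ 2 + (w * x) ^ 3 + (w * x) ^ 4)" using w by algebra
    moreover have "1 - x ^ 5 \<noteq> 0" using x by simp
    ultimately show ?thesis by simp
  qed
  note g' = g[OF root5_power_5]
  have e4: "w ^ 4 * ((1 - w * a) * (1 + w * x + (w * x) ^ 2 + (w * x) ^ 3 + (w * x) ^ 4) / c) =
    1 / c * w ^ 4 + (x - a) / c * w ^ 5 + (x ^ 2 - a * x) / c * w ^ 6 + (x ^ 3 - a * x ^ 2) / c * w ^ 7 + (x ^ 4 - a * x ^ 3) / c * w ^ 8
      + (- a * x ^ 4) / c * w ^ 9" for w c :: complex
    unfolding divide_inverse by algebra
  have e3: "w ^ 3 * ((1 - w * a) * (1 + w * x + (w * x) ^ 2 + (w * x) ^ 3 + (w * x) ^ 4) / c) =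
    1 / c * w ^ 3 + (x - a) / c * w ^ 4 + (x ^ 2 - a * x) / c * w ^ 5 + (x ^ 3 - a * x ^ 2) / c * w ^ 6 + (x ^ 4 - a * x ^ 3) / c * w ^ 7
      + (- a * x ^ 4) / c * w ^ 8" for w c :: complex
    unfolding divide_inverse by algebra
  show "(\<Sum>j<5. (root5 ^ j) ^ 4 * ((1 - root5 ^ j * a) / (1 - root5 ^ j * x))) = 5 * (x - a) / (1 - x ^ 5)"
    unfolding g' e4 sum.distrib sum_distrib_left[symmetric] root5_sum by simp
  show "(\<Sum>j<5. (root5 ^ j) ^ 3 * ((1 - root5 ^ j * a) / (1 - root5 ^ j * x))) = 5 * (x ^ 2 - a * x) / (1 - x ^ 5)"
    unfolding g' e3 sum.distrib sum_distrib_left[symmetric] root5_sum by simp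
qed

section \<open>Derivatives of the rank and crank generating functions\<close>

lemma lam_eq: "lam q x * qinf x q = x * deriv (\<lambda>x. qinf x q) x" if "qinf x q \<noteq> 0"
  using that by (simp add: lam_def)

lemma qinf_unit_nonzero:
  assumes "norm q < 1" "norm x = 1"
  shows "qinf (x * q) q \<noteq> 0"
proof (rule qinf_nonzero[OF assms(1)])
  fix k
  have "norm (x * q * q ^ k) < 1" using norm_power_Suc_less_1[OF assms(1), of k] assms(2) by (simp add: norm_mult)
  then show "x * q * q ^ k \<noteq> 1" by auto
qed

lemma crank_prod_deriv:
  assumes q: "norm q < 1" and x: "norm x = 1"
  shows "((\<lambda>u. crank_prod q (x * exp u)) has_field_derivative crank_prod q x * (lam q (q / x) - lam q (x * q))) (at 0)"
proof -
  have x0: "x \<noteq> 0" using x by auto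
  have n1: "qinf (x * q) q \<noteq> 0" by (rule qinf_unit_nonzero[OF q x])
  have "norm (inverse x) = 1" using x by (simp add: norm_inverse)
  from qinf_unit_nonzero[OF q this] have n2: "qinf (q / x) q \<noteq> 0" by (simp add: divide_inverse mult.commute)
  define P where "P = (\<lambda>x. qinf x q)"
  define P' where "P' = deriv P"
  have dP: "(P has_field_derivative P' v) (at v)" for v unfolding P_def P'_def by (rule qinf_deriv[OF q])
  have a: "((\<lambda>u. P (x * exp u * q)) has_field_derivative P' (x * q) * (x * q)) (at 0)"
    by (rule DERIV_chain2[of P]) (use dP[of "x * q"] in \<open>auto intro!: derivative_eq_intros\<close>)
  have b: "((\<lambda>u. P (q / (x * exp u))) has_field_derivative P' (q / x) * (- (q / x))) (at 0)"
    by (rule DERIV_chain2[of P]) (use dP[of "q / x"] x0 in \<open>auto intro!: derivative_eq_intros simp: power2_eq_square divide_simps\<close>)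
  have c: "((\<lambda>u. P (x * exp u * q) * P (q / (x * exp u))) has_field_derivative
      P' (x * q) * (x * q) * P (q / x) + P' (q / x) * (- (q / x)) * P (x * q)) (at 0)"
    using DERIV_mult[OF a b] by simp
  have d: "((\<lambda>u. qinf q q / (P (x * exp u * q) * P (q / (x * exp u)))) has_field_derivative
      - (qinf q q * (P' (x * q) * (x * q) * P (q / x) + P' (q / x) * (- (q / x)) * P (x * q))) / (P (x * q) * P (q / x)) ^ 2) (at 0)"
    using DERIV_divide[OF DERIV_const c, of "qinf q q"] n1 n2 by (simp add: P_def power2_eq_square)
  have l: "x * q * P' (x * q) = lam q (x * q) * P (x * q)" "q / x * P' (q / x) = lam q (q / x) * P (q / x)"
    using lam_eq[OF n1] lam_eq[OF n2] by (simp_all add: P_def P'_def)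
  have "- (qinf q q * (P' (x * q) * (x * q) * P (q / x) + P' (q / x) * (- (q / x)) * P (x * q))) / (P (x * q) * P (q / x)) ^ 2
    = - (qinf q q * ((x * q * P' (x * q)) * P (q / x) - (q / x * P' (q / x)) * P (x * q))) / (P (x * q) * P (q / x)) ^ 2"
    by (simp add: mult_ac)
  also have "\<dots> = qinf q q / (P (x * q) * P (q / x)) * (lam q (q / x) - lam q (x * q))"
    unfolding l using n1 n2 by (simp add: P_def field_simps power2_eq_square)
  finally show ?thesis using d by (simp add: crank_prod_def P_def)
qed

lemma crank_prod_analytic:
  assumes q: "norm q < 1" and x: "norm x = 1"
  shows "(\<lambda>u. crank_prod q (x * exp u)) analytic_on {0}"
proof -
  have x0: "x \<noteq> 0" using x by auto
  have n1: "qinf (x * q) q \<noteq> 0" by (rule qinf_unit_nonzero[OF q x])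
  have "norm (inverse x) = 1" using x by (simp add: norm_inverse)
  from qinf_unit_nonzero[OF q this] have n2: "qinf (q / x) q \<noteq> 0" by (simp add: divide_inverse mult.commute)
  have a: "(\<lambda>u. qinf (x * exp u * q) q) holomorphic_on UNIV"
    by (intro holomorphic_intros q)
  have b: "(\<lambda>u. qinf (q / (x * exp u)) q) holomorphic_on UNIV"
    by (intro holomorphic_intros q) (use x0 in auto)
  have "(\<lambda>u. qinf (x * exp u * q) q) analytic_on {0}" "(\<lambda>u. qinf (q / (x * exp u)) q) analytic_on {0}"
    using a b analytic_on_open[OF open_UNIV] analytic_on_subset by blast+
  then show ?thesis unfolding crank_prod_def
    by (intro analytic_intros) (use n1 n2 in auto)
qed

text \<open>Difference of \<open>crank_gf\<close> at 1/x and at x: \<open>crank_prod\<close> is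
  symmetric and the terms at q^2 cancel, so what remains is the derivative found in
  \<open>crank_prod_deriv\<close>.\<close>

lemma crank_deriv_sums:
  assumes q: "norm q < 1" "q \<noteq> 0" and x: "norm x = 1"
  shows "(\<lambda>n. (\<Sum>\<pi>\<in>partitions n. of_nat (num_ones \<pi>) * (x powi (- partition_crank \<pi>) - x powi partition_crank \<pi>)) * q ^ n)
    sums (crank_prod q x * (lam q (q / x) - lam q (x * q)))"
proof (rule partition_series)
  have "norm (inverse x) = 1" using x by (simp add: norm_inverse)
  from crank_gf[OF q this]
  have "((\<lambda>\<pi>. of_nat (num_ones \<pi>) * x powi (- partition_crank \<pi>) * q ^ sum_mset \<pi>) has_sum
     crank_prod q x * (lam q (q * q) - lam q (x * q))) (msets {0<..})"
    by (simp add: crank_prod_def divide_inverse mult_ac power_int_minus power_int_inverse)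
  from has_sum_add[OF this has_sum_cmult_right[OF crank_gf[OF q x], of "- 1"]]
  show "((\<lambda>\<pi>. of_nat (num_ones \<pi>) * (x powi (- partition_crank \<pi>) - x powi partition_crank \<pi>) * q ^ sum_mset \<pi>) has_sum
     crank_prod q x * (lam q (q / x) - lam q (x * q))) (msets {0<..})"
    by (simp add: algebra_simps)
qed

lemma powi_annulus_bound:
  fixes x :: complex
  assumes "1 < \<rho>" "1 / \<rho> < norm x" "norm x < \<rho>"
  shows "norm (x powi m) \<le> \<rho> powi m + \<rho> powi (- m)"
proof (cases "m \<ge> 0")
  case True
  then have "norm (x powi m) \<le> \<rho> powi m" using assms by (simp add: norm_power power_int_def power_mono)
  then show ?thesis using assms zero_le_power_int[of \<rho> "- m"] by linarith
next
  case False
  have x: "norm x > 0" using assms by (meson divide_pos_pos less_trans zero_less_one)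
  have "norm (x powi m) = inverse (norm x) ^ nat (- m)" using False by (simp add: norm_power norm_inverse power_int_def)
  also have "\<dots> \<le> \<rho> ^ nat (- m)"
    using assms x by (intro power_mono) (auto simp: field_simps)
  also have "\<dots> = \<rho> powi (- m)" using False by (simp add: power_int_def)
  finally show ?thesis using assms zero_le_power_int[of \<rho> m] by linarith
qed

text \<open>Termwise differentiation on the annulus 1/\<rho> < |x| < \<rho>. The majorant is the
  rank series of base |q| at \<rho> plus that at 1/\<rho>; both converge because \<rho> |q| <
  1.\<close>

lemma rank_series_deriv:
  assumes q: "norm q < 1" "q \<noteq> 0"
  shows "\<exists>S D. open S \<and> {x. norm x = 1} \<subseteq> S \<and> (\<forall>x\<in>S. ((\<lambda>x. durf q (1 / x) x) has_field_derivative D x) (at x) \<and>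
     (\<lambda>n. (\<Sum>\<pi>\<in>partitions n. of_int (partition_rank \<pi>) * x powi (partition_rank \<pi> - 1)) * q ^ n) sums D x)"
proof -
  define \<rho> where "\<rho> = (1 + 1 / norm q) / 2"
  have "1 < (1 + s) / 2 \<and> (1 + s) / 2 < s" if "1 < s" for s :: real using that by auto
  moreover have "1 < 1 / norm q" using q by (simp add: field_simps)
  ultimately have \<rho>: "1 < \<rho>" "\<rho> < 1 / norm q" unfolding \<rho>_def by auto
  have \<rho>q: "\<rho> * norm q < 1" using \<rho>(2) q by (simp add: field_simps)
  have q\<rho>: "norm q < 1 / \<rho>" using \<rho>q \<rho>(1) by (simp add: field_simps)
  define S where "S = {x::complex. 1 / \<rho> < norm x \<and> norm x < \<rho>}"
  have oS: "open S" unfolding S_def by (intro open_Collect_conj open_Collect_less continuous_intros)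
  have x0: "x \<noteq> 0" if "x \<in> S" for x using that \<rho> by (auto simp: S_def)
  define f where "f = (\<lambda>n x. (\<Sum>\<pi>\<in>partitions n. x powi partition_rank \<pi>) * q ^ n)"
  define f' where "f' = (\<lambda>n x. (\<Sum>\<pi>\<in>partitions n. of_int (partition_rank \<pi>) * x powi (partition_rank \<pi> - 1)) * q ^ n)"
  have df: "(f n has_field_derivative f' n x) (at x)" if "x \<in> S" for n x
    unfolding f_def f'_def using x0[OF that]
    by (auto intro!: derivative_eq_intros sum.cong simp: sum_distrib_right)
  define h where "h = (\<lambda>n. (\<Sum>\<pi>\<in>partitions n. complex_of_real (\<rho> powi partition_rank \<pi> + \<rho> powi (- partition_rank \<pi>))) * of_real (norm q) ^ n)"
  have sh: "summable h"
  proof -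
    define r where "r = complex_of_real (norm q)"
    have r: "norm r < 1" "r \<noteq> 0" using q by (auto simp: r_def)
    have z1: "norm r < norm (complex_of_real \<rho>)" "norm (complex_of_real \<rho> * r) < 1"
      using \<rho> \<rho>q q by (auto simp: r_def norm_mult)
    have z2: "norm r < norm (complex_of_real (1 / \<rho>))" "norm (complex_of_real (1 / \<rho>) * r) < 1"
      using \<rho> q\<rho> q by (auto simp: r_def norm_mult norm_divide field_simps)
    have "((\<lambda>\<pi>. complex_of_real (\<rho> powi partition_rank \<pi> + \<rho> powi (- partition_rank \<pi>)) * r ^ sum_mset \<pi>) has_sum
      (durf r (1 / complex_of_real \<rho>) (complex_of_real \<rho>) + durf r (1 / complex_of_real (1 / \<rho>)) (complex_of_real (1 / \<rho>)))) (msets {0<..})"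
      using has_sum_add[OF rank_gf(2)[OF r z1] rank_gf(2)[OF r z2]]
      by (simp add: ring_distribs power_int_minus power_int_inverse divide_inverse of_real_power_int)
    from partition_series[OF this] show ?thesis unfolding h_def r_def by (rule sums_summable)
  qed
  have hr: "h n = complex_of_real ((\<Sum>\<pi>\<in>partitions n. \<rho> powi partition_rank \<pi> + \<rho> powi (- partition_rank \<pi>)) * norm q ^ n)" for n
    by (simp add: h_def)
  have hn: "(\<Sum>\<pi>\<in>partitions n. \<rho> powi partition_rank \<pi> + \<rho> powi (- partition_rank \<pi>)) * norm q ^ n \<ge> 0" for n
    using \<rho> by (intro mult_nonneg_nonneg sum_nonneg add_nonneg_nonneg zero_le_power_int) auto
  have bd: "norm (f n x) \<le> norm (h n)" if "x \<in> S" for n x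
  proof -
    have "norm (f n x) \<le> (\<Sum>\<pi>\<in>partitions n. norm (x powi partition_rank \<pi>)) * norm q ^ n"
      unfolding f_def norm_mult norm_power by (intro mult_right_mono norm_sum) auto
    also have "\<dots> \<le> (\<Sum>\<pi>\<in>partitions n. \<rho> powi partition_rank \<pi> + \<rho> powi (- partition_rank \<pi>)) * norm q ^ n"
      using that \<rho>(1) by (intro mult_right_mono sum_mono powi_annulus_bound) (auto simp: S_def)
    also have "\<dots> = norm (h n)" unfolding hr norm_of_real using hn[of n] by simp
    finally show ?thesis .
  qed
  have "h n \<in> \<real>\<^sub>\<ge>\<^sub>0" for n unfolding hr nonneg_Reals_of_real_iff by (rule hn)
  then have "range h \<subseteq> \<real>\<^sub>\<ge>\<^sub>0" by blast
  then have hyp: "\<exists>d (k :: nat \<Rightarrow> complex). 0 < d \<and> summable k \<and> range k \<subseteq> \<real>\<^sub>\<ge>\<^sub>0 \<and> (\<forall>\<^sub>F n in sequentially. \<forall>y\<in>ball x d \<inter> S. norm (f n y) \<le> norm (k n))" if "x \<in> S" for x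
    using sh bd by (intro exI[of _ "1 :: real"] exI[of _ h]) auto
  obtain g g' where g: "\<forall>x\<in>S. ((\<lambda>n. f n x) sums g x) \<and> ((\<lambda>n. f' n x) sums g' x) \<and> (g has_field_derivative g' x) (at x)"
    using series_and_derivative_comparison_complex[of S f f', OF oS df hyp] by blast
  have gd: "g x = durf q (1 / x) x" if "x \<in> S" for x
  proof -
    have "1 / \<rho> < norm x" "norm x < \<rho>" using that by (auto simp: S_def)
    moreover from this have "norm x * norm q < \<rho> * norm q" using q by (intro mult_strict_right_mono) auto
    ultimately have "norm q < norm x" "norm (x * q) < 1" using q\<rho> \<rho>q by (auto simp: norm_mult)
    from partition_series[OF rank_gf(2)[OF q this]] g that show ?thesis
      unfolding f_def using sums_unique2 by blast
  qed
  have "((\<lambda>x. durf q (1 / x) x) has_field_derivative g' x) (at x)" if "x \<in> S" for x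
    by (rule has_field_derivative_transform_within_open[of g _ _ S]) (use g oS gd that in auto)
  moreover have "{x. norm x = 1} \<subseteq> S" using \<rho> by (auto simp: S_def)
  ultimately show ?thesis using oS g unfolding f'_def by (intro exI[of _ S] exI[of _ g']) auto
qed

lemma has_sum_sum_lessThan:
  fixes f :: "nat \<Rightarrow> 'a \<Rightarrow> complex"
  assumes "\<And>j. j < n \<Longrightarrow> (f j has_sum s j) A"
  shows "((\<lambda>x. \<Sum>j<n. f j x) has_sum (\<Sum>j<n. s j)) A"
  using assms by (induction n) (auto intro!: has_sum_add)

lemma rank_part_deriv:
  assumes q: "norm q < 1" "q \<noteq> 0" and x: "norm x = 1"
  shows "\<exists>D. ((\<lambda>u. durf q (1 / (x * exp u)) (x * exp u)) has_field_derivative D) (at 0) \<and>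
    (\<lambda>u. durf q (1 / (x * exp u)) (x * exp u)) analytic_on {0} \<and>
    (\<lambda>n. (\<Sum>\<pi>\<in>partitions n. of_int (partition_rank \<pi>) * x powi partition_rank \<pi>) * q ^ n) sums D"
proof -
  obtain S D where SD: "open S \<and> {x. norm x = 1} \<subseteq> S \<and> (\<forall>x\<in>S. ((\<lambda>x. durf q (1 / x) x) has_field_derivative D x) (at x) \<and>
     (\<lambda>n. (\<Sum>\<pi>\<in>partitions n. of_int (partition_rank \<pi>) * x powi (partition_rank \<pi> - 1)) * q ^ n) sums D x)"
    using rank_series_deriv[OF q] by (elim exE) (rule that)
  then have S: "open S" "{x. norm x = 1} \<subseteq> S"
    and D: "\<And>x. x \<in> S \<Longrightarrow> ((\<lambda>x. durf q (1 / x) x) has_field_derivative D x) (at x)"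
      "\<And>x. x \<in> S \<Longrightarrow> (\<lambda>n. (\<Sum>\<pi>\<in>partitions n. of_int (partition_rank \<pi>) * x powi (partition_rank \<pi> - 1)) * q ^ n) sums D x"
    by simp_all
  have xS: "x \<in> S" using S x by auto
  have x0: "x \<noteq> 0" using x by auto
  have a: "((\<lambda>u. durf q (1 / (x * exp u)) (x * exp u)) has_field_derivative D x * x) (at 0)"
    by (rule DERIV_chain2[of "\<lambda>x. durf q (1 / x) x"]) (use D(1)[OF xS] in \<open>auto intro!: derivative_eq_intros\<close>)
  define U where "U = (\<lambda>u. x * exp u) -` S"
  have U: "open U" unfolding U_def by (intro open_vimage S continuous_intros)
  have "(\<lambda>x. durf q (1 / x) x) holomorphic_on S"
    using D(1) S(1) by (auto simp: holomorphic_on_open)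
  moreover have "(\<lambda>u. x * exp u) holomorphic_on U" by (intro holomorphic_intros)
  moreover have "(\<lambda>u. x * exp u) ` U \<subseteq> S" by (auto simp: U_def)
  ultimately have "((\<lambda>x. durf q (1 / x) x) \<circ> (\<lambda>u. x * exp u)) holomorphic_on U"
    by (intro holomorphic_on_compose_gen)
  then have "(\<lambda>u. durf q (1 / (x * exp u)) (x * exp u)) holomorphic_on U" by (simp add: o_def)
  then have b: "(\<lambda>u. durf q (1 / (x * exp u)) (x * exp u)) analytic_on {0}"
    unfolding analytic_on_open[OF U, symmetric] by (rule analytic_on_subset) (use xS in \<open>simp add: U_def\<close>)
  have "x powi (m - 1) * x = x powi m" for m using x0 by (simp add: power_int_diff)
  then have e: "of_int m * x powi (m - 1) * x = of_int m * x powi m" for m by (simp only: mult.assoc)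
  have "(\<lambda>n. ((\<Sum>\<pi>\<in>partitions n. of_int (partition_rank \<pi>) * x powi (partition_rank \<pi> - 1)) * q ^ n) * x) sums (D x * x)"
    by (rule sums_mult2[OF D(2)[OF xS]])
  moreover have "((\<Sum>\<pi>\<in>partitions n. of_int (partition_rank \<pi>) * x powi (partition_rank \<pi> - 1)) * q ^ n) * x
     = (\<Sum>\<pi>\<in>partitions n. of_int (partition_rank \<pi>) * x powi partition_rank \<pi>) * q ^ n" for n
  proof -
    have "((\<Sum>\<pi>\<in>partitions n. of_int (partition_rank \<pi>) * x powi (partition_rank \<pi> - 1)) * q ^ n) * x
      = ((\<Sum>\<pi>\<in>partitions n. of_int (partition_rank \<pi>) * x powi (partition_rank \<pi> - 1)) * x) * q ^ n"
      by (simp only: mult_ac)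
    then show ?thesis by (simp only: sum_distrib_right[of _ _ x] e)
  qed
  ultimately have "(\<lambda>n. (\<Sum>\<pi>\<in>partitions n. of_int (partition_rank \<pi>) * x powi partition_rank \<pi>) * q ^ n) sums (D x * x)" by simp
  then show ?thesis using a b by blast
qed

text \<open>For n > 0, the right side of the claim minus the left, with NT 3 - NT 2 already replaced
  by the sum of ranks.\<close>

definition coef :: "nat \<Rightarrow> int" where
  "coef n = M_omega 4 5 n - M_omega 1 5 n
     + 2 * (\<Sum>\<pi> | \<pi> \<in> partitions n \<and> [partition_rank \<pi> = 2] (mod 5). partition_rank \<pi>)"

lemma root5_filter_crank:
  "(\<Sum>j<5. (root5 ^ j) ^ 4 * (\<Sum>\<pi>\<in>partitions n. of_nat (num_ones \<pi>) * ((root5 ^ j) powi (- partition_crank \<pi>) - (root5 ^ j) powi partition_crank \<pi>)))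
    = 5 * of_int (M_omega 4 5 n - M_omega 1 5 n)"
proof -
  have "(\<Sum>j<5. (root5 ^ j) ^ 4 * (\<Sum>\<pi>\<in>partitions n. of_nat (num_ones \<pi>) * ((root5 ^ j) powi (- partition_crank \<pi>) - (root5 ^ j) powi partition_crank \<pi>)))
    = (\<Sum>\<pi>\<in>partitions n. \<Sum>j<5. (root5 ^ j) ^ 4 * (of_nat (num_ones \<pi>) * ((root5 ^ j) powi (- partition_crank \<pi>) - (root5 ^ j) powi partition_crank \<pi>)))"
    unfolding sum_distrib_left by (rule sum.swap)
  also have "\<dots> = (\<Sum>\<pi>\<in>partitions n. of_nat (num_ones \<pi>) * ((\<Sum>j<5. (root5 ^ j) ^ 4 * (root5 ^ j) powi (- partition_crank \<pi>))
      - (\<Sum>j<5. (root5 ^ j) ^ 4 * (root5 ^ j) powi partition_crank \<pi>)))"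
    by (simp add: sum_subtractf[symmetric] sum_distrib_left algebra_simps)
  also have "\<dots> = (\<Sum>\<pi>\<in>partitions n. 5 * (if [partition_crank \<pi> = 4] (mod 5) then of_nat (num_ones \<pi>) else 0)
      - 5 * (if [partition_crank \<pi> = 1] (mod 5) then of_nat (num_ones \<pi>) else 0))"
  proof (rule sum.cong[OF refl])
    fix \<pi>
    have "(4 - c) mod 5 = 0 \<longleftrightarrow> c mod 5 = 4" for c :: int by presburger
    moreover have "(4 + c) mod 5 = 0 \<longleftrightarrow> c mod 5 = 1" for c :: int by presburger
    ultimately have "(int 4 + - partition_crank \<pi>) mod 5 = 0 \<longleftrightarrow> [partition_crank \<pi> = 4] (mod 5)"
      "(int 4 + partition_crank \<pi>) mod 5 = 0 \<longleftrightarrow> [partition_crank \<pi> = 1] (mod 5)"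
      unfolding cong_def by simp_all
    then show "of_nat (num_ones \<pi>) * ((\<Sum>j<5. (root5 ^ j) ^ 4 * (root5 ^ j) powi (- partition_crank \<pi>))
      - (\<Sum>j<5. (root5 ^ j) ^ 4 * (root5 ^ j) powi partition_crank \<pi>))
      = 5 * (if [partition_crank \<pi> = 4] (mod 5) then of_nat (num_ones \<pi>) else 0)
      - 5 * (if [partition_crank \<pi> = 1] (mod 5) then of_nat (num_ones \<pi>) else 0)"
      unfolding root5_sum_powi by simp
  qed
  also have "\<dots> = 5 * of_int (M_omega 4 5 n - M_omega 1 5 n)"
    unfolding M_omega_def using finite_partitions[of n]
    by (simp add: sum_subtractf sum_distrib_left[symmetric] sum.inter_filter algebra_simps if_distrib[of of_int] cong: if_cong)
  finally show ?thesis .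
qed

lemma root5_filter_rank:
  "(\<Sum>j<5. (root5 ^ j) ^ 3 * (\<Sum>\<pi>\<in>partitions n. of_int (partition_rank \<pi>) * (root5 ^ j) powi partition_rank \<pi>))
    = 5 * of_int (\<Sum>\<pi> | \<pi> \<in> partitions n \<and> [partition_rank \<pi> = 2] (mod 5). partition_rank \<pi>)"
proof -
  have "(\<Sum>j<5. (root5 ^ j) ^ 3 * (\<Sum>\<pi>\<in>partitions n. of_int (partition_rank \<pi>) * (root5 ^ j) powi partition_rank \<pi>))
    = (\<Sum>\<pi>\<in>partitions n. \<Sum>j<5. (root5 ^ j) ^ 3 * (of_int (partition_rank \<pi>) * (root5 ^ j) powi partition_rank \<pi>))"
    unfolding sum_distrib_left by (rule sum.swap)
  also have "\<dots> = (\<Sum>\<pi>\<in>partitions n. of_int (partition_rank \<pi>) * (\<Sum>j<5. (root5 ^ j) ^ 3 * (root5 ^ j) powi partition_rank \<pi>))"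
    by (simp add: sum_distrib_left mult_ac)
  also have "\<dots> = (\<Sum>\<pi>\<in>partitions n. 5 * (if [partition_rank \<pi> = 2] (mod 5) then of_int (partition_rank \<pi>) else 0))"
  proof (rule sum.cong[OF refl])
    fix \<pi>
    have "(int 3 + partition_rank \<pi>) mod 5 = 0 \<longleftrightarrow> [partition_rank \<pi> = 2] (mod 5)"
      unfolding cong_def by presburger
    then show "of_int (partition_rank \<pi>) * (\<Sum>j<5. (root5 ^ j) ^ 3 * (root5 ^ j) powi partition_rank \<pi>)
      = 5 * (if [partition_rank \<pi> = 2] (mod 5) then of_int (partition_rank \<pi>) else 0)"
      unfolding root5_sum_powi by simp
  qed
  also have "\<dots> = 5 * of_int (\<Sum>\<pi> | \<pi> \<in> partitions n \<and> [partition_rank \<pi> = 2] (mod 5). partition_rank \<pi>)"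
    using finite_partitions[of n] by (simp add: sum_distrib_left[symmetric] sum.inter_filter if_distrib[of of_int] cong: if_cong)
  finally show ?thesis .
qed

text \<open>The weights select residues: (root5^j)^4 against x^(-crank) - x^crank gives crank 4
  minus crank 1, and (root5^j)^3 against x^rank gives rank 2. With z = exp u the derivative in u is
  z d/dz.\<close>

definition Psi :: "complex \<Rightarrow> complex \<Rightarrow> complex" where
  "Psi q u = (\<Sum>j<5. (root5 ^ j) ^ 4 * crank_prod q (root5 ^ j * exp u))
     + 2 * (\<Sum>j<5. (root5 ^ j) ^ 3 * durf q (1 / (root5 ^ j * exp u)) (root5 ^ j * exp u))"

lemma Psi_deriv:
  assumes q: "norm q < 1" "q \<noteq> 0"
  shows "Psi q analytic_on {0}" "\<exists>D. (Psi q has_field_derivative D) (at 0) \<and> (\<lambda>n. 5 * of_int (coef n) * q ^ n) sums D"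
proof -
  have n: "norm (root5 ^ j) = 1" for j by (simp add: norm_power)
  define C where "C j = crank_prod q (root5 ^ j) * (lam q (q / root5 ^ j) - lam q (root5 ^ j * q))" for j
  note dC = crank_prod_deriv[OF q(1) n, folded C_def]
  note sC = crank_deriv_sums[OF q n, folded C_def]
  define R where "R j D \<longleftrightarrow> ((\<lambda>u. durf q (1 / (root5 ^ j * exp u)) (root5 ^ j * exp u)) has_field_derivative D) (at 0) \<and>
    (\<lambda>u. durf q (1 / (root5 ^ j * exp u)) (root5 ^ j * exp u)) analytic_on {0} \<and>
    (\<lambda>n. (\<Sum>\<pi>\<in>partitions n. of_int (partition_rank \<pi>) * (root5 ^ j) powi partition_rank \<pi>) * q ^ n) sums D" for j D
  have "\<forall>j. \<exists>D. R j D" unfolding R_def by (intro allI rank_part_deriv[OF q n])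
  from choice[OF this] obtain D where "\<forall>j. R j (D j)" ..
  then have D: "((\<lambda>u. durf q (1 / (root5 ^ j * exp u)) (root5 ^ j * exp u)) has_field_derivative D j) (at 0)"
    "(\<lambda>u. durf q (1 / (root5 ^ j * exp u)) (root5 ^ j * exp u)) analytic_on {0}"
    "(\<lambda>n. (\<Sum>\<pi>\<in>partitions n. of_int (partition_rank \<pi>) * (root5 ^ j) powi partition_rank \<pi>) * q ^ n) sums D j" for j
    unfolding R_def by simp_all
  show "Psi q analytic_on {0}"
    unfolding Psi_def by (intro analytic_intros crank_prod_analytic[OF q(1) n] D(2))
  have 1: "(Psi q has_field_derivative (\<Sum>j<5. (root5 ^ j) ^ 4 * C j) + 2 * (\<Sum>j<5. (root5 ^ j) ^ 3 * D j)) (at 0)"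
    unfolding Psi_def by (intro DERIV_add DERIV_sum DERIV_cmult dC D(1))
  have "(\<lambda>n. (\<Sum>j<5. (root5 ^ j) ^ 4 * ((\<Sum>\<pi>\<in>partitions n. of_nat (num_ones \<pi>) * ((root5 ^ j) powi (- partition_crank \<pi>) - (root5 ^ j) powi partition_crank \<pi>)) * q ^ n))
      + 2 * (\<Sum>j<5. (root5 ^ j) ^ 3 * ((\<Sum>\<pi>\<in>partitions n. of_int (partition_rank \<pi>) * (root5 ^ j) powi partition_rank \<pi>) * q ^ n)))
    sums ((\<Sum>j<5. (root5 ^ j) ^ 4 * C j) + 2 * (\<Sum>j<5. (root5 ^ j) ^ 3 * D j))"
    by (intro sums_add sums_sum sums_mult sC D(3))
  moreover have "(\<Sum>j<5. (root5 ^ j) ^ 4 * ((\<Sum>\<pi>\<in>partitions n. of_nat (num_ones \<pi>) * ((root5 ^ j) powi (- partition_crank \<pi>) - (root5 ^ j) powi partition_crank \<pi>)) * q ^ n))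
      + 2 * (\<Sum>j<5. (root5 ^ j) ^ 3 * ((\<Sum>\<pi>\<in>partitions n. of_int (partition_rank \<pi>) * (root5 ^ j) powi partition_rank \<pi>) * q ^ n))
      = 5 * of_int (coef n) * q ^ n" for n
    unfolding mult.assoc[symmetric, of _ _ "q ^ n"] sum_distrib_right[symmetric] root5_filter_crank root5_filter_rank coef_def
    by (simp add: algebra_simps)
  ultimately have "(\<lambda>n. 5 * of_int (coef n) * q ^ n) sums ((\<Sum>j<5. (root5 ^ j) ^ 4 * C j) + 2 * (\<Sum>j<5. (root5 ^ j) ^ 3 * D j))"
    by simp
  with 1 show "\<exists>D. (Psi q has_field_derivative D) (at 0) \<and> (\<lambda>n. 5 * of_int (coef n) * q ^ n) sums D" by blast
qed

lemma root5_extract_product: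
  fixes p0 :: complex
  shows "(\<Sum>k<5. (root5 ^ k) ^ 3 * ((p0 + p1 * (root5 ^ k * q) + p2 * (root5 ^ k * q) ^ 2 + p3 * (root5 ^ k * q) ^ 3 + p4 * (root5 ^ k * q) ^ 4)
     * (c0 + c1 * (root5 ^ k * q) + c2 * (root5 ^ k * q) ^ 2 + c3 * (root5 ^ k * q) ^ 3 + c4 * (root5 ^ k * q) ^ 4)))
    = 5 * (p0 * c2 + p1 * c1 + p2 * c0 + q ^ 5 * (p3 * c4 + p4 * c3)) * q ^ 2"
proof -
  have e: "(p0 + p1 * x + p2 * x ^ 2 + p3 * x ^ 3 + p4 * x ^ 4) * (c0 + c1 * x + c2 * x ^ 2 + c3 * x ^ 3 + c4 * x ^ 4)
    = p0 * c0 + (p0 * c1 + p1 * c0) * x + (p0 * c2 + p1 * c1 + p2 * c0) * x ^ 2 + (p0 * c3 + p1 * c2 + p2 * c1 + p3 * c0) * x ^ 3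
      + (p0 * c4 + p1 * c3 + p2 * c2 + p3 * c1 + p4 * c0) * x ^ 4 + (p1 * c4 + p2 * c3 + p3 * c2 + p4 * c1) * x ^ 5
      + (p2 * c4 + p3 * c3 + p4 * c2) * x ^ 6 + (p3 * c4 + p4 * c3) * x ^ 7 + p4 * c4 * x ^ 8" for x
    by algebra
  show ?thesis unfolding e root5_extract by algebra
qed

text \<open>Partial fractions in base q with the single class b = 1, since \<open>crank_prod\<close>
  is (1 - x)(q;q)_inf divided by the theta function at x.\<close>

lemma crank_lambert:
  assumes q: "norm q < 1" "q \<noteq> 0" and x: "x \<noteq> 0" "\<And>m. x * q powi m \<noteq> 1"
  shows "crank_prod q x = (1 - x) / qinf q q * (\<Sum>\<^sub>\<infinity>m. ((- 1) powi m * q powi tri m) ^ 1 * (q powi 0) powi m / (1 - x * q powi m))"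
proof -
  interpret q: five_dissection q using q by unfold_locales auto
  have "(\<Prod>a\<in>{}. jth q (x * a)) / (\<Prod>b\<in>{1}. jth q (x * b)) =
    (\<Sum>b\<in>{1}. (\<Prod>a\<in>{}. jth q (a / b)) / ((\<Prod>b'\<in>{1}-{b}. jth q (b' / b)) * qinf q q ^ 2) *
      (\<Sum>\<^sub>\<infinity>m. ((- 1) powi m * q powi tri m) ^ 1 * (\<Prod>{} / \<Prod>{1} * b ^ 1) powi m / (1 - x * b * q powi m)))"
  proof (rule theta_partial_fractions[OF q])
    fix b b' :: complex and j assume "b \<in> {1}" "b' \<in> {1}" "b = b' * q powi j"
    then show "b = b' \<and> j = 0" using q.powi_neq_1[of j] by auto
  qed (use x in auto)
  then have j: "1 / jth q x = 1 / qinf q q ^ 2 * (\<Sum>\<^sub>\<infinity>m. ((- 1) powi m * q powi tri m) ^ 1 * (q powi 0) powi m / (1 - x * q powi m))"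
    by simp
  have jx: "jth q x = (1 - x) * (qinf (x * q) q * qinf (q / x) q)"
    unfolding jth_def using qinf_rec[OF q(1), of x] by simp
  then have "1 - x \<noteq> 0" using jth_nonzero[OF q x] by auto
  then have "crank_prod q x = (1 - x) * qinf q q * (1 / jth q x)"
    unfolding crank_prod_def jx by simp
  also have "\<dots> = (1 - x) / qinf q q * (\<Sum>\<^sub>\<infinity>m. ((- 1) powi m * q powi tri m) ^ 1 * (q powi 0) powi m / (1 - x * q powi m))"
    unfolding j using qinf_self_nonzero[OF q(1)] by (simp add: power2_eq_square)
  finally show ?thesis .
qed

lemma rank_lambert':
  assumes q: "norm q < 1" "q \<noteq> 0" and x: "x \<noteq> 0" "\<And>m. x * q powi m \<noteq> 1"
  shows "durf q (1 / x) x = (1 - x) / qinf q q * (\<Sum>\<^sub>\<infinity>m. ((- 1) powi m * q powi tri m) ^ 3 * (q powi (- 1)) powi m / (1 - x * q powi m))"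
proof -
  have "(- 1) powi m * q powi (tri m + m * m) = ((- 1) powi m * q powi tri m) ^ 3 * (q powi (- 1)) powi m" for m :: int
  proof -
    have "((- 1 :: complex) powi m) ^ 3 = (- 1) powi m" by (cases "even m") auto
    moreover have "(q powi tri m) ^ 3 * (q powi (- 1)) powi m = q powi (tri m + m * m)"
    proof -
      have "(q powi tri m) ^ 3 * (q powi (- 1)) powi m = q powi (tri m * 3) * q powi (- 1 * m)"
        by (simp only: power_int_mult power_int_numeral)
      also have "\<dots> = q powi (tri m * 3 + - 1 * m)" using q(2) by (simp only: power_int_add simp_thms)
      also have "tri m * 3 + - 1 * m = tri m + m * m" using two_tri[of m] by (simp add: algebra_simps)
      finally show ?thesis .
    qed
    ultimately show ?thesis by (simp only: power_mult_distrib mult.assoc)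
  qed
  then show ?thesis using rank_lambert[OF q x] by simp
qed

context five_dissection
begin

section \<open>The dissection at residue two\<close>

text \<open>\<open>root5_filter\<close> is applied for each m with a = z and x = z q^m; its
  numerator is the prefactor 1 - x of the Lambert form. Leaving F open covers the crank (d = 1, b =
  0) and the rank (d = 3, b = -1) together.\<close>

lemma lambert_root_filter:
  assumes q: "q ^ 5 = y" and z: "z \<noteq> 0" and gen: "\<And>m. z ^ 5 * y powi m \<noteq> 1" and d: "d \<ge> 1"
    and F: "\<And>x. x \<noteq> 0 \<Longrightarrow> (\<And>m. x * q powi m \<noteq> 1) \<Longrightarrow>
      F x = (1 - x) / qinf q q * (\<Sum>\<^sub>\<infinity>m. ((- 1) powi m * q powi tri m) ^ d * (q powi b) powi m / (1 - x * q powi m))"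
  shows "(\<Sum>j<5. (root5 ^ j) ^ 4 * F (root5 ^ j * z)) = 5 * z / qinf q q * (gsum q d (b + 1) (z ^ 5) - gsum q d b (z ^ 5))"
    and "(\<Sum>j<5. (root5 ^ j) ^ 3 * F (root5 ^ j * z)) = 5 * z ^ 2 / qinf q q * (gsum q d (b + 2) (z ^ 5) - gsum q d (b + 1) (z ^ 5))"
proof -
  have q1: "norm q < 1" "q \<noteq> 0" using root_norm[OF q] by auto
  interpret q: five_dissection q using q1 by unfold_locales auto
  define c where "c m = ((- 1) powi m * q powi tri m) ^ d * (q powi b) powi m" for m
  have u5: "(q powi m) ^ 5 = y powi m" for m
  proof -
    have "(q powi m) ^ 5 = (q powi m) powi 5" by (simp add: power_int_def)
    also have "\<dots> = (q powi 5) powi m" by (simp only: power_int_mult[symmetric] mult.commute)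
    also have "q powi 5 = y" using q by (simp add: power_int_def)
    finally show ?thesis .
  qed
  have z5: "z ^ 5 \<noteq> 0" using z by simp
  have w0: "root5 ^ j * z \<noteq> 0" for j using z by simp
  have genw: "root5 ^ j * z * q powi m \<noteq> 1" for j m
  proof
    assume "root5 ^ j * z * q powi m = 1"
    then have "(root5 ^ j * z * q powi m) ^ 5 = 1" by simp
    then have "z ^ 5 * y powi m = 1" by (simp add: power_mult_distrib u5 root5_power_5)
    then show False using gen by blast
  qed
  have S: "((\<lambda>m. (1 - root5 ^ j * z) / qinf q q * (c m / (1 - root5 ^ j * z * q powi m))) has_sum F (root5 ^ j * z)) UNIV" for j
  proof -
    obtain K where K: "\<And>m. norm (1 / (1 - root5 ^ j * z * q powi m)) \<le> K"
      using q.generic_bound[OF w0 genw] by blast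
    have "(\<lambda>m. ((- 1) powi m * q powi tri m) ^ d * (q powi b) powi m * (1 / (1 - root5 ^ j * z * q powi m))) summable_on UNIV"
      by (rule theta_weight_summable[OF q1 _ d K]) (use q1 in simp)
    then have "(\<lambda>m. c m / (1 - root5 ^ j * z * q powi m)) summable_on UNIV" by (simp add: c_def)
    from has_sum_cmult_right[OF has_sum_infsum[OF this], of "(1 - root5 ^ j * z) / qinf q q"]
    show ?thesis unfolding F[OF w0 genw] c_def .
  qed
  have G: "((\<lambda>m. ((- 1) powi m * q powi tri m) ^ d * (q powi b') powi m / (1 - z ^ 5 * y powi m)) has_sum gsum q d b' (z ^ 5)) UNIV" for b'
    unfolding gsum_def by (rule has_sum_infsum[OF gsum_summable[OF q z5 gen d]])
  have cb: "((- 1) powi m * q powi tri m) ^ d * (q powi (b + 1)) powi m = c m * q powi m"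
    "((- 1) powi m * q powi tri m) ^ d * (q powi (b + 2)) powi m = c m * (q powi m) ^ 2" for m
  proof -
    show "((- 1) powi m * q powi tri m) ^ d * (q powi (b + 1)) powi m = c m * q powi m"
      using q1 by (simp add: c_def power_int_add power_int_mult_distrib)
    have "(q powi (b + 2)) powi m = (q powi b) powi m * (q powi m) ^ 2"
      using q1 by (simp add: power_int_add power_int_mult_distrib power2_eq_square)
    then show "((- 1) powi m * q powi tri m) ^ d * (q powi (b + 2)) powi m = c m * (q powi m) ^ 2"
      by (simp add: c_def)
  qed
  note G0 = G[of b, folded c_def]
  note G1 = G[of "b + 1", unfolded cb]
  note G2 = G[of "b + 2", unfolded cb]
  have x5: "(z * q powi m) ^ 5 = z ^ 5 * y powi m" for m by (simp add: power_mult_distrib u5)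
  have x5': "(z * q powi m) ^ 5 \<noteq> 1" for m unfolding x5 by (rule gen)
  have D: "1 - z ^ 5 * y powi m \<noteq> 0" for m using gen[of m] by simp
  have T: "(\<Sum>j<5. (root5 ^ j) ^ p * ((1 - root5 ^ j * z) / qinf q q * (c m / (1 - root5 ^ j * z * q powi m)))) =
      c m / qinf q q * (\<Sum>j<5. (root5 ^ j) ^ p * ((1 - root5 ^ j * z) / (1 - root5 ^ j * (z * q powi m))))" for m p
    unfolding sum_distrib_left by (intro sum.cong) (simp_all add: mult_ac)
  have "((\<lambda>m. \<Sum>j<5. (root5 ^ j) ^ 4 * ((1 - root5 ^ j * z) / qinf q q * (c m / (1 - root5 ^ j * z * q powi m))))
    has_sum (\<Sum>j<5. (root5 ^ j) ^ 4 * F (root5 ^ j * z))) UNIV"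
    by (intro has_sum_sum_lessThan has_sum_cmult_right S)
  moreover have "(\<Sum>j<5. (root5 ^ j) ^ 4 * ((1 - root5 ^ j * z) / qinf q q * (c m / (1 - root5 ^ j * z * q powi m)))) =
    5 * z / qinf q q * (c m * q powi m / (1 - z ^ 5 * y powi m)) + (- 5 * z / qinf q q) * (c m / (1 - z ^ 5 * y powi m))" for m
    unfolding T root5_filter(1)[OF x5'] x5 by (simp add: divide_inverse algebra_simps)
  moreover have "((\<lambda>m. 5 * z / qinf q q * (c m * q powi m / (1 - z ^ 5 * y powi m)) + (- 5 * z / qinf q q) * (c m / (1 - z ^ 5 * y powi m)))
    has_sum (5 * z / qinf q q * gsum q d (b + 1) (z ^ 5) + (- 5 * z / qinf q q) * gsum q d b (z ^ 5))) UNIV"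
    by (intro has_sum_add has_sum_cmult_right G0 G1)
  ultimately have "(\<Sum>j<5. (root5 ^ j) ^ 4 * F (root5 ^ j * z)) = 5 * z / qinf q q * gsum q d (b + 1) (z ^ 5) + (- 5 * z / qinf q q) * gsum q d b (z ^ 5)"
    using has_sum_unique by (simp only:)
  then show "(\<Sum>j<5. (root5 ^ j) ^ 4 * F (root5 ^ j * z)) = 5 * z / qinf q q * (gsum q d (b + 1) (z ^ 5) - gsum q d b (z ^ 5))"
    by (simp add: right_diff_distrib)
  have "((\<lambda>m. \<Sum>j<5. (root5 ^ j) ^ 3 * ((1 - root5 ^ j * z) / qinf q q * (c m / (1 - root5 ^ j * z * q powi m))))
    has_sum (\<Sum>j<5. (root5 ^ j) ^ 3 * F (root5 ^ j * z))) UNIV"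
    by (intro has_sum_sum_lessThan has_sum_cmult_right S)
  moreover have "(\<Sum>j<5. (root5 ^ j) ^ 3 * ((1 - root5 ^ j * z) / qinf q q * (c m / (1 - root5 ^ j * z * q powi m)))) =
    5 * z ^ 2 / qinf q q * (c m * (q powi m) ^ 2 / (1 - z ^ 5 * y powi m)) + (- 5 * z ^ 2 / qinf q q) * (c m * q powi m / (1 - z ^ 5 * y powi m))" for m
    unfolding T root5_filter(2)[OF x5'] x5 by (simp add: divide_inverse algebra_simps power2_eq_square)
  moreover have "((\<lambda>m. 5 * z ^ 2 / qinf q q * (c m * (q powi m) ^ 2 / (1 - z ^ 5 * y powi m)) + (- 5 * z ^ 2 / qinf q q) * (c m * q powi m / (1 - z ^ 5 * y powi m)))
    has_sum (5 * z ^ 2 / qinf q q * gsum q d (b + 2) (z ^ 5) + (- 5 * z ^ 2 / qinf q q) * gsum q d (b + 1) (z ^ 5))) UNIV"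
    by (intro has_sum_add has_sum_cmult_right G1 G2)
  ultimately have "(\<Sum>j<5. (root5 ^ j) ^ 3 * F (root5 ^ j * z)) = 5 * z ^ 2 / qinf q q * gsum q d (b + 2) (z ^ 5) + (- 5 * z ^ 2 / qinf q q) * gsum q d (b + 1) (z ^ 5)"
    using has_sum_unique by (simp only:)
  then show "(\<Sum>j<5. (root5 ^ j) ^ 3 * F (root5 ^ j * z)) = 5 * z ^ 2 / qinf q q * (gsum q d (b + 2) (z ^ 5) - gsum q d (b + 1) (z ^ 5))"
    by (simp add: right_diff_distrib)
qed

text \<open>The product of r - x - x^2/r over all five conjugates x of q. The roots of that
  quadratic are golden-ratio multiples of r, and 11 is the fifth Lucas number.\<close>

definition "Mc = r ^ 5 - 11 * y - y ^ 2 / r ^ 5"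

text \<open>Multiplication by this quartic rationalises the pentagonal factor \<^term>\<open>qinf q q / J\<close> over the field of fifth powers.\<close>

lemma quintic:
  assumes "q ^ 5 = y"
  shows "(r - q - q ^ 2 / r) * (p0 + p1 * q + p2 * q ^ 2 + p3 * q ^ 3 + 5 * q ^ 4) = Mc"
proof -
  define ir where "ir = inverse r"
  have "ir * r = 1" using r_nonzero by (simp add: ir_def)
  then show ?thesis using assms
    unfolding p0_def p1_def p2_def p3_def Mc_def divide_inverse power_inverse[symmetric] ir_def[symmetric] by algebra
qed

lemma root5_power_mult_5: "q ^ 5 = y \<Longrightarrow> (root5 ^ k * q) ^ 5 = y"
  by (simp add: power_mult_distrib root5_power_5)

lemma pentagonal_factor_nonzero:
  assumes "q ^ 5 = y"
  shows "r - q - q ^ 2 / r \<noteq> 0"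
  using pentagonal_dissection[OF assms] qinf_self_nonzero[OF root_norm(1)[OF assms]] by auto

text \<open>Otherwise the quartic cofactor would vanish at all five conjugates of q, because the
  pentagonal factor does not; the weight root5^k then isolates 25 q^4 = 0.\<close>

lemma Mc_nonzero:
  assumes q: "q ^ 5 = y"
  shows "Mc \<noteq> 0"
proof
  assume "Mc = 0"
  then have z: "p0 + p1 * (root5 ^ k * q) + p2 * (root5 ^ k * q) ^ 2 + p3 * (root5 ^ k * q) ^ 3 + 5 * (root5 ^ k * q) ^ 4 = 0" for k
    using quintic[OF root5_power_mult_5[OF q], of k] pentagonal_factor_nonzero[OF root5_power_mult_5[OF q], of k] by simp
  have e: "w * (p0 + p1 * (w * q) + p2 * (w * q) ^ 2 + p3 * (w * q) ^ 3 + 5 * (w * q) ^ 4)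
    = p0 * w ^ 1 + p1 * q * w ^ 2 + p2 * q ^ 2 * w ^ 3 + p3 * q ^ 3 * w ^ 4 + 5 * q ^ 4 * w ^ 5" for w :: complex
    by algebra
  have "(\<Sum>k<5. root5 ^ k * (p0 + p1 * (root5 ^ k * q) + p2 * (root5 ^ k * q) ^ 2 + p3 * (root5 ^ k * q) ^ 3 + 5 * (root5 ^ k * q) ^ 4)) = 25 * q ^ 4"
    unfolding e sum.distrib sum_distrib_left[symmetric] root5_sum by simp
  then have "q ^ 4 = 0" unfolding z by simp
  then show False using root_norm(2)[OF q] by simp
qed

text \<open>Multiplication by J Mc trades 1/(q;q)_inf for the quartic cofactor. For every conjugate
  x the crank side is then a product of two quartics in x with common coefficients, and
  \<open>root5_extract_product\<close> reads off the residue 2.\<close>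

lemma crank_dissect:
  assumes q: "q ^ 5 = y" and z: "z \<noteq> 0" and gen: "\<And>m. z ^ 5 * y powi m \<noteq> 1"
  shows "(\<Sum>k<5. (root5 ^ k) ^ 3 * (\<Sum>j<5. (root5 ^ j) ^ 4 * crank_prod (root5 ^ k * q) (root5 ^ j * z))) * (J * Mc) *
      (ty (z ^ 5) 0 * (ty (z ^ 5) 1 * (ty (z ^ 5) 2 * (ty (z ^ 5) 3 * ty (z ^ 5) 4)))) = 25 * q ^ 2 * J ^ 2 * (z * crank_num (z ^ 5))"
proof -
  define t where "t = z ^ 5"
  have t: "t \<noteq> 0" "\<And>m. t * y powi m \<noteq> 1" using z gen by (auto simp: t_def)
  \<comment> \<open>Coefficients of the powers of x in \<open>gsum x 1 1 t - gsum x 1 0 t\<close>,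
    divided by J^2, with \<open>ty t 6\<close> brought back to \<open>ty t 1\<close>.\<close>
  define c0 c1 c2 c3 c4 where "c0 = r * (ty t 1 / (ty t 0 * ty t 2)) - ty t 2 / (ty t 0 * ty t 4) / r"
    and "c1 = r * (ty t 2 / (ty t 1 * ty t 3))" and "c2 = - 1 / ty t 1" and "c3 = - 1 / ty t 2"
    and "c4 = ty t 1 / (ty t 3 * ty t 4) / (r * t)"
  note c = c0_def c1_def c2_def c3_def c4_def
  have t6: "ty t 6 = - ty t 1 / (t * y)" using ty_shift[OF t(1), of 1] by simp
  have inner: "(\<Sum>j<5. (root5 ^ j) ^ 4 * crank_prod x (root5 ^ j * z)) * (J * Mc) =
    5 * z * J ^ 2 * ((p0 + p1 * x + p2 * x ^ 2 + p3 * x ^ 3 + 5 * x ^ 4) * (c0 + c1 * x + c2 * x ^ 2 + c3 * x ^ 3 + c4 * x ^ 4))"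
    if x: "x ^ 5 = y" for x
  proof -
    have g: "gsum x 1 (0 + 1) t - gsum x 1 0 t = J ^ 2 * (c0 + c1 * x + c2 * x ^ 2 + c3 * x ^ 3 + c4 * x ^ 4)"
      unfolding add_0 gsum_1_1[OF x t] gsum_1_0[OF x t] t6 c using t(1) y0 r_nonzero by (simp add: algebra_simps)
    have "(\<Sum>j<5. (root5 ^ j) ^ 4 * crank_prod x (root5 ^ j * z)) = 5 * z / qinf x x * (gsum x 1 (0 + 1) t - gsum x 1 0 t)"
      unfolding t_def by (rule lambert_root_filter(1)[OF x z gen]) (simp, (rule crank_lambert[OF root_norm[OF x]]; blast))
    then show ?thesis unfolding g pentagonal_dissection[OF x] quintic[OF x, symmetric]
      using pentagonal_factor_nonzero[OF x] J_nonzero by simp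
  qed
  have "(\<Sum>k<5. (root5 ^ k) ^ 3 * (\<Sum>j<5. (root5 ^ j) ^ 4 * crank_prod (root5 ^ k * q) (root5 ^ j * z))) * (J * Mc)
    = (\<Sum>k<5. (root5 ^ k) ^ 3 * ((\<Sum>j<5. (root5 ^ j) ^ 4 * crank_prod (root5 ^ k * q) (root5 ^ j * z)) * (J * Mc)))"
    by (simp only: sum_distrib_right mult.assoc)
  also have "\<dots> = 5 * z * J ^ 2 * (\<Sum>k<5. (root5 ^ k) ^ 3 * ((p0 + p1 * (root5 ^ k * q) + p2 * (root5 ^ k * q) ^ 2 + p3 * (root5 ^ k * q) ^ 3 + 5 * (root5 ^ k * q) ^ 4)
     * (c0 + c1 * (root5 ^ k * q) + c2 * (root5 ^ k * q) ^ 2 + c3 * (root5 ^ k * q) ^ 3 + c4 * (root5 ^ k * q) ^ 4)))"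
    unfolding inner[OF root5_power_mult_5[OF q]] sum_distrib_left by (intro sum.cong) (simp_all only: mult_ac)
  also have "\<dots> = 25 * q ^ 2 * J ^ 2 * z * (p0 * c2 + p1 * c1 + p2 * c0 + y * (p3 * c4 + 5 * c3))"
    unfolding root5_extract_product q by simp
  finally have A: "(\<Sum>k<5. (root5 ^ k) ^ 3 * (\<Sum>j<5. (root5 ^ j) ^ 4 * crank_prod (root5 ^ k * q) (root5 ^ j * z))) * (J * Mc)
    = 25 * q ^ 2 * J ^ 2 * z * (p0 * c2 + p1 * c1 + p2 * c0 + y * (p3 * c4 + 5 * c3))" .
  define T where "T = ty t 0 * (ty t 1 * (ty t 2 * (ty t 3 * ty t 4)))"
  have T: "c0 * T = r * (ty t 1 * ty t 1 * (ty t 3 * ty t 4)) - 1 / r * (ty t 1 * (ty t 2 * ty t 2 * ty t 3))"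
    "c1 * T = r * (ty t 0 * (ty t 2 * ty t 2 * ty t 4))" "c2 * T = - (ty t 0 * (ty t 2 * (ty t 3 * ty t 4)))"
    "c3 * T = - (ty t 0 * (ty t 1 * (ty t 3 * ty t 4)))" "c4 * T = 1 / r * (1 / t * (ty t 0 * (ty t 1 * ty t 1 * ty t 2)))"
    unfolding c T_def using ty_nonzero[OF t] by (simp_all add: field_simps)
  have "(p0 * c2 + p1 * c1 + p2 * c0 + y * (p3 * c4 + 5 * c3)) * T = p0 * (c2 * T) + p1 * (c1 * T) + p2 * (c0 * T) + y * (p3 * (c4 * T) + 5 * (c3 * T))"
    by (simp only: algebra_simps)
  also have "\<dots> = crank_num t" unfolding T crank_num_def by (simp add: algebra_simps)
  finally show ?thesis unfolding A t_def[symmetric] T_def[symmetric] by (simp only: mult.assoc)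
qed

text \<open>The surviving Lambert series are collected in a3 and a4. Their cofactor s cancels
  against Euler's product, so they contribute only x^3 and x^4, and \<open>root5_extract\<close>
  sends them to 0.\<close>

lemma rank_dissect:
  assumes q: "q ^ 5 = y" and z: "z \<noteq> 0" and gen: "\<And>m. z ^ 5 * y powi m \<noteq> 1"
  shows "(\<Sum>k<5. (root5 ^ k) ^ 3 * (\<Sum>j<5. (root5 ^ j) ^ 3 * durf (root5 ^ k * q) (1 / (root5 ^ j * z)) (root5 ^ j * z))) * (J * Mc) *
      (ty (z ^ 5) 0 * (ty (z ^ 5) 1 * (ty (z ^ 5) 2 * (ty (z ^ 5) 3 * ty (z ^ 5) 4)))) = 25 * q ^ 2 * J ^ 2 * (al * be * (z ^ 2 * rank_num (z ^ 5)))"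
proof -
  define t where "t = z ^ 5"
  have t: "t \<noteq> 0" "\<And>m. t * y powi m \<noteq> 1" using z gen by (auto simp: t_def)
  define d0 d1 d3 d4 where "d0 = - 1 / (ty t 0 * ty t 2 * ty t 4)" and "d1 = - 1 / (ty t 0 * ty t 2 * ty t 3)"
    and "d3 = 1 / (ty t 1 * ty t 2 * ty t 3)" and "d4 = 1 / y / (ty t 0 * ty t 1 * ty t 4)"
  note d = d0_def d1_def d3_def d4_def
  define a3 a4 where "a3 = Mc * y * lam_sum 3 t 2 0" and "a4 = - (Mc / y * lam_sum 3 t 0 (-5))"
  have inner: "(\<Sum>j<5. (root5 ^ j) ^ 3 * durf x (1 / (root5 ^ j * z)) (root5 ^ j * z)) * (J * Mc) =
    5 * z ^ 2 * (0 + 0 * x + 0 * x ^ 2 + a3 * x ^ 3 + a4 * x ^ 4 + 0 * x ^ 5 + 0 * x ^ 6 + 0 * x ^ 7 + 0 * x ^ 8)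
    + 5 * z ^ 2 * al * be * J ^ 2 * ((p0 + p1 * x + p2 * x ^ 2 + p3 * x ^ 3 + 5 * x ^ 4) * (d0 + d1 * x + 0 * x ^ 2 + d3 * x ^ 3 + d4 * x ^ 4))"
    if x: "x ^ 5 = y" for x
  proof -
    define s where "s = r - x - x ^ 2 / r"
    define P where "P = p0 + p1 * x + p2 * x ^ 2 + p3 * x ^ 3 + 5 * x ^ 4"
    have sP: "s * P = Mc" unfolding s_def P_def by (rule quintic[OF x])
    have s0: "s \<noteq> 0" unfolding s_def by (rule pentagonal_factor_nonzero[OF x])
    have g: "gsum x 3 (- 1 + 2) t - gsum x 3 (- 1 + 1) t = s * (y * x ^ 3 * lam_sum 3 t 2 0 - x ^ 4 / y * lam_sum 3 t 0 (-5))
      + al * be * J ^ 2 * (d0 + d1 * x + 0 * x ^ 2 + d3 * x ^ 3 + d4 * x ^ 4)"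
    proof -
      have e: "gsum x 3 (- 1 + 2) t = gsum x 3 1 t" "gsum x 3 (- 1 + 1) t = gsum x 3 0 t" by simp_all
      show ?thesis unfolding e gsum_3_1[OF x t] gsum_3_0[OF x t] s_def[symmetric] d by (simp add: algebra_simps)
    qed
    have "(\<Sum>j<5. (root5 ^ j) ^ 3 * durf x (1 / (root5 ^ j * z)) (root5 ^ j * z)) = 5 * z ^ 2 / qinf x x * (gsum x 3 (- 1 + 2) t - gsum x 3 (- 1 + 1) t)"
      unfolding t_def by (rule lambert_root_filter(2)[OF x z gen, where F = "\<lambda>v. durf x (1 / v) v"]) (simp, (rule rank_lambert'[OF root_norm[OF x]]; blast))
    then have "(\<Sum>j<5. (root5 ^ j) ^ 3 * durf x (1 / (root5 ^ j * z)) (root5 ^ j * z)) * (J * Mc)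
      = 5 * z ^ 2 * P * (s * (y * x ^ 3 * lam_sum 3 t 2 0 - x ^ 4 / y * lam_sum 3 t 0 (-5)) + al * be * J ^ 2 * (d0 + d1 * x + 0 * x ^ 2 + d3 * x ^ 3 + d4 * x ^ 4))"
      unfolding g pentagonal_dissection[OF x] s_def[symmetric] sP[symmetric] using s0 J_nonzero by simp
    also have "\<dots> = 5 * z ^ 2 * (Mc * (y * x ^ 3 * lam_sum 3 t 2 0 - x ^ 4 / y * lam_sum 3 t 0 (-5)))
      + 5 * z ^ 2 * al * be * J ^ 2 * (P * (d0 + d1 * x + 0 * x ^ 2 + d3 * x ^ 3 + d4 * x ^ 4))"
      unfolding sP[symmetric] by (simp only: algebra_simps)
    also have "Mc * (y * x ^ 3 * lam_sum 3 t 2 0 - x ^ 4 / y * lam_sum 3 t 0 (-5)) = 0 + 0 * x + 0 * x ^ 2 + a3 * x ^ 3 + a4 * x ^ 4 + 0 * x ^ 5 + 0 * x ^ 6 + 0 * x ^ 7 + 0 * x ^ 8"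
      unfolding a3_def a4_def by (simp add: algebra_simps)
    finally show ?thesis unfolding P_def .
  qed
  have "(\<Sum>k<5. (root5 ^ k) ^ 3 * (\<Sum>j<5. (root5 ^ j) ^ 3 * durf (root5 ^ k * q) (1 / (root5 ^ j * z)) (root5 ^ j * z))) * (J * Mc)
    = (\<Sum>k<5. (root5 ^ k) ^ 3 * ((\<Sum>j<5. (root5 ^ j) ^ 3 * durf (root5 ^ k * q) (1 / (root5 ^ j * z)) (root5 ^ j * z)) * (J * Mc)))"
    by (simp only: sum_distrib_right mult.assoc)
  also have "\<dots> = 5 * z ^ 2 * (\<Sum>k<5. (root5 ^ k) ^ 3 * (0 + 0 * (root5 ^ k * q) + 0 * (root5 ^ k * q) ^ 2 + a3 * (root5 ^ k * q) ^ 3 + a4 * (root5 ^ k * q) ^ 4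
        + 0 * (root5 ^ k * q) ^ 5 + 0 * (root5 ^ k * q) ^ 6 + 0 * (root5 ^ k * q) ^ 7 + 0 * (root5 ^ k * q) ^ 8))
     + 5 * z ^ 2 * al * be * J ^ 2 * (\<Sum>k<5. (root5 ^ k) ^ 3 * ((p0 + p1 * (root5 ^ k * q) + p2 * (root5 ^ k * q) ^ 2 + p3 * (root5 ^ k * q) ^ 3 + 5 * (root5 ^ k * q) ^ 4)
     * (d0 + d1 * (root5 ^ k * q) + 0 * (root5 ^ k * q) ^ 2 + d3 * (root5 ^ k * q) ^ 3 + d4 * (root5 ^ k * q) ^ 4)))"
    unfolding inner[OF root5_power_mult_5[OF q]] sum_distrib_left sum.distrib[symmetric]
    by (intro sum.cong refl) (simp only: distrib_left mult.left_commute[of _ "5 * z ^ 2"] mult.left_commute[of _ "5 * z ^ 2 * al * be * J ^ 2"])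
  also have "\<dots> = 25 * q ^ 2 * J ^ 2 * (al * be * z ^ 2) * (p1 * d1 + p2 * d0 + y * (p3 * d4 + 5 * d3))"
    unfolding root5_extract root5_extract_product q by simp
  finally have A: "(\<Sum>k<5. (root5 ^ k) ^ 3 * (\<Sum>j<5. (root5 ^ j) ^ 3 * durf (root5 ^ k * q) (1 / (root5 ^ j * z)) (root5 ^ j * z))) * (J * Mc)
    = 25 * q ^ 2 * J ^ 2 * (al * be * z ^ 2) * (p1 * d1 + p2 * d0 + y * (p3 * d4 + 5 * d3))" .
  define T where "T = ty t 0 * (ty t 1 * (ty t 2 * (ty t 3 * ty t 4)))"
  have T: "d0 * T = - (ty t 1 * ty t 3)" "d1 * T = - (ty t 1 * ty t 4)" "d3 * T = ty t 0 * ty t 4" "y * (d4 * T) = ty t 2 * ty t 3"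
    unfolding d T_def using ty_nonzero[OF t] y0 by (simp_all add: field_simps)
  have "(p1 * d1 + p2 * d0 + y * (p3 * d4 + 5 * d3)) * T = p1 * (d1 * T) + p2 * (d0 * T) + p3 * (y * (d4 * T)) + 5 * y * (d3 * T)"
    by (simp only: algebra_simps)
  also have "\<dots> = rank_num t" unfolding T rank_num_def by (simp add: algebra_simps)
  finally show ?thesis unfolding A t_def[symmetric] T_def[symmetric] by (simp only: mult.assoc)
qed

lemma Psi_dissect_deriv:
  assumes q: "q ^ 5 = y"
  shows "((\<lambda>u. \<Sum>k<5. (root5 ^ k) ^ 3 * Psi (root5 ^ k * q) u) has_field_derivative 0) (at 0)"
proof -
  define H where "H u = (\<Sum>k<5. (root5 ^ k) ^ 3 * Psi (root5 ^ k * q) u)" for u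
  note qk = root_norm[OF root5_power_mult_5[OF q]]
  have "H analytic_on {0}" unfolding H_def by (intro analytic_intros Psi_deriv(1) qk)
  from jet_analytic[OF this] obtain h1 h2 where h: "jet H (H 0) h1 h2" by blast
  define N where "N u = exp (1 * u) * crank_num (exp (5 * u)) + 2 * al * be * (exp (2 * u) * rank_num (exp (5 * u)))" for u
  define E where "E u = ty (exp (5 * u)) 0 * (ty (exp (5 * u)) 1 * (ty (exp (5 * u)) 2 * (ty (exp (5 * u)) 3 * ty (exp (5 * u)) 4)))" for u
  obtain n D where n: "jet N 0 n (5 / 2 * n)" and D: "jet E 0 D (5 / 2 * D)" "D \<noteq> 0"
    using numerator_jet unfolding N_def E_def by blast
  define K where "K = 25 * q ^ 2 * J ^ 2"
  have ev: "\<forall>\<^sub>F u in at 0. H u * (J * Mc) * E u = K * N u"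
    using generic_near_1
  proof eventually_elim
    case (elim u)
    have e: "exp u ^ 5 = exp (5 * u)" "exp u ^ 2 = exp (2 * u)" using exp_of_nat_mult[of 5 u] exp_of_nat_mult[of 2 u] by simp_all
    have gen: "exp u ^ 5 * y powi m \<noteq> 1" for m using elim e by auto
    define HA where "HA = (\<Sum>k<5. (root5 ^ k) ^ 3 * (\<Sum>j<5. (root5 ^ j) ^ 4 * crank_prod (root5 ^ k * q) (root5 ^ j * exp u)))"
    define HB where "HB = (\<Sum>k<5. (root5 ^ k) ^ 3 * (\<Sum>j<5. (root5 ^ j) ^ 3 * durf (root5 ^ k * q) (1 / (root5 ^ j * exp u)) (root5 ^ j * exp u)))"
    have lin: "(\<Sum>k<5. a k * (A k + 2 * B k)) = (\<Sum>k<5. a k * A k) + 2 * (\<Sum>k<5. a k * B k)" for a A B :: "nat \<Rightarrow> complex"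
      by (simp add: distrib_left sum.distrib sum_distrib_left mult.left_commute[of _ 2])
    have H: "H u = HA + 2 * HB"
      unfolding H_def Psi_def HA_def HB_def by (rule lin)
    have "HA * (J * Mc) * E u = K * (exp u * crank_num (exp (5 * u)))"
      using crank_dissect[OF q exp_not_eq_zero gen] unfolding HA_def E_def K_def e .
    moreover have "HB * (J * Mc) * E u = K * (al * be * (exp (2 * u) * rank_num (exp (5 * u))))"
      using rank_dissect[OF q exp_not_eq_zero gen] unfolding HB_def E_def K_def e .
    ultimately show ?case unfolding H N_def by (simp add: algebra_simps)
  qed
  note L = jet_mult[OF jet_mult[OF h jet_const[of "J * Mc"]] D(1)]
  note R = jet_mult[OF jet_const[of K] n]
  have 1: "H 0 * (J * Mc) * D = K * n" using jet_unique(2)[OF L R ev] by simp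
  have "H 0 * (J * Mc) * (5 / 2 * D) + h1 * (J * Mc) * D = K * (5 / 2 * n)" using jet_unique(3)[OF L R ev] by simp
  \<comment> \<open>Order one says H 0 J Mc D = K n. As both jets have the ratio 5/2, order two
    repeats this equation except for the term with h1.\<close>
  then have "h1 * (J * Mc) * D = 5 / 2 * (K * n - H 0 * (J * Mc) * D)" by (simp add: algebra_simps)
  then have "h1 = 0" unfolding 1 using J_nonzero Mc_nonzero[OF q] D(2) by simp
  then show ?thesis using jet_deriv(2)[OF h] by (simp add: H_def[abs_def])
qed

end

text \<open>Averaging the derivative of Psi at 0 over the conjugates of q keeps the exponents 2 mod
  5, and the average vanishes throughout the punctured disc. A power series with a nonzero
  coefficient has isolated zeros.\<close>

lemma coef_eq_0:
  assumes "m mod 5 = 2"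
  shows "coef m = 0"
proof (rule ccontr)
  define b where "b n = (if (3 + n) mod 5 = 0 then of_int (coef n) else 0 :: complex)" for n
  have S: "(\<lambda>n. b n * q ^ n) sums 0" if q: "norm q < 1" "q \<noteq> 0" for q :: complex
  proof -
    interpret five_dissection "q ^ 5"
      using q by unfold_locales (simp_all add: norm_power power_less_one_iff)
    have qk: "norm (root5 ^ k * q) < 1" "root5 ^ k * q \<noteq> 0" for k using q by (simp_all add: norm_mult norm_power)
    define R where "R k D \<longleftrightarrow> (Psi (root5 ^ k * q) has_field_derivative D) (at 0) \<and> (\<lambda>n. 5 * of_int (coef n) * (root5 ^ k * q) ^ n) sums D" for k D
    have "\<forall>k. \<exists>D. R k D" unfolding R_def by (intro allI Psi_deriv(2) qk)
    from choice[OF this] obtain D where "\<forall>k. R k (D k)" ..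
    then have D: "(Psi (root5 ^ k * q) has_field_derivative D k) (at 0)" "(\<lambda>n. 5 * of_int (coef n) * (root5 ^ k * q) ^ n) sums D k" for k
      unfolding R_def by simp_all
    have "((\<lambda>u. \<Sum>k<5. (root5 ^ k) ^ 3 * Psi (root5 ^ k * q) u) has_field_derivative (\<Sum>k<5. (root5 ^ k) ^ 3 * D k)) (at 0)"
      by (intro DERIV_sum DERIV_cmult D(1))
    then have z: "(\<Sum>k<5. (root5 ^ k) ^ 3 * D k) = 0" using Psi_dissect_deriv[OF refl] DERIV_unique by blast
    have "(\<lambda>n. \<Sum>k<5. (root5 ^ k) ^ 3 * (5 * of_int (coef n) * (root5 ^ k * q) ^ n)) sums (\<Sum>k<5. (root5 ^ k) ^ 3 * D k)"
      by (intro sums_sum sums_mult D(2))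
    moreover have "(\<Sum>k<5. (root5 ^ k) ^ 3 * (5 * of_int (coef n) * (root5 ^ k * q) ^ n)) = 25 * (b n * q ^ n)" for n
    proof -
      have "(\<Sum>k<5. (root5 ^ k) ^ 3 * (5 * of_int (coef n) * (root5 ^ k * q) ^ n)) = 5 * of_int (coef n) * q ^ n * (\<Sum>k<5. (root5 ^ k) ^ (3 + n))"
        unfolding sum_distrib_left power_add power_mult_distrib by (intro sum.cong refl) (simp only: mult_ac)
      then show ?thesis unfolding root5_sum b_def by simp
    qed
    ultimately have "(\<lambda>n. 25 * (b n * q ^ n)) sums 0" unfolding z by simp
    from sums_mult[OF this, of "1 / 25"] show ?thesis by simp
  qed
  \<comment> \<open>S leaves out q = 0; there the series is b 0, and the exponent 0 does not lie in
    the class 2 mod 5.\<close>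
  have b0: "b 0 = 0" by (simp add: b_def)
  have sm: "(\<lambda>n. b n * (x - 0) ^ n) sums 0" if "norm (x - 0) < 1" for x :: complex
  proof (cases "x = 0")
    case True
    have "(\<lambda>n. b n * 0 ^ n) = (\<lambda>n. 0)" using b0 by (auto simp: power_0_left)
    then show ?thesis using True by simp
  next
    case False
    then show ?thesis using S[of x] that by simp
  qed
  assume "coef m \<noteq> 0"
  moreover have "(3 + m) mod 5 = 0" using assms by presburger
  ultimately have "b m \<noteq> 0" by (simp add: b_def)
  moreover have "m > 0" using assms by (cases m) auto
  ultimately obtain s :: real where s: "s > 0" "\<And>z :: complex. z \<in> cball 0 s - {0} \<Longrightarrow> (0 :: complex) \<noteq> 0"
    using powser_0_nonzero[of 1 0 b "\<lambda>_. 0" m, OF _ sm] by auto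
  have "of_real s \<in> cball (0 :: complex) s - {0}" using s(1) by simp
  from s(2)[OF this] show False by simp
qed

theorem theorem1p3:
  fixes n :: nat
  shows "M_omega 1 5 (5 * n + 2) - M_omega 4 5 (5 * n + 2)
       = 2 * NT 3 5 (5 * n + 2) - 2 * NT 2 5 (5 * n + 2)"
proof -
  have "coef (5 * n + 2) = 0" by (rule coef_eq_0) presburger
  then show ?thesis using NT_diff_eq_rank_sum[of "5 * n + 2"] unfolding coef_def by simp
qed

end
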